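(* For $|q|<1$ the following identities hold: \[ \psi(q)\bigl(\phi(q)^2-\phi(q^7)^2\bigr) = 4q\psi(q^2)\psi(q^7)\phi(q^7)+8q^2\psi(q^{14})\psi(q^3)\phi(q^{21})+8q^4\psi(q^{14})f(q,q^2)f(q^7,q^{35}), \] and \[ 7\phi(q^7)^2\psi(q^7) = 8q^2\psi(q^2)\psi(q^{21})\phi(q^3)+8\psi(q^2)f(q,q^5)f(q^7,q^{14})-4q\psi(q^{14})\psi(q)\phi(q)- \psi(q^7)\phi(q)^2. \]
   Context: Ramanujan's general theta function is $f(a,b)=\sum_{n=-\infty}^{\infty}a^{n(n-1)/2}b^{n(n+1)/2}$ for $|ab|<1$. Further $\phi(q):=f(q,q)=\sum_{n\in\mathbb Z}q^{n^2}$ and $\psi(q):=f(q,q^3)=\sum_{n\ge 0}q^{n(n+1)/2}$. *)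

theory Defs
  imports "HOL-Analysis.Analysis"
begin

(* Both exponents are nonnegative and both divisions by 2 are exact for every integer n.
   The sum is absolutely convergent for norm (a * b) < 1 (also when a = 0 or b = 0, where
   0 powi 0 = 1); otherwise the value carries no meaning. *)
definition theta_f :: "complex \<Rightarrow> complex \<Rightarrow> complex" where
  "theta_f a b =
     (\<Sum>\<^sub>\<infinity>n\<in>(UNIV :: int set). a powi (n * (n - 1) div 2) * b powi (n * (n + 1) div 2))"

definition theta_phi :: "complex \<Rightarrow> complex" where
  "theta_phi q = theta_f q q"

definition theta_psi :: "complex \<Rightarrow> complex" where
  "theta_psi q = theta_f q (q ^ 3)"

end

theory Submission
  imports
    Defs
    "HOL-Complex_Analysis.Complex_Analysis"
    "HOL-Probability.Characteristic_Functions"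
    "HOL-Real_Asymp.Real_Asymp"
begin

text \<open>
  Up to powers of \<open>q\<close>, every term is a theta series of a positive ternary lattice. The terms containing
  \<open>f q (q^2)\<close> or \<open>f q (q^5)\<close>, together with their neighbours, are theta series of lattices which split off a
  vector of norm 14 (or 2) and glue the remaining two coordinates modulo 3; in the coordinates of
  \<open>m\<^sup>2 + 8 y\<^sup>2 + 8 z\<^sup>2\<close> they are cut out by conditions modulo 7 attached to an isotropic line. Both
  identities thereby become one statement: four functions \<open>F23 p u\<close>, \<open>u = 0, \<dots>, 3\<close>, built from residue classes
  modulo 7, vanish; the component \<open>u = 0\<close> is the second identity and the component 0 of the finite Fourier
  transform is the first.

  By Poisson summation these functions and their images under the modular group form a finite family
  on which \<open>\<tau> \<mapsto> -1/\<tau>\<close> and \<open>\<tau> \<mapsto> \<tau> + 1\<close> act, up to weight 3/2, by unitary matrices. A few initial coefficients show that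
  all members vanish to high order at the cusp, and then the maximum principle forces them to be 0.
\<close>

text \<open>The single products are modular forms of a level with many cusps. Dissection into
  residue classes modulo 7 turns them into vectors with four components (the even functions modulo 7
  have dimension four) on which the full modular group acts. Since it acts unitarily up to the
  weight, only the norm of a vector at a single cusp has to be controlled.

  What links the vectors to the lattices is a count: x1^2 + x2^2 + x3^2 has exactly eight isotropic
  lines modulo 7, all equivalent under sign changes and the exchange of x2 and x3, which are
  symmetries of a product of even functions g, k, k. Counting the lines orthogonal to a vector
  converts sums over one line or one plane into \<open>tri\<close>.

  The denominator in \<open>nome\<close> is 112 = 2 * 8 * 7: the 8 comes from \<theta>_2, the 2 from
  its half argument in \<open>th23\<close>, the 7 from the dissection; thus every exponent is an
  integer. The digits in \<open>k4\<close>, \<open>g34\<close>, \<open>F23\<close> refer to Jacobi's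
  \<theta>_2, \<theta>_3, \<theta>_4, which the modular group permutes; hence the vanishing of
  \<open>F23\<close> is proved together with that of its companions.\<close>

lemma holomorphic_on_infsum:
  fixes f :: "'a \<Rightarrow> complex \<Rightarrow> complex"
  assumes U: "open U" and f: "\<And>n. f n holomorphic_on U"
    and M: "\<And>z. z \<in> U \<Longrightarrow> \<exists>r>0. cball z r \<subseteq> U \<and>
      (\<exists>M. M summable_on UNIV \<and> (\<forall>n. \<forall>w\<in>cball z r. norm (f n w) \<le> M n))"
  shows "(\<lambda>z. \<Sum>\<^sub>\<infinity>n. f n z) holomorphic_on U"
proof -
  have "(\<lambda>z. \<Sum>\<^sub>\<infinity>n. f n z) field_differentiable (at z)" if z: "z \<in> U" for z
  proof -
    obtain r M where r: "r > 0" "cball z r \<subseteq> U" and M: "M summable_on UNIV"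
      "\<And>n w. w \<in> cball z r \<Longrightarrow> norm (f n w) \<le> M n"
      using M[OF z] by blast
    have ul: "uniform_limit (cball z r) (\<lambda>X y. \<Sum>x\<in>X. f x y) (\<lambda>y. \<Sum>\<^sub>\<infinity>x. f x y) (finite_subsets_at_top UNIV)"
      using M by (intro Weierstrass_m_test_general) auto
    have fin: "(\<lambda>y. \<Sum>x\<in>X. f x y) holomorphic_on U" for X
      using f by (intro holomorphic_intros) auto
    have "(\<lambda>z. \<Sum>\<^sub>\<infinity>n. f n z) holomorphic_on ball z r"
    proof (rule holomorphic_uniform_limit[OF _ ul])
      show "\<forall>\<^sub>F X in finite_subsets_at_top UNIV. continuous_on (cball z r) (\<lambda>y. \<Sum>x\<in>X. f x y) \<and>
          (\<lambda>y. \<Sum>x\<in>X. f x y) holomorphic_on ball z r"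
        using holomorphic_on_subset[OF fin r(2)] r(2) ball_subset_cball
        by (intro always_eventually allI conjI holomorphic_on_imp_continuous_on)
           (blast intro: holomorphic_on_subset)+
    qed auto
    then show ?thesis
      using r by (meson centre_in_ball holomorphic_on_imp_differentiable_at open_ball)
  qed
  then show ?thesis
    using U by (simp add: holomorphic_on_def field_differentiable_at_within)
qed

lemma summable_on_power_abs_int:
  fixes r :: real
  assumes "0 \<le> r" "r < 1"
  shows "(\<lambda>n::int. r ^ nat \<bar>n\<bar>) summable_on UNIV"
proof -
  have "summable (\<lambda>n. r ^ n)"
    using assms by (simp add: summable_geometric)
  then have s: "(\<lambda>n::nat. r ^ n) summable_on UNIV"
    using assms by (simp add: summable_nonneg_imp_summable_on)
  have a: "(\<lambda>n::int. r ^ nat \<bar>n\<bar>) summable_on (range int)"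
    using s by (subst summable_on_reindex) (auto simp: o_def)
  have b: "(\<lambda>n::int. r ^ nat \<bar>n\<bar>) summable_on (range (\<lambda>n. - int n))"
    using s by (subst summable_on_reindex) (auto simp: o_def inj_def)
  have "UNIV = range int \<union> range (\<lambda>n. - int n)"
    by (auto intro: int_cases2)
  then show ?thesis
    using summable_on_union[OF a b] by simp
qed

section \<open>Poisson summation for Gaussians\<close>

text \<open>The telescoping proof: with \<open>f z - f 0 = (exp (2 \<pi> \<i> z) - 1) * g z\<close> the Fourier coefficients of
  \<open>f\<close> are differences of consecutive Fourier coefficients of \<open>g\<close>, and the latter tend to 0.\<close>

lemma fourier_series_at_0:
  fixes f :: "complex \<Rightarrow> complex"
  assumes f: "f holomorphic_on UNIV" and per: "\<And>z. f (z + 1) = f z"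
  defines "F \<equiv> \<lambda>k::int. integral {-1/2..1/2} (\<lambda>x::real. f (of_real x) * exp (- (2 * of_real pi * \<i> * of_int k * of_real x)))"
  shows "(\<lambda>N::nat. \<Sum>k=-int N..int N. F k) \<longlonglongrightarrow> f 0"
proof -
  \<comment> \<open>In this strip \<open>e z = 1\<close> holds only at z = 0, where the zero is
    simple; hence the quotient \<open>g\<close> below is holomorphic on the whole strip.\<close>
  define U where "U = {z::complex. \<bar>Re z\<bar> < 1}"
  have U: "open U"
  proof -
    have "U = {z. Re z < 1} \<inter> {z. Re z > -1}" by (auto simp: U_def)
    then show ?thesis by (simp add: open_halfspace_Re_lt open_halfspace_Re_gt open_Int)
  qed
  define e where "e = (\<lambda>z::complex. exp (2 * of_real pi * \<i> * z))"
  define q where "q = (\<lambda>z. if z = 0 then deriv f 0 else (f z - f 0) / (z - 0))"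
  define k where "k = (\<lambda>z. if z = 0 then deriv e 0 else (e z - e 0) / (z - 0))"
  have ehol: "e holomorphic_on UNIV" unfolding e_def by (intro holomorphic_intros)
  have de: "deriv e 0 = 2 * of_real pi * \<i>"
    unfolding e_def by (rule DERIV_imp_deriv) (auto intro!: derivative_eq_intros)
  have q: "q holomorphic_on U" unfolding q_def
    by (rule pole_lemma_open[OF _ U]) (use f in \<open>auto intro: holomorphic_on_subset\<close>)
  have k: "k holomorphic_on U" unfolding k_def
    by (rule pole_lemma_open[OF _ U]) (use ehol in \<open>auto intro: holomorphic_on_subset\<close>)
  have knz: "k z \<noteq> 0" if "z \<in> U" for z
  proof (cases "z = 0")
    case True then show ?thesis by (simp add: k_def de)
  next
    case False
    have "e z \<noteq> 1"
    proof
      assume "e z = 1"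
      then obtain n :: int where "Im z = 0" "Re z = of_int n"
        unfolding e_def exp_eq_1 by auto
      then show False using that False by (auto simp: U_def complex_eq_iff)
    qed
    then show ?thesis using False by (simp add: k_def e_def)
  qed
  define g where "g = (\<lambda>z. q z / k z)"
  have g: "g holomorphic_on U" unfolding g_def
    by (intro holomorphic_intros q k knz)
  have gf: "g z * (e z - 1) = f z - f 0" if "z \<in> U" for z
    using knz[OF that] by (auto simp: g_def q_def k_def e_def divide_simps)
  have inU: "of_real x \<in> U" if "x \<in> {-1/2..1/2}" for x using that by (auto simp: U_def)
  have ghalf: "g (1/2) = g (-1/2)"
  proof -
    have "f (1/2) = f (-1/2)" using per[of "-1/2"] by simp
    moreover have "e (1/2) = -1" "e (-1/2) = -1"
      by (auto simp: e_def exp_minus algebra_simps)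
    ultimately show ?thesis
      using gf[of "1/2"] gf[of "-1/2"] by (simp add: U_def) (metis mult_cancel_right neg_equal_iff_equal zero_neq_numeral)
  qed
  define E where "E = (\<lambda>(k::int) (x::real). exp (- (2 * of_real pi * \<i> * of_int k * of_real x)))"
  have contE: "continuous_on S (E k)" for S k unfolding E_def by (intro continuous_intros)
  let ?U = "{-1/2..1/2::real}"
  have contg: "continuous_on ?U (\<lambda>x::real. g (of_real x))"
    by (rule continuous_on_compose2[OF holomorphic_on_imp_continuous_on[OF g]]) (auto intro!: continuous_intros simp: U_def)
  have g': "deriv g holomorphic_on U" using g U by (rule holomorphic_deriv)
  have contg': "continuous_on ?U (\<lambda>x::real. deriv g (of_real x))"
    by (rule continuous_on_compose2[OF holomorphic_on_imp_continuous_on[OF g']]) (auto intro!: continuous_intros simp: U_def)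
  define G where "G = (\<lambda>k::int. integral ?U (\<lambda>x::real. g (of_real x) * E k x))"
  have contf: "continuous_on ?U (\<lambda>x::real. f (of_real x))"
    by (rule continuous_on_compose2[OF holomorphic_on_imp_continuous_on[OF f]]) (auto intro!: continuous_intros)
  have Eper: "E k (1/2) = E k (-1/2)" for k
  proof -
    have "exp (- (2 * of_real pi * \<i> * of_int k)) = (1::complex)"
      by (auto simp: exp_eq_1 intro: exI[of _ "-k"])
    then have "exp (of_real pi * \<i> * of_int k + - (2 * of_real pi * \<i> * of_int k)) = exp (of_real pi * \<i> * of_int k :: complex)"
      by (subst exp_add) simp
    then show ?thesis unfolding E_def by (simp add: algebra_simps)
  qed
  have intE: "integral ?U (E k) = (if k = 0 then 1 else 0)" for k :: int
  proof (cases "k = 0")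
    case True then show ?thesis by (simp add: E_def)
  next
    case False
    have "((\<lambda>x. E k x) has_integral
       (E k (1/2) / (- (2 * of_real pi * \<i> * of_int k)) - E k (-1/2) / (- (2 * of_real pi * \<i> * of_int k)))) ?U"
    proof (rule fundamental_theorem_of_calculus)
      fix x :: real assume "x \<in> ?U"
      have "((\<lambda>z. exp (- (2 * of_real pi * \<i> * of_int k * z)) / (- (2 * of_real pi * \<i> * of_int k))) has_field_derivative E k x) (at (of_real x))"
        using False unfolding E_def by (auto intro!: derivative_eq_intros simp: field_simps)
      then show "((\<lambda>x. E k x / (- (2 * of_real pi * \<i> * of_int k))) has_vector_derivative E k x) (at x within ?U)"
        unfolding E_def by (rule has_vector_derivative_real_field)
    qed simp
    then show ?thesis using False Eper[of k] by (simp add: integral_unique)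
  qed
  have rec: "F k = G (k - 1) - G k + (if k = 0 then f 0 else 0)" for k
  proof -
    have eq: "f (of_real x) * E k x = g (of_real x) * E (k-1) x - g (of_real x) * E k x + f 0 * E k x"
      if "x \<in> ?U" for x
    proof -
      have "E (k-1) x = e (of_real x) * E k x"
        unfolding E_def e_def by (simp add: exp_add[symmetric] algebra_simps)
      moreover have "f (of_real x) = g (of_real x) * (e (of_real x) - 1) + f 0"
        using gf[OF inU[OF that]] by simp
      ultimately show ?thesis by (simp only:) (simp add: algebra_simps)
    qed
    have "F k = integral ?U (\<lambda>x. g (of_real x) * E (k-1) x - g (of_real x) * E k x + f 0 * E k x)"
      unfolding F_def by (rule integral_cong) (use eq in \<open>simp add: E_def\<close>)
    also have "\<dots> = integral ?U (\<lambda>x. g (of_real x) * E (k-1) x) - integral ?U (\<lambda>x. g (of_real x) * E k x) + f 0 * integral ?U (E k)"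
      by (subst Henstock_Kurzweil_Integration.integral_add, (rule integrable_continuous_real, intro continuous_intros contg contE)+,
          subst Henstock_Kurzweil_Integration.integral_diff, (rule integrable_continuous_real, intro continuous_intros contg contE)+) auto
    finally show ?thesis unfolding G_def intE by simp
  qed
  \<comment> \<open>Integration by parts: \<open>g\<close> and \<open>E k\<close> take equal values
    at the two ends of the interval, so the boundary terms cancel and the coefficients decay like
    1/k.\<close>
  have Gsmall: "norm (G k) \<le> C / (2 * pi * \<bar>real_of_int k\<bar>)"
    if k: "k \<noteq> 0" and C: "C = integral ?U (\<lambda>x. norm (deriv g (complex_of_real x)))" for k C
  proof -
    let ?c = "2 * of_real pi * \<i> * of_int k :: complex"
    have "((\<lambda>x. deriv g (of_real x) * E k x - ?c * (g (of_real x) * E k x)) has_integral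
       (g (of_real (1/2)) * E k (1/2) - g (of_real (-1/2)) * E k (-1/2))) ?U"
    proof (rule fundamental_theorem_of_calculus)
      fix x :: real assume x: "x \<in> ?U"
      have "(g has_field_derivative deriv g (of_real x)) (at (of_real x))"
        using g U inU[OF x] by (rule holomorphic_derivI)
      then have "((\<lambda>z. g z * exp (- (2 * of_real pi * \<i> * of_int k * z))) has_field_derivative
          (deriv g (of_real x) * E k x - ?c * (g (of_real x) * E k x))) (at (of_real x))"
        unfolding E_def by (auto intro!: derivative_eq_intros simp: algebra_simps)
      then show "((\<lambda>x. g (of_real x) * E k x) has_vector_derivative
          (deriv g (of_real x) * E k x - ?c * (g (of_real x) * E k x))) (at x within ?U)"
        unfolding E_def by (rule has_vector_derivative_real_field)
    qed simp
    then have "integral ?U (\<lambda>x. deriv g (of_real x) * E k x - ?c * (g (of_real x) * E k x)) = 0"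
      using ghalf Eper[of k] by (simp add: integral_unique)
    moreover have "integral ?U (\<lambda>x. deriv g (of_real x) * E k x - ?c * (g (of_real x) * E k x)) =
       integral ?U (\<lambda>x. deriv g (of_real x) * E k x) - ?c * G k"
      unfolding G_def
      by (subst Henstock_Kurzweil_Integration.integral_diff, (rule integrable_continuous_real, intro continuous_intros contg contg' contE)+) auto
    ultimately have "?c * G k = integral ?U (\<lambda>x. deriv g (of_real x) * E k x)" by simp
    moreover have "norm (integral ?U (\<lambda>x. deriv g (of_real x) * E k x)) \<le> C"
      unfolding C
    proof (rule integral_norm_bound_integral)
      show "(\<lambda>x. deriv g (complex_of_real x) * E k x) integrable_on ?U"
        by (rule integrable_continuous_real, intro continuous_intros contg' contE)
      show "(\<lambda>x. cmod (deriv g (complex_of_real x))) integrable_on ?U"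
        by (rule integrable_continuous_real, intro continuous_intros contg' contE)
    qed (simp add: E_def norm_mult)
    ultimately have "norm (?c * G k) \<le> C" by simp
    then show ?thesis using k by (simp add: norm_mult field_simps)
  qed
  define C where "C = integral ?U (\<lambda>x. norm (deriv g (complex_of_real x)))"
  have sum: "(\<Sum>k=-int N..int N. F k) = f 0 + G (- int N - 1) - G (int N)" for N :: nat
  proof (induction N)
    case 0 then show ?case using rec[of 0] by simp
  next
    case (Suc N)
    have "{- int (Suc N)..int (Suc N)} = insert (- int (Suc N)) (insert (int (Suc N)) {- int N..int N})"
      by auto
    moreover have "- int N - 1 = - 1 - int N" by simp
    ultimately show ?case
      using Suc[unfolded \<open>- int N - 1 = - 1 - int N\<close>] rec[of "int (Suc N)"] rec[of "- int (Suc N)"] by simp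
  qed
  have l1: "(\<lambda>N. G (int N)) \<longlonglongrightarrow> 0"
  proof (rule Lim_null_comparison)
    show "\<forall>\<^sub>F N in sequentially. norm (G (int N)) \<le> C / (2 * pi * real N)"
      using eventually_gt_at_top[of 0]
    proof eventually_elim
      case (elim N) then show ?case using Gsmall[OF _ C_def, of "int N"] by simp
    qed
    show "(\<lambda>N. C / (2 * pi * real N)) \<longlonglongrightarrow> 0" by real_asymp
  qed
  have l2: "(\<lambda>N. G (- int N - 1)) \<longlonglongrightarrow> 0"
  proof (rule Lim_null_comparison)
    show "\<forall>\<^sub>F N in sequentially. norm (G (- int N - 1)) \<le> C / (2 * pi * (real N + 1))"
    proof (intro always_eventually allI)
      fix N
      have "\<bar>real_of_int (- int N - 1)\<bar> = real N + 1" by simp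
      then show "norm (G (- int N - 1)) \<le> C / (2 * pi * (real N + 1))"
        using Gsmall[OF _ C_def, of "- int N - 1"] by (simp only:)
    qed
    show "(\<lambda>N. C / (2 * pi * (real N + 1))) \<longlonglongrightarrow> 0" by real_asymp
  qed
  have "(\<lambda>N. f 0 + G (- int N - 1) - G (int N)) \<longlonglongrightarrow> f 0 + 0 - 0"
    by (intro tendsto_intros l1 l2)
  then show ?thesis by (simp add: sum)
qed

lemma filterlim_symmetric_intervals:
  "filterlim (\<lambda>m::nat. {- int m..int m}) (finite_subsets_at_top UNIV) sequentially"
  unfolding filterlim_finite_subsets_at_top
proof (intro allI impI)
  fix X :: "int set" assume "finite X \<and> X \<subseteq> UNIV"
  then have X: "finite X" by simp
  define M where "M = Max (insert 0 ((\<lambda>n. nat \<bar>n\<bar>) ` X))"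
  have M: "nat \<bar>n\<bar> \<le> M" if "n \<in> X" for n
    unfolding M_def using X that by (intro Max_ge) auto
  have "X \<subseteq> {- int m..int m}" if "m \<ge> M" for m
    using M that by fastforce
  then show "\<forall>\<^sub>F y in sequentially. finite {- int y..int y} \<and> X \<subseteq> {- int y..int y} \<and> {- int y..int y} \<subseteq> UNIV"
    by (intro eventually_mono[OF eventually_ge_at_top[of M]]) auto
qed

text \<open>After rescaling by d = sqrt (2 c) this is the characteristic function of the standard
  normal distribution.\<close>

lemma gaussian_fourier_transform:
  fixes c u :: real
  assumes c: "c > 0"
  shows "integrable lborel (\<lambda>x. exp (of_real (- c * x\<^sup>2)) * exp (\<i> * of_real (u * x)))"
    and "(LINT x|lborel. exp (of_real (- c * x\<^sup>2)) * exp (\<i> * of_real (u * x))) = of_real (sqrt (pi / c) * exp (- u\<^sup>2 / (4 * c)))"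
proof -
  define d where "d = sqrt (2 * c)"
  have d: "d > 0" "d\<^sup>2 = 2 * c" using c by (auto simp: d_def)
  define h where "h = (\<lambda>x. std_normal_density x *\<^sub>R iexp ((u / d) * x))"
  have hi: "integrable lborel h"
  proof -
    have "integrable lborel (\<lambda>x. std_normal_density x *\<^sub>R (1::real))"
      using integrable_normal_density[of 1 0] by simp
    then have "integrable lborel (\<lambda>x. std_normal_density x)" by simp
    then show ?thesis unfolding h_def
      by (rule Bochner_Integration.integrable_bound) (auto simp: norm_mult)
  qed
  have "char std_normal_distribution (u / d) = LINT x|lborel. h x"
    unfolding char_def h_def by (subst integral_density) auto
  then have hI: "(LINT x|lborel. h x) = of_real (exp (- (u / d)\<^sup>2 / 2))"
    by (simp add: char_std_normal_distribution)
  let ?f = "\<lambda>x. exp (of_real (- c * x\<^sup>2)) * exp (\<i> * of_real (u * x)) :: complex"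
  have conv: "?f x = of_real (sqrt (2 * pi)) * h (0 + d * x)" for x
  proof -
    have "std_normal_density (d * x) = exp (- c * x\<^sup>2) / sqrt (2 * pi)"
      unfolding normal_density_def using d by (simp add: power_mult_distrib)
    then show ?thesis unfolding h_def using d(1)
      by (simp add: scaleR_conv_of_real exp_of_real[symmetric])
  qed
  show "integrable lborel ?f"
    unfolding conv using lborel_integrable_real_affine[OF hi, of d 0] d by simp
  have "(LINT x|lborel. h x) = \<bar>d\<bar> *\<^sub>R (LINT x|lborel. h (0 + d * x))"
    by (rule lborel_integral_real_affine) (use d in simp)
  then have "(LINT x|lborel. h (0 + d * x)) = of_real (exp (- (u / d)\<^sup>2 / 2) / d)"
    using hI d by (simp add: scaleR_conv_of_real field_simps)
  then have "(LINT x|lborel. ?f x) = of_real (sqrt (2 * pi) * (exp (- (u / d)\<^sup>2 / 2) / d))"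
    unfolding conv by simp
  also have "sqrt (2 * pi) * (exp (- (u / d)\<^sup>2 / 2) / d) = sqrt (pi / c) * exp (- u\<^sup>2 / (4 * c))"
    using c d by (simp add: power_divide d_def real_sqrt_mult real_sqrt_divide)
  finally show "(LINT x|lborel. ?f x) = of_real (sqrt (pi / c) * exp (- u\<^sup>2 / (4 * c)))" .
qed

text \<open>The inequality (|Re z + n| - 1)^2 \<ge> 0 trades the quadratic exponent for a linear
  one, so a geometric series in |n| dominates the periodised Gaussian uniformly on discs.\<close>

lemma norm_gaussian_shift_le:
  fixes z :: complex and c R :: real and n :: int
  assumes c: "c > 0" and z: "norm z \<le> R"
  shows "norm (exp (- (of_real c * (z + of_int n)\<^sup>2))) \<le> exp (c * (R\<^sup>2 + 2 * R + 1)) * exp (- 2 * c) ^ nat \<bar>n\<bar>"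
proof -
  have "norm (exp (- (of_real c * (z + of_int n)\<^sup>2))) = exp (- c * ((Re z + n)\<^sup>2 - (Im z)\<^sup>2))"
    by (simp add: power2_eq_square)
  moreover have "- c * ((Re z + n)\<^sup>2 - (Im z)\<^sup>2) \<le> c * (R\<^sup>2 + 2 * R + 1) + real (nat \<bar>n\<bar>) * (- 2 * c)"
  proof -
    have [simp]: "real (nat \<bar>n\<bar>) = \<bar>real_of_int n\<bar>" by simp
    have R: "\<bar>Re z\<bar> \<le> R" "\<bar>Im z\<bar> \<le> R"
      using z abs_Re_le_cmod[of z] abs_Im_le_cmod[of z] by linarith+
    have 1: "(Im z)\<^sup>2 \<le> R\<^sup>2" using R(2) by (metis abs_ge_zero power2_abs power_mono)
    have "(\<bar>Re z + n\<bar> - 1)\<^sup>2 \<ge> 0" by simp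
    then have 2: "2 * \<bar>Re z + n\<bar> - 1 \<le> (Re z + n)\<^sup>2"
      by (simp add: power2_diff)
    have 3: "\<bar>real_of_int n\<bar> - R \<le> \<bar>Re z + n\<bar>" using R by linarith
    have "a - d \<le> r + 2 * R + 1 - 2 * e" if "a \<le> r" "2 * b - 1 \<le> d" "e - R \<le> b" for a b d e r :: real
      using that by linarith
    from this[OF 1 2 3] have "(Im z)\<^sup>2 - (Re z + n)\<^sup>2 \<le> R\<^sup>2 + 2 * R + 1 - 2 * \<bar>real_of_int n\<bar>" .
    then have "c * ((Im z)\<^sup>2 - (Re z + n)\<^sup>2) \<le> c * (R\<^sup>2 + 2 * R + 1 - 2 * \<bar>real_of_int n\<bar>)"
      using c by (intro mult_left_mono) auto
    then show ?thesis by (simp add: algebra_simps)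
  qed
  moreover have "exp (c * (R\<^sup>2 + 2 * R + 1) + real (nat \<bar>n\<bar>) * (- 2 * c)) = exp (c * (R\<^sup>2 + 2 * R + 1)) * exp (- 2 * c) ^ nat \<bar>n\<bar>"
    by (simp only: exp_add exp_of_nat_mult)
  ultimately show ?thesis by (metis exp_le_cancel_iff)
qed

lemma abs_le_square_int: "\<bar>n\<bar> \<le> n\<^sup>2" for n :: int
  using mult_left_mono[of 1 "\<bar>n\<bar>" "\<bar>n\<bar>"] by (cases "n = 0") (simp_all add: power2_eq_square)

text \<open>The periodised Gaussian is entire with period 1, so its value is the sum of its Fourier
  series; each Fourier coefficient unfolds from the unit interval to an integral over the real
  line.\<close>

lemma poisson_gaussian_real:
  fixes a c :: real
  assumes c: "c > 0"
  shows "(\<Sum>\<^sub>\<infinity>n::int. exp (of_real (- c * (a + of_int n)\<^sup>2))) =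
    (of_real (sqrt (pi / c)) :: complex) *
      (\<Sum>\<^sub>\<infinity>k::int. of_real (exp (- (pi\<^sup>2 * (of_int k)\<^sup>2 / c))) * exp (of_real (2 * pi * a * of_int k) * \<i>))"
proof -
  define B where "B = (\<lambda>z::complex. \<Sum>\<^sub>\<infinity>n::int. exp (- (of_real c * (z + of_int n)\<^sup>2)))"
  \<comment> \<open>The shift is absorbed into the function, so that convergence of the Fourier
    series is needed at 0 only.\<close>
  define f where "f = (\<lambda>z. B (z + of_real a))"
  have sumM: "(\<lambda>n::int. exp (c * (R\<^sup>2 + 2 * R + 1)) * exp (- 2 * c) ^ nat \<bar>n\<bar>) summable_on UNIV" for R
    by (intro summable_on_cmult_right summable_on_power_abs_int) (use c in auto)
  have B: "B holomorphic_on UNIV"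
    unfolding B_def
  proof (rule holomorphic_on_infsum)
    fix z :: complex
    show "\<exists>r>0. cball z r \<subseteq> UNIV \<and> (\<exists>M. M summable_on UNIV \<and>
      (\<forall>n::int. \<forall>w\<in>cball z r. norm (exp (- (of_real c * (w + of_int n)\<^sup>2))) \<le> M n))"
    proof (intro exI[of _ 1] conjI exI allI ballI)
      fix n :: int and w assume w: "w \<in> cball z 1"
      have "norm w \<le> norm z + 1" using w norm_triangle_ineq2[of w z] by (auto simp: dist_norm norm_minus_commute)
      then show "norm (exp (- (of_real c * (w + of_int n)\<^sup>2))) \<le> exp (c * ((norm z + 1)\<^sup>2 + 2 * (norm z + 1) + 1)) * exp (- 2 * c) ^ nat \<bar>n\<bar>"
        using norm_gaussian_shift_le[OF c] by blast
    qed (use sumM[of "norm z + 1"] in \<open>simp_all only: subset_UNIV zero_less_one\<close>)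
  qed (auto intro!: holomorphic_intros)
  have "(B \<circ> (\<lambda>z. z + of_real a)) holomorphic_on UNIV"
    by (rule holomorphic_on_compose_gen[OF _ B]) (auto intro!: holomorphic_intros)
  then have f: "f holomorphic_on UNIV" by (simp add: f_def o_def)
  have per: "f (z + 1) = f z" for z
  proof -
    have "B (w + 1) = B w" for w
      using infsum_reindex_bij_betw[OF bij_plus_right[of 1], of "\<lambda>n. exp (- (of_real c * (w + of_int n)\<^sup>2))"]
      by (simp add: B_def add_ac)
    from this[of "z + of_real a"] show ?thesis by (simp add: f_def add_ac)
  qed
  define E where "E = (\<lambda>(k::int) (x::real). exp (- (2 * of_real pi * \<i> * of_int k * of_real x)))"
  let ?U = "{-1/2..1/2::real}"
  define F where "F = (\<lambda>k::int. integral ?U (\<lambda>x::real. f (of_real x) * E k x))"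
  define \<phi> where "\<phi> = (\<lambda>(k::int) (x::real). exp (- of_real (c * (x + a)\<^sup>2)) * E k x)"
  define L where "L = (\<lambda>k::int. of_real (sqrt (pi / c)) * (of_real (exp (- (pi\<^sup>2 * (of_int k)\<^sup>2 / c))) * exp (of_real (2 * pi * a * of_int k) * \<i>)) :: complex)"
  have int\<phi>: "integrable lborel (\<phi> k)" "integral\<^sup>L lborel (\<phi> k) = L k" for k
  proof -
    define u where "u = - 2 * pi * of_int k"
    have eq: "\<phi> k x = exp (- \<i> * of_real (u * a)) * (exp (of_real (- c * (a + 1 * x)\<^sup>2)) * exp (\<i> * of_real (u * (a + 1 * x))))" for x
      unfolding \<phi>_def E_def u_def by (simp add: exp_add[symmetric] algebra_simps)
    note G = gaussian_fourier_transform[OF c, of u]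
    have i: "integrable lborel (\<lambda>x. exp (of_real (- c * (a + 1 * x)\<^sup>2)) * exp (\<i> * of_real (u * (a + 1 * x))))"
      by (rule lborel_integrable_real_affine[OF G(1)]) simp
    show "integrable lborel (\<phi> k)" unfolding eq using i by simp
    have "(LINT x|lborel. exp (of_real (- c * (a + 1 * x)\<^sup>2)) * exp (\<i> * of_real (u * (a + 1 * x)))) = of_real (sqrt (pi / c) * exp (- u\<^sup>2 / (4 * c)))"
      using lborel_integral_real_affine[of 1 "\<lambda>x. exp (of_real (- c * x\<^sup>2)) * exp (\<i> * of_real (u * x))" a] G(2) by simp
    then have "integral\<^sup>L lborel (\<phi> k) = exp (- \<i> * of_real (u * a)) * of_real (sqrt (pi / c) * exp (- u\<^sup>2 / (4 * c)))"
      unfolding eq by simp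
    also have "- u\<^sup>2 / (4 * c) = - (pi\<^sup>2 * (of_int k)\<^sup>2 / c)" by (simp add: u_def power_mult_distrib)
    also have "- \<i> * of_real (u * a) = of_real (2 * pi * a * of_int k) * \<i>" by (simp add: u_def)
    finally show "integral\<^sup>L lborel (\<phi> k) = L k" by (simp add: L_def)
  qed
  have cont\<phi>: "continuous_on S (\<phi> k)" for S k unfolding \<phi>_def E_def by (intro continuous_intros)
  have F_eq: "F k = L k" for k
  proof -
    define h where "h = (\<lambda>(n::int) x. exp (- (of_real c * (of_real x + of_real a + of_int n)\<^sup>2)) * E k x)"
    have "((\<lambda>X. \<Sum>n\<in>X. integral ?U (h n)) \<longlongrightarrow> F k) (finite_subsets_at_top UNIV)"
    proof -
      have "uniform_limit ?U (\<lambda>X x. \<Sum>n\<in>X. h n x)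
             (\<lambda>x. \<Sum>\<^sub>\<infinity>n. h n x) (finite_subsets_at_top UNIV)"
      proof (rule Weierstrass_m_test_general)
        fix n :: int and x :: real assume x: "x \<in> ?U"
        have "norm (of_real x + of_real a :: complex) \<le> 1 + \<bar>a\<bar>"
          using x by (intro order_trans[OF norm_triangle_ineq]) auto
        from norm_gaussian_shift_le[OF c this, of n]
        show "norm (h n x) \<le> exp (c * ((1 + \<bar>a\<bar>)\<^sup>2 + 2 * (1 + \<bar>a\<bar>) + 1)) * exp (- 2 * c) ^ nat \<bar>n\<bar>"
          by (simp add: norm_mult E_def h_def)
      qed (rule sumM)
      moreover have "(\<Sum>\<^sub>\<infinity>n. h n x) = f (of_real x) * E k x" for x
        unfolding f_def B_def h_def by (rule infsum_cmult_left')
      ultimately have ul: "uniform_limit ?U (\<lambda>X x. \<Sum>n\<in>X. h n x)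
             (\<lambda>x. f (of_real x) * E k x) (finite_subsets_at_top UNIV)" by simp
      have ic: "(h n) integrable_on ?U" for n :: int
        unfolding E_def h_def by (intro integrable_continuous_real continuous_intros)
      have ucont: "continuous_on ?U (\<lambda>x. \<Sum>n\<in>X. h n x)" for X :: "int set"
        unfolding E_def h_def by (intro continuous_intros)
      obtain I J where I: "\<And>X. ((\<lambda>x. \<Sum>n\<in>X. h n x) has_integral I X) ?U"
        and J: "((\<lambda>x. f (of_real x) * E k x) has_integral J) ?U" and IJ: "(I \<longlongrightarrow> J) (finite_subsets_at_top UNIV)"
        by (rule uniform_limit_integral[OF ul ucont]) (rule finite_subsets_at_top_neq_bot, rule that)
      have "I X = (\<Sum>n\<in>X. integral ?U (h n))" if "finite X" for X
        by (rule has_integral_unique[OF I[of X] has_integral_sum[OF that integrable_integral[OF ic]]])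
      moreover have "J = F k" using J by (simp add: F_def integral_unique)
      ultimately show ?thesis using IJ
        by (auto elim!: Lim_transform_eventually intro: eventually_finite_subsets_at_top_weakI)
    qed
    from filterlim_compose[OF this filterlim_symmetric_intervals]
    have lim1: "(\<lambda>m. \<Sum>n=-int m..int m. integral ?U (h n)) \<longlonglongrightarrow> F k" .
    let ?I = "\<lambda>m. {- real m - 1/2..real m + 1/2}" and ?J = "\<lambda>n::int. integral {of_int n - 1/2..of_int n + 1/2} (\<phi> k)"
    have shift: "integral ?U (h n) = ?J n" for n :: int
    proof -
      have "((\<phi> k) has_integral ?J n) (cbox (of_int n - 1/2) (of_int n + 1/2))"
        using cont\<phi> by (auto intro: integrable_integral integrable_continuous_real)
      from has_integral_affinity[OF this, of 1 "of_int n"]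
      have "((\<lambda>x. \<phi> k (x + of_int n)) has_integral ?J n) ?U"
        by (simp add: algebra_simps)
      moreover have "\<phi> k (x + of_int n) = h n x" for x
      proof -
        have "exp (- (2 * of_real pi * \<i> * of_int k * of_int n)) = (1::complex)"
          by (auto simp: exp_eq_1 intro!: exI[of _ "- (k * n)"])
        then have "E k (x + of_int n) = E k x"
          unfolding E_def by (simp add: algebra_simps exp_diff exp_minus divide_inverse)
        then show ?thesis by (simp add: \<phi>_def h_def algebra_simps)
      qed
      ultimately show ?thesis by (simp add: integral_unique)
    qed
    have comb: "(\<Sum>n=-int m..int m. ?J n) = integral (?I m) (\<phi> k)" for m :: nat
    proof (induction m)
      case (Suc m)
      have "{- int (Suc m)..int (Suc m)} = insert (- int (Suc m)) (insert (int (Suc m)) {- int m..int m})"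
        by auto
      moreover have e: "- (1/2) - real m = - real m - 1/2" by simp
      ultimately have "(\<Sum>n=-int (Suc m)..int (Suc m). ?J n) =
        integral {- real (Suc m) - 1/2..- real m - 1/2} (\<phi> k) + (integral {real m + 1/2..real (Suc m) + 1/2} (\<phi> k) + integral (?I m) (\<phi> k))"
        using Suc by (simp add: algebra_simps) (simp only: e)
      also have "\<dots> = integral {- real (Suc m) - 1/2..- real m - 1/2} (\<phi> k) + integral {- real m - 1/2..real (Suc m) + 1/2} (\<phi> k)"
        using Henstock_Kurzweil_Integration.integral_combine[of "- real m - 1/2" "real m + 1/2" "real (Suc m) + 1/2" "\<phi> k"] cont\<phi>
        by (auto simp: integrable_continuous_real add.commute)
      also have "\<dots> = integral (?I (Suc m)) (\<phi> k)"
        using cont\<phi> by (intro Henstock_Kurzweil_Integration.integral_combine) (auto simp: integrable_continuous_real)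
      finally show ?case .
    qed simp
    have lim2: "(\<lambda>m. integral (?I m) (\<phi> k)) \<longlonglongrightarrow> L k"
    proof -
      have "(\<lambda>m. LINT x|lborel. indicator (?I m) x *\<^sub>R \<phi> k x) \<longlonglongrightarrow> (LINT x|lborel. \<phi> k x)"
      proof (rule integral_dominated_convergence[where w = "\<lambda>x. norm (\<phi> k x)"])
        show "AE x in lborel. (\<lambda>m. indicator (?I m) x *\<^sub>R \<phi> k x) \<longlonglongrightarrow> \<phi> k x"
        proof (intro AE_I2)
          fix x :: real
          have "\<forall>\<^sub>F m in sequentially. real m \<ge> \<bar>x\<bar>" by real_asymp
          then have "\<forall>\<^sub>F m in sequentially. indicator (?I m) x *\<^sub>R \<phi> k x = \<phi> k x"
            by eventually_elim (auto simp: indicator_def)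
          then show "(\<lambda>m. indicator (?I m) x *\<^sub>R \<phi> k x) \<longlonglongrightarrow> \<phi> k x"
            by (simp add: tendsto_eventually)
        qed
        show "AE x in lborel. norm (indicator (?I m) x *\<^sub>R \<phi> k x) \<le> norm (\<phi> k x)" for m
          by (auto simp: indicator_def)
      qed (use int\<phi>(1)[of k] in \<open>auto intro: borel_measurable_integrable\<close>)
      moreover have "(LINT x|lborel. indicator (?I m) x *\<^sub>R \<phi> k x) = integral (?I m) (\<phi> k)" for m
        using set_borel_integral_eq_integral(2)[of "(?I m)" "\<phi> k"]
          integrable_mult_indicator[OF _ int\<phi>(1)[of k], of "(?I m)"]
        unfolding set_lebesgue_integral_def set_integrable_def by simp
      ultimately show ?thesis by (simp add: int\<phi>)
    qed
    from lim1 have "(\<lambda>m. integral (?I m) (\<phi> k)) \<longlonglongrightarrow> F k" unfolding shift comb .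
    from LIMSEQ_unique[OF this lim2] show ?thesis .
  qed
  have Lsum: "L summable_on UNIV"
  proof (rule abs_summable_summable)
    have "(\<lambda>k::int. sqrt (pi / c) * exp (- (pi\<^sup>2 / c)) ^ nat \<bar>k\<bar>) summable_on UNIV"
      by (intro summable_on_cmult_right summable_on_power_abs_int) (use c in auto)
    then show "(\<lambda>k. norm (L k)) summable_on UNIV"
    proof (rule summable_on_comparison_test)
      fix k :: int
      have "\<bar>real_of_int k\<bar> \<le> (of_int k)\<^sup>2"
        using abs_le_square_int[of k] by (metis of_int_abs of_int_le_iff of_int_power)
      then have "pi\<^sup>2 / c * \<bar>real_of_int k\<bar> \<le> pi\<^sup>2 / c * (of_int k)\<^sup>2"
        using c by (intro mult_left_mono) auto
      then have "exp (- (pi\<^sup>2 * (of_int k)\<^sup>2 / c)) \<le> exp (- (pi\<^sup>2 / c)) ^ nat \<bar>k\<bar>"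
        by (simp add: exp_of_nat_mult[symmetric] mult.commute)
      then show "norm (L k) \<le> sqrt (pi / c) * exp (- (pi\<^sup>2 / c)) ^ nat \<bar>k\<bar>"
        unfolding L_def using c by (auto simp: norm_mult intro!: mult_left_mono)
    qed auto
  qed
  have "(\<lambda>N::nat. \<Sum>k=-int N..int N. F k) \<longlonglongrightarrow> f 0"
    unfolding F_def E_def by (rule fourier_series_at_0[OF f per])
  moreover have "(\<lambda>N::nat. \<Sum>k=-int N..int N. L k) \<longlonglongrightarrow> (\<Sum>\<^sub>\<infinity>k. L k)"
    using filterlim_compose[OF infsum_tendsto[OF Lsum] filterlim_symmetric_intervals] .
  ultimately have "f 0 = (\<Sum>\<^sub>\<infinity>k. L k)" by (simp add: F_eq LIMSEQ_unique)
  also have "f 0 = (\<Sum>\<^sub>\<infinity>n::int. exp (of_real (- c * (a + of_int n)\<^sup>2)))"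
    by (simp add: f_def B_def)
  finally show ?thesis unfolding L_def by (subst (asm) infsum_cmult_right')
qed

section \<open>Theta series in one variable\<close>

definition theta_sum :: "(int \<Rightarrow> real) \<Rightarrow> nat \<Rightarrow> complex \<Rightarrow> complex" where
  "theta_sum s N p = (\<Sum>\<^sub>\<infinity>n::int. of_real (s n) * p ^ (N * nat (n\<^sup>2)))"

lemma nat_abs_le_nat_square: "nat \<bar>n\<bar> \<le> nat (n\<^sup>2)" for n :: int
  using abs_le_square_int[of n] by linarith

text \<open>The slack d serves series that have been divided by a power of p: the quotient by p^29
  is treated with d = 29, the theta series themselves with d = 0.\<close>

lemma norm_power_term_le:
  fixes p :: complex
  assumes s: "norm c \<le> B" and e: "nat \<bar>n\<bar> \<le> e + d" and r: "norm p \<le> r" "0 < r" "r < 1"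
  shows "norm (c * p ^ e) \<le> B * (1 / r) ^ d * r ^ nat \<bar>n\<bar>"
proof -
  have "norm (p ^ e) \<le> r ^ e" using r by (simp add: norm_power power_mono)
  also have "r ^ e = (1 / r) ^ d * r ^ (e + d)"
    using r by (simp add: power_add power_one_over)
  also have "\<dots> \<le> (1 / r) ^ d * r ^ nat \<bar>n\<bar>"
    using r e by (intro mult_left_mono power_decreasing) auto
  finally have "norm (p ^ e) \<le> (1 / r) ^ d * r ^ nat \<bar>n\<bar>" .
  moreover have "B \<ge> 0" using s norm_ge_zero order_trans by blast
  ultimately show ?thesis unfolding norm_mult mult.assoc
    using s by (intro mult_mono) auto
qed

lemma power_series_int_summable:
  fixes p :: complex
  assumes s: "\<And>n::int. norm (c n) \<le> B" and e: "\<And>n. nat \<bar>n\<bar> \<le> e n + d" and p: "norm p < 1"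
  shows "(\<lambda>n. norm (c n * p ^ e n)) summable_on UNIV"
proof -
  define r where "r = max (norm p) (1/2)"
  have r: "norm p \<le> r" "0 < r" "r < 1" using p by (auto simp: r_def)
  have "(\<lambda>n::int. B * (1 / r) ^ d * r ^ nat \<bar>n\<bar>) summable_on UNIV"
    by (intro summable_on_cmult_right summable_on_power_abs_int) (use r in auto)
  then show ?thesis
    by (rule summable_on_comparison_test) (use norm_power_term_le[OF s e r] in auto)
qed

lemma power_series_int_holomorphic:
  assumes s: "\<And>n::int. norm (c n) \<le> B" and e: "\<And>n. nat \<bar>n\<bar> \<le> e n + d"
  shows "(\<lambda>p::complex. \<Sum>\<^sub>\<infinity>n. c n * p ^ e n) holomorphic_on ball 0 1"
proof (rule holomorphic_on_infsum)
  fix z :: complex assume z: "z \<in> ball 0 1"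
  define \<rho> where "\<rho> = (1 - norm z) / 2"
  define r where "r = max (norm z + \<rho>) (1/2)"
  have r: "0 < r" "r < 1" "0 < \<rho>" using z norm_ge_zero[of z]
    by (auto simp: r_def \<rho>_def field_simps intro: add_pos_nonneg)
  have w: "norm w \<le> r" if "w \<in> cball z \<rho>" for w
    using that norm_triangle_ineq2[of w z] by (auto simp: dist_norm norm_minus_commute r_def)
  have sm: "(\<lambda>n::int. B * (1 / r) ^ d * r ^ nat \<bar>n\<bar>) summable_on UNIV"
    by (intro summable_on_cmult_right summable_on_power_abs_int) (use r in auto)
  have sub: "cball z \<rho> \<subseteq> ball 0 1" using w r by force
  have "\<forall>n. \<forall>w\<in>cball z \<rho>. norm (c n * w ^ e n) \<le> B * (1 / r) ^ d * r ^ nat \<bar>n\<bar>"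
    using norm_power_term_le[OF s e w] r by auto
  then show "\<exists>r>0. cball z r \<subseteq> ball 0 1 \<and> (\<exists>M. M summable_on UNIV \<and> (\<forall>n. \<forall>w\<in>cball z r. norm (c n * w ^ e n) \<le> M n))"
    using r(3) sub sm by blast
qed (auto intro!: holomorphic_intros)

lemma theta_sum_summable:
  fixes p :: complex
  assumes s: "\<And>n. \<bar>s n\<bar> \<le> B" and N: "N > 0" and p: "norm p < 1"
  shows "(\<lambda>n. norm (of_real (s n) * p ^ (N * nat (n\<^sup>2)))) summable_on UNIV"
proof (rule power_series_int_summable[of _ B _ 0, OF _ _ p])
  show "nat \<bar>n\<bar> \<le> N * nat (n\<^sup>2) + 0" for n :: int
    using nat_abs_le_nat_square[of n] N by (metis add_0_right le_trans mult_le_mono1 mult_1 Suc_leI One_nat_def)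
qed (use s in auto)

lemma theta_sum_holomorphic:
  assumes s: "\<And>n. \<bar>s n\<bar> \<le> B" and N: "N > 0"
  shows "theta_sum s N holomorphic_on ball 0 1"
  unfolding theta_sum_def
proof (rule power_series_int_holomorphic[of _ B _ 0])
  show "nat \<bar>n\<bar> \<le> N * nat (n\<^sup>2) + 0" for n :: int
    using nat_abs_le_nat_square[of n] N by (metis add_0_right le_trans mult_le_mono1 mult_1 Suc_leI One_nat_def)
qed (use s in auto)

lemma infsum_int_residues:
  fixes f :: "int \<Rightarrow> complex"
  assumes f: "f summable_on UNIV" and M: "M > 0"
  shows "(\<Sum>\<^sub>\<infinity>n. f n) = (\<Sum>r\<in>{0..<M}. \<Sum>\<^sub>\<infinity>j. f (M * j + r))"
proof -
  have inj: "inj (\<lambda>j. M * j + r)" for r using M by (auto simp: inj_def)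
  have "(\<Union>r\<in>{0..<M}. range (\<lambda>j. M * j + r)) = UNIV"
  proof -
    have "n \<in> (\<Union>r\<in>{0..<M}. range (\<lambda>j. M * j + r))" for n
      using M by (intro UN_I[of "n mod M"] image_eqI[of _ _ "n div M"]) (auto simp: mult.commute)
    then show ?thesis by auto
  qed
  then have "(\<Sum>\<^sub>\<infinity>n. f n) = infsum f (\<Union>r\<in>{0..<M}. range (\<lambda>j. M * j + r))" by simp
  also have "\<dots> = (\<Sum>r\<in>{0..<M}. infsum f (range (\<lambda>j. M * j + r)))"
  proof (rule sum_infsum[symmetric])
    fix r r' assume r: "r \<in> {0..<M}" "r' \<in> {0..<M}" "r \<noteq> r'"
    have "(M * j + r) mod M = r" "(M * j + r') mod M = r'" for j using r by (auto simp: mod_pos_pos_trivial)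
    then show "range (\<lambda>j. M * j + r) \<inter> range (\<lambda>j. M * j + r') = {}"
      using r(3) by (metis (no_types, lifting) disjoint_iff imageE)
  qed (use f summable_on_subset_banach in auto)
  also have "\<dots> = (\<Sum>r\<in>{0..<M}. \<Sum>\<^sub>\<infinity>j. f (M * j + r))"
    by (simp add: infsum_reindex[OF inj] o_def)
  finally show ?thesis .
qed

lemma has_sum_finite_sum:
  fixes f :: "'a \<Rightarrow> 'b \<Rightarrow> complex"
  assumes "finite I" "\<And>i. i \<in> I \<Longrightarrow> (f i has_sum a i) A"
  shows "((\<lambda>x. \<Sum>i\<in>I. f i x) has_sum (\<Sum>i\<in>I. a i)) A"
  using assms by (induction I rule: finite_induct) (auto intro!: has_sum_add)

section \<open>Inversion of theta series with periodic coefficients\<close>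

definition nome :: "complex \<Rightarrow> complex" where "nome \<tau> = exp (2 * of_real pi * \<i> * \<tau> / 112)"

lemma norm_nome: "norm (nome \<tau>) = exp (- (2 * pi * Im \<tau> / 112))"
  by (simp add: nome_def)

lemma norm_nome_less_1: "Im \<tau> > 0 \<Longrightarrow> norm (nome \<tau>) < 1"
  by (simp add: norm_nome)

lemma nome_power: "nome \<tau> ^ k = exp (2 * of_real pi * \<i> * \<tau> * of_nat k / 112)"
  unfolding nome_def exp_of_nat_mult[symmetric] by (simp add: mult_ac)

abbreviation cosk :: "int \<Rightarrow> int \<Rightarrow> real" where "cosk M n \<equiv> cos (2 * pi * of_int n / of_int M)"

text \<open>Poisson summation is applied in each residue class modulo M. It turns the coefficient N
  * M^2 / 56 of the exponent into its reciprocal 56 / (N * M^2), and this equals N' / 56 exactly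
  when N' * N * M^2 = 56^2 = 3136.\<close>

lemma theta_sum_inversion_imag_axis:
  fixes s :: "int \<Rightarrow> real" and M :: int and y :: real
  assumes y: "y > 0" and s: "\<And>n. \<bar>s n\<bar> \<le> B" "\<And>n. s (n + M) = s n"
    and M: "M > 0" and N: "N > 0" and NM: "3136 = int N' * int N * M\<^sup>2"
  defines "s' \<equiv> \<lambda>k. \<Sum>r\<in>{0..<M}. s r * cosk M (k * r)"
  shows "theta_sum s N (nome (-1 / (\<i> * of_real y))) =
    of_real (sqrt (real N' / 56 * y)) * theta_sum s' N' (nome (\<i> * of_real y))"
proof -
  have N': "N' > 0" using NM by (cases "N' = 0") auto
  define c where "c = pi * N * (of_int M)\<^sup>2 / (56 * y)"
  have c: "c > 0" using y N M by (simp add: c_def)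
  define p where "p = nome (-1 / (\<i> * of_real y))"
  have inv: "-1 / (\<i> * of_real y) = \<i> * of_real (1 / y)" using y by (simp add: field_simps)
  have p: "norm p < 1" unfolding p_def inv using y by (intro norm_nome_less_1) simp
  define P where "P = nome (\<i> * of_real y)"
  have P: "norm P < 1" unfolding P_def using y by (intro norm_nome_less_1) simp
  have NMr: "3136 = real N' * real N * (of_int M)\<^sup>2"
    using arg_cong[OF NM, of real_of_int] by simp
  have periodic: "s (M * j + r) = s r" for j r
  proof (induction j rule: int_induct[where k = 0])
    case (step1 i) then show ?case using s(2)[of "M * i + r"] by (simp add: algebra_simps)
  next
    case (step2 i) then show ?case using s(2)[of "M * (i - 1) + r"] by (simp add: algebra_simps)
  qed simp
  have Pk: "P ^ (N' * nat (k\<^sup>2)) = of_real (exp (- (pi\<^sup>2 * (of_int k)\<^sup>2 / c)))" for k :: int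
  proof -
    have "pi\<^sup>2 * (of_int k)\<^sup>2 / c = 2 * pi * y * (N' * (of_int k)\<^sup>2) / 112"
    proof -
      have "pi\<^sup>2 * (of_int k)\<^sup>2 / c = pi * (of_int k)\<^sup>2 * y * (56 / (real N * (of_int M)\<^sup>2))"
        unfolding c_def using y N M by (simp add: field_simps power2_eq_square)
      also have "56 / (real N * (of_int M)\<^sup>2) = real N' / 56"
        using NMr N M by (simp add: field_simps)
      finally show ?thesis by (simp add: field_simps)
    qed
    moreover have "P ^ (N' * nat (k\<^sup>2)) = exp (of_real (- (2 * pi * y * (N' * (of_int k)\<^sup>2) / 112)))"
      unfolding P_def nome_power by (simp add: algebra_simps)
    ultimately show ?thesis by (simp only: exp_of_real)
  qed
  have pn: "p ^ (N * nat ((M * j + r)\<^sup>2)) = exp (of_real (- c * (of_int r / of_int M + of_int j)\<^sup>2))" for j r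
  proof -
    have "c * (of_int r / of_int M + of_int j)\<^sup>2 = pi * N * (of_int M * (of_int r / of_int M + of_int j))\<^sup>2 / (56 * y)"
      by (simp add: c_def power_mult_distrib)
    also have "of_int M * (of_int r / of_int M + of_int j) = (of_int (M * j + r) :: real)"
      using M by (simp add: field_simps)
    finally have "c * (of_int r / of_int M + of_int j)\<^sup>2 = 2 * pi * (1 / y) * (N * (of_int (M * j + r))\<^sup>2) / 112"
      using y by (simp add: field_simps)
    moreover have "2 * of_real pi * \<i> * (\<i> * of_real (1 / y)) * of_nat (N * nat ((M * j + r)\<^sup>2)) / 112 =
       of_real (- (2 * pi * (1 / y) * (N * (of_int (M * j + r))\<^sup>2) / 112))"
      by simp
    ultimately show ?thesis unfolding p_def inv nome_power by (simp only: mult_minus_left)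
  qed
  define G where "G = (\<lambda>k::int. complex_of_real (exp (- (pi\<^sup>2 * (of_int k)\<^sup>2 / c))))"
  have Gsum: "(\<lambda>k. w k * G k) summable_on UNIV" if "\<And>k. norm (w k) \<le> W" for w W
  proof (rule abs_summable_summable)
    show "(\<lambda>k. norm (w k * G k)) summable_on UNIV"
      unfolding G_def Pk[symmetric]
    proof (rule power_series_int_summable[of _ W _ 0, OF that _ P])
      show "nat \<bar>n\<bar> \<le> N' * nat (n\<^sup>2) + 0" for n :: int
        using nat_abs_le_nat_square[of n] N' by (metis add_0_right le_trans mult_le_mono1 mult_1 Suc_leI One_nat_def)
    qed
  qed
  have inner: "(\<Sum>\<^sub>\<infinity>j. p ^ (N * nat ((M * j + r)\<^sup>2))) = of_real (sqrt (pi / c)) * (\<Sum>\<^sub>\<infinity>k. of_real (cosk M (k * r)) * G k)" for r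
  proof -
    \<comment> \<open>The Gaussian factor \<open>G k\<close> is even in k, so averaging over k and
      -k replaces the exponential by a cosine, whether or not s is even.\<close>
    define E where "E = (\<lambda>k::int. exp (of_real (2 * pi * (of_int r / of_int M) * of_int k) * \<i>))"
    have nE: "norm (E k) \<le> 1" for k by (simp add: E_def)
    have "(\<Sum>\<^sub>\<infinity>k. E k * G k) = (\<Sum>\<^sub>\<infinity>k. E (- k) * G k)"
      using infsum_reindex_bij_betw[OF bij_uminus, of "\<lambda>k. E k * G k"] by (simp add: G_def)
    then have "2 * (\<Sum>\<^sub>\<infinity>k. E k * G k) = (\<Sum>\<^sub>\<infinity>k. E k * G k) + (\<Sum>\<^sub>\<infinity>k. E (- k) * G k)" by simp
    also have "\<dots> = (\<Sum>\<^sub>\<infinity>k. E k * G k + E (- k) * G k)"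
      by (rule infsum_add[symmetric]) (auto intro!: Gsum nE)
    also have "\<dots> = (\<Sum>\<^sub>\<infinity>k. 2 * (of_real (cosk M (k * r)) * G k))"
    proof (rule infsum_cong)
      fix k
      have "E k + E (- k) = 2 * of_real (cosk M (k * r))"
        unfolding E_def by (simp add: cos_exp_eq cos_of_real[symmetric] mult_ac)
      then show "E k * G k + E (- k) * G k = 2 * (of_real (cosk M (k * r)) * G k)"
        by (simp add: distrib_right[symmetric] mult.assoc)
    qed
    also have "\<dots> = 2 * (\<Sum>\<^sub>\<infinity>k. of_real (cosk M (k * r)) * G k)"
      by (rule infsum_cmult_right')
    finally have "(\<Sum>\<^sub>\<infinity>k. E k * G k) = (\<Sum>\<^sub>\<infinity>k. of_real (cosk M (k * r)) * G k)" by simp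
    then show ?thesis
      unfolding pn poisson_gaussian_real[OF c] G_def E_def by (simp add: mult.commute)
  qed
  have "theta_sum s N p = (\<Sum>r\<in>{0..<M}. \<Sum>\<^sub>\<infinity>j. of_real (s (M * j + r)) * p ^ (N * nat ((M * j + r)\<^sup>2)))"
    unfolding theta_sum_def
    by (rule infsum_int_residues[OF abs_summable_summable[OF theta_sum_summable[OF s(1) N p]] M])
  also have "\<dots> = (\<Sum>r\<in>{0..<M}. of_real (s r) * (of_real (sqrt (pi / c)) * (\<Sum>\<^sub>\<infinity>k. of_real (cosk M (k * r)) * G k)))"
    unfolding periodic inner[symmetric] by (simp add: infsum_cmult_right')
  also have "\<dots> = of_real (sqrt (pi / c)) * (\<Sum>r\<in>{0..<M}. \<Sum>\<^sub>\<infinity>k. of_real (s r * cosk M (k * r)) * G k)"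
    by (simp add: sum_distrib_left infsum_cmult_right'[symmetric] mult_ac)
  also have "(\<Sum>r\<in>{0..<M}. \<Sum>\<^sub>\<infinity>k. of_real (s r * cosk M (k * r)) * G k)
      = (\<Sum>\<^sub>\<infinity>k. \<Sum>r\<in>{0..<M}. of_real (s r * cosk M (k * r)) * G k)"
  proof (rule infsumI[symmetric], rule has_sum_finite_sum)
    fix r
    have "(\<lambda>k. of_real (s r * cosk M (k * r)) * G k) summable_on UNIV"
      by (rule Gsum[of _ "\<bar>s r\<bar>"]) (simp add: norm_mult abs_mult mult_left_le del: of_real_mult)
    then show "((\<lambda>k. of_real (s r * cosk M (k * r)) * G k) has_sum
        (\<Sum>\<^sub>\<infinity>k. of_real (s r * cosk M (k * r)) * G k)) UNIV"
      by (rule has_sum_infsum)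
  qed simp
  also have "\<dots> = theta_sum s' N' P"
    unfolding theta_sum_def Pk s'_def by (simp add: sum_distrib_right G_def)
  also have "pi / c = real N' / 56 * y"
    unfolding c_def using NMr N M y by (simp add: field_simps)
  finally show ?thesis by (simp add: p_def P_def)
qed

text \<open>Both sides are holomorphic on the upper half plane and agree on the imaginary axis. The
  principal root causes no trouble, because the real part of -i \<tau> is Im \<tau> > 0.\<close>

theorem theta_sum_inversion:
  fixes s :: "int \<Rightarrow> real" and M :: int and \<tau> :: complex
  assumes \<tau>: "Im \<tau> > 0" and s: "\<And>n. \<bar>s n\<bar> \<le> B" "\<And>n. s (n + M) = s n"
    and M: "M > 0" and N: "N > 0" and NM: "3136 = int N' * int N * M\<^sup>2"
  defines "s' \<equiv> \<lambda>k. \<Sum>r\<in>{0..<M}. s r * cosk M (k * r)"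
  shows "theta_sum s N (nome (-1 / \<tau>)) =
    of_real (sqrt (real N' / 56)) * csqrt (- \<i> * \<tau>) * theta_sum s' N' (nome \<tau>)"
proof -
  have N': "N' > 0" using NM by (cases "N' = 0") auto
  have B0: "B \<ge> 0" using s(1)[of 0] by linarith
  have s'B: "\<bar>s' k\<bar> \<le> of_int M * B" for k
  proof -
    have "\<bar>s' k\<bar> \<le> (\<Sum>r\<in>{0..<M}. B)"
      unfolding s'_def
    proof (rule order_trans[OF sum_abs], rule sum_mono)
      fix r
      show "\<bar>s r * cosk M (k * r)\<bar> \<le> B"
        using s(1)[of r] B0 abs_cos_le_one
        unfolding abs_mult by (metis abs_ge_zero mult_mono mult.right_neutral)
    qed
    then show ?thesis using M by simp
  qed
  define H where "H = {z::complex. Im z > 0}"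
  have H: "open H" "connected H" unfolding H_def
    by (simp_all add: open_halfspace_Im_gt convex_halfspace_Im_gt convex_connected)
  have nomeH: "nome holomorphic_on S" for S unfolding nome_def by (intro holomorphic_intros) auto
  define d where "d = (\<lambda>z. theta_sum s N (nome (-1 / z)) - of_real (sqrt (real N' / 56)) * csqrt (- \<i> * z) * theta_sum s' N' (nome z))"
  have h1: "(theta_sum s N \<circ> (\<lambda>z. nome (-1 / z))) holomorphic_on H"
  proof (rule holomorphic_on_compose_gen[OF _ theta_sum_holomorphic[OF s(1) N]])
    show "(\<lambda>z. nome (-1 / z)) holomorphic_on H"
      unfolding nome_def H_def by (intro holomorphic_intros) auto
    show "(\<lambda>z. nome (-1 / z)) ` H \<subseteq> ball 0 1"
    proof clarsimp
      fix z assume "z \<in> H"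
      then have "Im z > 0" by (simp add: H_def)
      then have "Im (-1 / z) > 0" by (auto simp: Im_divide intro!: divide_pos_pos sum_power2_gt_zero_iff[THEN iffD2])
      then show "cmod (nome (- (1 / z))) < 1" by (intro norm_nome_less_1) simp
    qed
  qed
  have h2: "(theta_sum s' N' \<circ> nome) holomorphic_on H"
    by (rule holomorphic_on_compose_gen[OF nomeH theta_sum_holomorphic[OF s'B N']])
      (auto simp: H_def norm_nome_less_1)
  have dh: "d holomorphic_on H"
    unfolding d_def using h1 h2
    by (intro holomorphic_intros) (auto simp: o_def H_def complex_nonpos_Reals_iff)
  have d0: "d z = 0" if z: "z \<in> {\<i> * of_real y | y. y > 0}" for z
  proof -
    obtain y where y: "y > 0" "z = \<i> * of_real y" using z by auto
    have "sqrt (real N' / 56 * y) = sqrt (real N' / 56) * sqrt y" by (rule real_sqrt_mult)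
    moreover have "csqrt (- \<i> * z) = of_real (sqrt y)" using y by (simp add: csqrt_of_real_nonneg)
    moreover have "theta_sum s N (nome (-1 / z)) = of_real (sqrt (real N' / 56 * y)) * theta_sum s' N' (nome z)"
      unfolding y(2) s'_def using y(1) by (rule theta_sum_inversion_imag_axis[where s = s and B = B and M = M and N = N and N' = N', OF _ s M N NM])
    ultimately show ?thesis by (simp add: d_def)
  qed
  have lim: "\<i> islimpt {\<i> * of_real y | y. y > 0}"
    unfolding islimpt_approachable
  proof (intro allI impI)
    fix e :: real assume e: "e > 0"
    have "dist (\<i> * of_real (1 + e / 2)) \<i> < e"
      using e by (simp add: dist_norm algebra_simps norm_mult)
    then show "\<exists>x'\<in>{\<i> * of_real y | y. y > 0}. x' \<noteq> \<i> \<and> dist x' \<i> < e"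
      using e by (intro bexI[of _ "\<i> * of_real (1 + e / 2)"]) (auto simp: complex_eq_iff intro!: exI[of _ "1 + e/2"])
  qed
  have "d \<tau> = 0"
    by (rule analytic_continuation[OF dh H _ _ lim d0]) (use \<tau> in \<open>auto simp: H_def\<close>)
  then show ?thesis by (simp add: d_def)
qed

section \<open>Dissection modulo 7\<close>

definition cos7 :: "int \<Rightarrow> real" where "cos7 m = 2 * cos (2 * pi * of_int m / 7)"

definition alt :: "int \<Rightarrow> real" where "alt n = (if even n then 1 else -1)"

text \<open>The indicator of the residue class of \<open>u\<close> modulo 7, averaged over \<open>u\<close> and \<open>-u\<close>.\<close>
definition res :: "int \<Rightarrow> int \<Rightarrow> real" where
  "res u n = (of_bool (7 dvd n - u) + of_bool (7 dvd n + u)) / 2"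

lemma cos7_0 [simp]: "cos7 0 = 2" by (simp add: cos7_def)

lemma cos7_uminus [simp]: "cos7 (- m) = cos7 m" by (simp add: cos7_def)

lemma cos7_periodic [simp]: "cos7 (m + 7 * j) = cos7 m"
proof -
  have "2 * pi * of_int (m + 7 * j) / 7 = 2 * pi * of_int m / 7 + 2 * pi * of_int j" by (simp add: field_simps)
  then show ?thesis unfolding cos7_def by (metis cos_of_real cos.plus_of_int mult.commute cos_add cos_int_2pin sin_int_2pin mult_zero_right diff_zero mult.right_neutral)
qed

lemma cos7_eqI: "7 dvd m - m' \<Longrightarrow> cos7 m = cos7 m'"
  using cos7_periodic[of m'] by (metis add.commute diff_add_cancel dvdE)

lemma cos7_small: "cos7 4 = cos7 3" "cos7 5 = cos7 2" "cos7 6 = cos7 1" "cos7 9 = cos7 2"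
  using cos7_periodic[of "-3" 1] cos7_periodic[of "-2" 1] cos7_periodic[of "-1" 1] cos7_periodic[of 2 1]
    cos7_uminus[of 3] cos7_uminus[of 2] cos7_uminus[of 1] by simp_all

text \<open>The multiplication table of the real subfield of the seventh cyclotomic field, as needed
  for the later polynomial identities. Products come from the addition formula; the vanishing of the
  sum of all seventh roots of unity then follows by cancelling c - 2.\<close>

lemma cos7_relations:
  defines "c \<equiv> cos7 1" and "d \<equiv> cos7 2" and "e \<equiv> cos7 3"
  shows "c * c = 2 + d" "d * d = 2 + e" "e * e = 2 + c" "c * d = c + e" "d * e = c + d" "c * e = d + e" "c + d + e = -1"
proof -
  have prod: "cos7 m * cos7 n = cos7 (m - n) + cos7 (m + n)" for m n
    unfolding cos7_def by (simp add: cos_times_cos diff_divide_distrib[symmetric] add_divide_distrib[symmetric] algebra_simps)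
  have m: "cos7 (-1) = cos7 1" "cos7 (-2) = cos7 2" using cos7_uminus[of 1] cos7_uminus[of 2] by simp_all
  show 1: "c * c = 2 + d" "d * d = 2 + e" "e * e = 2 + c" "c * d = c + e" "d * e = c + d" "c * e = d + e"
    unfolding c_def d_def e_def prod by (simp_all add: cos7_small m)
  have "c = 2 * cos (2 * pi / 7)" by (simp add: c_def cos7_def)
  moreover have "cos (2 * pi / 7) < 1"
  proof -
    have "cos (2 * pi / 7) < cos 0" by (rule cos_monotone_0_pi) (use pi_gt_zero in auto)
    then show ?thesis by simp
  qed
  ultimately have "c \<noteq> 2" by simp
  moreover have "c * (c + d + e) = 2 + 2 * c + 2 * d + 2 * e - c" using 1 by (simp add: algebra_simps)
  then have "(c - 2) * (c + d + e + 1) = 0" by (simp add: algebra_simps)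
  ultimately show "c + d + e = -1" by simp
qed

lemma res_periodic: "7 dvd n - m \<Longrightarrow> res u n = res u m"
proof -
  assume "7 dvd n - m"
  then obtain j where "n = m + 7 * j" by (metis add.commute diff_add_cancel dvdE)
  then have "7 dvd n - u \<longleftrightarrow> 7 dvd m - u" "7 dvd n + u \<longleftrightarrow> 7 dvd m + u" by presburger+
  then show ?thesis by (simp add: res_def)
qed

lemma abs_res_le: "\<bar>res u n\<bar> \<le> 1" by (simp add: res_def)

text \<open>\<open>res u\<close> averages the classes of u and -u, which an even function does not
  distinguish.\<close>

lemma sum_res_even_periodic:
  assumes per: "\<And>n. F (n + 7) = F n" and ev: "\<And>n. F (- n) = F n"
  shows "(\<Sum>r\<in>{0..<7}. res u r * F r) = F u"
proof -
  have per': "F (n + 7 * j) = F n" for n j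
  proof (induction j rule: int_induct[where k = 0])
    case (step1 i) then show ?case using per[of "n + 7 * i"] by (simp add: algebra_simps)
  next
    case (step2 i) then show ?case using per[of "n + 7 * (i - 1)"] by (simp add: algebra_simps)
  qed simp
  have modF: "F (n mod 7) = F n" for n
    using per'[of "n mod 7" "n div 7"] by simp
  have "(\<Sum>r\<in>{0..<7}. of_bool (7 dvd r - w) * F r) = F w" for w
  proof -
    have "(\<Sum>r\<in>{0..<7}. of_bool (7 dvd r - w) * F r) = (\<Sum>r\<in>{0..<7}. if r = w mod 7 then F r else 0)"
    proof (rule sum.cong)
      fix r :: int assume "r \<in> {0..<7}"
      then have "7 dvd r - w \<longleftrightarrow> r = w mod 7" by (auto simp: mod_eq_dvd_iff[symmetric])
      then show "of_bool (7 dvd r - w) * F r = (if r = w mod 7 then F r else 0)" by simp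
    qed simp
    also have "\<dots> = F (w mod 7)" by simp
    finally show ?thesis by (simp add: modF)
  qed
  moreover have "res u r * F r = (of_bool (7 dvd r - u) * F r + of_bool (7 dvd r - - u) * F r) / 2" for r
    by (simp add: res_def field_simps)
  ultimately show ?thesis by (simp only: sum_divide_distrib[symmetric] sum.distrib ev) simp
qed

text \<open>\<open>res 0\<close> is a full indicator, while the other \<open>res u\<close> take the
  value 1/2 on two classes; this explains the 1/2 on the left and the coefficient 1 of
  \<open>res 0\<close>.\<close>

lemma cos7_expand:
  "cos7 (u * n) / 2 = res 0 n + cos7 u * res 1 n + cos7 (2 * u) * res 2 n + cos7 (3 * u) * res 3 n"
proof -
  define j where "j = n mod 7"
  have j: "7 dvd n - j" unfolding j_def by (simp add: dvd_minus_mod)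
  then have "7 dvd u * n - u * j" by (simp add: right_diff_distrib[symmetric])
  then have c: "cos7 (u * n) = cos7 (u * j)" by (rule cos7_eqI)
  have m: "cos7 (4 * u) = cos7 (3 * u)" "cos7 (5 * u) = cos7 (2 * u)" "cos7 (6 * u) = cos7 u"
  proof -
    have "7 dvd 4 * u - - (3 * u)" "7 dvd 5 * u - - (2 * u)" "7 dvd 6 * u - - u" by simp_all
    then show "cos7 (4 * u) = cos7 (3 * u)" "cos7 (5 * u) = cos7 (2 * u)" "cos7 (6 * u) = cos7 u"
      by (metis cos7_eqI cos7_uminus)+
  qed
  have "j \<in> {0,1,2,3,4,5,6}" unfolding j_def by auto
  then show ?thesis
    unfolding c res_periodic[OF j]
    by (elim insertE emptyE) (simp_all add: res_def m mult.commute[of u])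
qed

lemma less_4I: "P 0 \<Longrightarrow> P 1 \<Longrightarrow> P 2 \<Longrightarrow> P 3 \<Longrightarrow> (u::nat) < 4 \<Longrightarrow> P u"
  by (auto simp: less_Suc_eq numeral_eq_Suc)

section \<open>Theta vectors\<close>

definition theta_vec :: "(int \<Rightarrow> real) \<Rightarrow> int \<Rightarrow> nat \<Rightarrow> complex \<Rightarrow> nat \<Rightarrow> complex" where
  "theta_vec w a N p u = theta_sum (\<lambda>n. w n * res (int u) (a * n)) N p"

abbreviation odd_ind :: "int \<Rightarrow> real" where "odd_ind n \<equiv> of_bool (odd n)"

text \<open>The matrix of the finite Fourier transform on even functions modulo 7.\<close>
definition dft7 :: "(nat \<Rightarrow> complex) \<Rightarrow> nat \<Rightarrow> complex" where
  "dft7 v u = v 0 + of_real (cos7 (int u)) * v 1 + of_real (cos7 (2 * int u)) * v 2 + of_real (cos7 (3 * int u)) * v 3"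

lemma theta_sum_linear:
  fixes p :: complex
  assumes p: "norm p < 1" and N: "N > 0" and I: "finite I"
    and s: "\<And>i n. i \<in> I \<Longrightarrow> \<bar>s i n\<bar> \<le> B"
  shows "theta_sum (\<lambda>n. \<Sum>i\<in>I. c i * s i n) N p = (\<Sum>i\<in>I. of_real (c i) * theta_sum (s i) N p)"
proof -
  have "((\<lambda>n. \<Sum>i\<in>I. of_real (c i) * (of_real (s i n) * p ^ (N * nat (n\<^sup>2)))) has_sum (\<Sum>i\<in>I. of_real (c i) * theta_sum (s i) N p)) UNIV"
  proof (rule has_sum_finite_sum[OF I])
    fix i assume i: "i \<in> I"
    show "((\<lambda>n. of_real (c i) * (of_real (s i n) * p ^ (N * nat (n\<^sup>2)))) has_sum (of_real (c i) * theta_sum (s i) N p)) UNIV"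
      unfolding theta_sum_def
      by (rule has_sum_cmult_right[OF has_sum_infsum[OF abs_summable_summable[OF theta_sum_summable[OF s[OF i] N p]]]])
  qed
  moreover have "(\<Sum>i\<in>I. of_real (c i) * (of_real (s i n) * p ^ (N * nat (n\<^sup>2)))) = of_real (\<Sum>i\<in>I. c i * s i n) * p ^ (N * nat (n\<^sup>2))" for n
    by (simp add: sum_distrib_right mult.assoc)
  ultimately show ?thesis unfolding theta_sum_def by (simp only: infsumI)
qed

lemma theta_sum_scale: "theta_sum (\<lambda>n. c * s n) N p = of_real c * theta_sum s N p"
  unfolding theta_sum_def by (simp add: mult.assoc infsum_cmult_right')

lemma theta_sum_cos7:
  fixes p :: complex
  assumes p: "norm p < 1" and N: "N > 0" and w: "\<And>n. \<bar>w n\<bar> \<le> 1"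
  shows "theta_sum (\<lambda>n. w n * (cos7 (int u * (a * n)) / 2)) N p = dft7 (theta_vec w a N p) u"
proof -
  define c where "c = (\<lambda>i::nat. if i = 0 then 1 else cos7 (int i * int u))"
  have b: "\<bar>w n * res (int i) (a * n)\<bar> \<le> 1" for i n
    using w[of n] abs_res_le[of "int i" "a * n"] by (simp add: abs_mult mult_le_one)
  have "w n * (cos7 (int u * (a * n)) / 2) = (\<Sum>i\<in>{0,1,2,3}. c i * (w n * res (int i) (a * n)))" for n
    unfolding cos7_expand by (simp add: c_def algebra_simps)
  then have "theta_sum (\<lambda>n. w n * (cos7 (int u * (a * n)) / 2)) N p = (\<Sum>i\<in>{0,1,2,3}. of_real (c i) * theta_sum (\<lambda>n. w n * res (int i) (a * n)) N p)"
    by (simp only: theta_sum_linear[OF p N _ b] finite.intros)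
  then show ?thesis by (simp add: dft7_def theta_vec_def c_def algebra_simps)
qed

text \<open>Since 8/7 = 1/7 + 1, a character modulo 14 splits into a parity sign and a character
  modulo 7, at the price of the factor 4.\<close>

lemma cos_14: "cos (2 * pi * of_int m / 14) = alt m * cos7 (4 * m) / 2"
proof -
  have "2 * pi * of_int (4 * m) / 7 = 2 * pi * of_int m / 14 + pi * of_int m" by (simp add: field_simps)
  then have "cos7 (4 * m) = 2 * (cos (2 * pi * of_int m / 14) * cos (pi * of_int m))"
    unfolding cos7_def by (simp only: cos_add sin_npi_int) simp
  moreover have "cos (pi * of_int m) = alt m"
    by (simp add: alt_def cos_npi_int)
  ultimately show ?thesis by (simp add: alt_def)
qed

lemma alt_mult_odd: "odd k \<Longrightarrow> alt (k * r) = alt r" "odd r \<Longrightarrow> alt (k * r) = alt k"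
  by (simp_all add: alt_def)

lemma sum_14: "(\<Sum>r\<in>{0..<14::int}. f r) = (\<Sum>r\<in>{0..<7::int}. f r + f (r + 7))" for f :: "int \<Rightarrow> real"
proof -
  have "{0..<14::int} = {0..<7} \<union> {7..<14}" by auto
  then have "(\<Sum>r\<in>{0..<14::int}. f r) = (\<Sum>r\<in>{0..<7}. f r) + (\<Sum>r\<in>{7..<14}. f r)"
    by (simp add: sum.union_disjoint)
  also have "(\<Sum>r\<in>{7..<14}. f r) = (\<Sum>r\<in>{0..<7}. f (r + 7))"
    by (rule sum.reindex_bij_witness[of _ "\<lambda>r. r + 7" "\<lambda>r. r - 7"]) auto
  finally show ?thesis by (simp add: sum.distrib)
qed

lemma cos7_mult_periodic: "cos7 (k * (n + 7)) = cos7 (k * n)" "cos7 (k * - n) = cos7 (k * n)"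
proof -
  show "cos7 (k * (n + 7)) = cos7 (k * n)" by (rule cos7_eqI) (simp add: algebra_simps)
qed simp

lemma res_add_7: "res u (n + 7) = res u n" by (rule res_periodic) simp

lemma fourier_res_7:
  "(\<Sum>r\<in>{0..<7}. res u r * cos (2 * pi * of_int (k * r) / 7)) = cos7 (u * k) / 2"
proof -
  have "(\<Sum>r\<in>{0..<7}. res u r * cos (2 * pi * of_int (k * r) / 7)) = (\<Sum>r\<in>{0..<7}. res u r * cos7 (k * r)) / 2"
    by (simp add: cos7_def sum_divide_distrib)
  also have "(\<Sum>r\<in>{0..<7}. res u r * cos7 (k * r)) = cos7 (k * u)"
    by (rule sum_res_even_periodic) (use cos7_mult_periodic in auto)
  finally show ?thesis by (simp add: mult.commute)
qed

text \<open>The odd residues modulo 14 represent every residue modulo 7 once, so the parity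
  condition contributes nothing but the sign \<open>alt k\<close>.\<close>

lemma fourier_odd_res_14:
  "(\<Sum>r\<in>{0..<14}. odd_ind r * res u r * cos (2 * pi * of_int (k * r) / 14)) = alt k * (cos7 (u * (4 * k)) / 2)"
proof -
  have "odd_ind r * res u r * cos (2 * pi * of_int (k * r) / 14) = alt k / 2 * (odd_ind r * (res u r * cos7 (4 * k * r)))" for r
    unfolding cos_14 by (cases "odd r") (auto simp: alt_mult_odd mult_ac)
  then have "(\<Sum>r\<in>{0..<14}. odd_ind r * res u r * cos (2 * pi * of_int (k * r) / 14)) =
     alt k / 2 * (\<Sum>r\<in>{0..<14}. odd_ind r * (res u r * cos7 (4 * k * r)))"
    by (simp only: sum_distrib_left)
  also have "(\<Sum>r\<in>{0..<14}. odd_ind r * (res u r * cos7 (4 * k * r))) = (\<Sum>r\<in>{0..<7}. res u r * cos7 (4 * k * r))"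
    unfolding sum_14 res_add_7 cos7_mult_periodic by (rule sum.cong) auto
  also have "\<dots> = cos7 (4 * k * u)"
    by (rule sum_res_even_periodic) (use cos7_mult_periodic[of "4 * k"] in auto)
  finally show ?thesis by (simp add: mult_ac)
qed

text \<open>The residues r and r + 7 have opposite parity: their contributions cancel for even k and
  coincide for odd k.\<close>

lemma fourier_alt_res_14:
  "(\<Sum>r\<in>{0..<14}. alt r * res u r * cos (2 * pi * of_int (k * r) / 14)) = 2 * (odd_ind k * (cos7 (u * (4 * k)) / 2))"
proof -
  have "alt r * res u r * cos (2 * pi * of_int (k * r) / 14) = 1 / 2 * (alt r * alt (k * r) * (res u r * cos7 (4 * k * r)))" for r
    unfolding cos_14 by (simp add: mult_ac)
  then have "(\<Sum>r\<in>{0..<14}. alt r * res u r * cos (2 * pi * of_int (k * r) / 14)) =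
     1 / 2 * (\<Sum>r\<in>{0..<14}. alt r * alt (k * r) * (res u r * cos7 (4 * k * r)))"
    by (simp only: sum_distrib_left)
  also have "(\<Sum>r\<in>{0..<14}. alt r * alt (k * r) * (res u r * cos7 (4 * k * r))) = (\<Sum>r\<in>{0..<7}. 2 * odd_ind k * (res u r * cos7 (4 * k * r)))"
    unfolding sum_14 res_add_7 cos7_mult_periodic by (rule sum.cong) (auto simp: alt_def)
  also have "\<dots> = 2 * odd_ind k * cos7 (4 * k * u)"
    unfolding sum_distrib_left[symmetric]
    by (subst sum_res_even_periodic[where F = "\<lambda>r. cos7 (4 * k * r)"]) (use cos7_mult_periodic[of "4 * k"] in auto)
  finally show ?thesis by (simp add: mult_ac)
qed

text \<open>2 is the inverse of 4 modulo 7.\<close>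

lemma res_4: "res u (4 * n) = res (2 * u) n"
proof -
  have *: "7 dvd 4 * n - v \<longleftrightarrow> 7 dvd n - 2 * v" for v
  proof
    assume "7 dvd 4 * n - v"
    then obtain j where "4 * n - v = 7 * j" by (elim dvdE)
    then have "n - 2 * v = 7 * (2 * j - n)" by simp
    then show "7 dvd n - 2 * v" by (simp only: dvd_triv_left)
  next
    assume "7 dvd n - 2 * v"
    then obtain j where "n - 2 * v = 7 * j" by (elim dvdE)
    then have "4 * n - v = 7 * (4 * j + v)" by simp
    then show "7 dvd 4 * n - v" by (simp only: dvd_triv_left)
  qed
  from *[of u] *[of "- u"] have "7 dvd 4 * n - u \<longleftrightarrow> 7 dvd n - 2 * u" "7 dvd 4 * n + u \<longleftrightarrow> 7 dvd n + 2 * u" by simp_all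
  then show ?thesis by (simp add: res_def)
qed

text \<open>
  In terms of Jacobi's functions, with \<open>p = exp (2 \<pi> \<i> \<tau> / 112)\<close>: \<open>th2, th3, th4\<close> are \<open>\<theta>\<^sub>2(\<tau>), \<theta>\<^sub>3(\<tau>), \<theta>\<^sub>4(\<tau>)\<close>, while \<open>th23\<close> is
  \<open>\<theta>\<^sub>2(\<tau>/2)\<close> and \<open>th34\<close> is \<open>\<theta>\<^sub>4(2 \<tau>)\<close>, whose squares are multiples of \<open>\<theta>\<^sub>2 \<theta>\<^sub>3\<close> and \<open>\<theta>\<^sub>3 \<theta>\<^sub>4\<close>. The vectors \<open>k2, k3, k4, g23, g34\<close>
  are the dissections modulo 7 of the same functions at \<open>\<tau>/7\<close>. The factors \<open>a = 4\<close> normalise the indices so that each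
  component \<open>u\<close> has exponents proportional to \<open>u\<^sup>2\<close> modulo 7 with the same constant.
\<close>
definition "k3 = theta_vec (\<lambda>_. 1) 1 8"
definition "k4 = theta_vec alt 1 8"
definition "k2 = theta_vec odd_ind 4 2"
definition "g23 = theta_vec odd_ind 1 1"
definition "g34 = theta_vec alt 4 16"
definition "th3 = theta_sum (\<lambda>_. 1) 56"
definition "th4 = theta_sum alt 56"
definition "th2 = theta_sum odd_ind 14"
definition "th23 = theta_sum odd_ind 7"
definition "th34 = theta_sum alt 112"

lemma alt_periodic: "alt (n + 2 * m) = alt n" by (simp add: alt_def)

lemma alt_14: "alt (n + 14) = alt n" using alt_periodic[of n 7] by simp

lemma abs_alt [simp]: "\<bar>alt n\<bar> = 1" by (simp add: alt_def)

section \<open>Inversion of the dissected theta series\<close>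

context
  fixes \<tau> :: complex assumes \<tau>: "Im \<tau> > 0"
begin

private lemma p: "norm (nome \<tau>) < 1" using \<tau> by (rule norm_nome_less_1)

text \<open>Reduces each inversion formula below to the finite Fourier transform over one period,
  the hypothesis \<open>four\<close>; there the weights \<open>odd_ind\<close> and
  \<open>alt\<close> are exchanged and the constant weight is preserved.\<close>

lemma theta_vec_inversion:
  assumes w: "\<And>n. \<bar>w n\<bar> \<le> 1" "\<And>n. w (n + M) = w n" and w': "\<And>n. \<bar>w' n\<bar> \<le> 1"
    and M: "M > 0" "7 dvd M" and N: "N > 0" and NM: "3136 = int N' * int N * M\<^sup>2"
    and four: "\<And>k. (\<Sum>r\<in>{0..<M}. w r * res (int u) (a * r) * cosk M (k * r))
      = c * (w' k * (cos7 (int u * (a' * k)) / 2))"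
  shows "theta_vec w a N (nome (-1 / \<tau>)) u =
    of_real (sqrt (real N' / 56) * c) * csqrt (- \<i> * \<tau>) * dft7 (theta_vec w' a' N' (nome \<tau>)) u"
proof -
  have N': "N' > 0" using NM by (cases "N' = 0") auto
  have "theta_vec w a N (nome (-1 / \<tau>)) u = of_real (sqrt (real N' / 56)) * csqrt (- \<i> * \<tau>) *
      theta_sum (\<lambda>k. \<Sum>r\<in>{0..<M}. w r * res (int u) (a * r) * cosk M (k * r)) N' (nome \<tau>)"
    unfolding theta_vec_def
  proof (rule theta_sum_inversion[OF \<tau>, where B = 1])
    fix n
    show "\<bar>w n * res (int u) (a * n)\<bar> \<le> 1"
      using w(1) abs_res_le by (simp add: abs_mult mult_le_one)
    have "7 dvd a * (n + M) - a * n" using M(2) by (simp add: algebra_simps)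
    then show "w (n + M) * res (int u) (a * (n + M)) = w n * res (int u) (a * n)"
      by (simp add: w(2) res_periodic)
  qed (use M N NM in auto)
  also have "theta_sum (\<lambda>k. \<Sum>r\<in>{0..<M}. w r * res (int u) (a * r) * cosk M (k * r)) N' (nome \<tau>) =
      of_real c * dft7 (theta_vec w' a' N' (nome \<tau>)) u"
    unfolding four theta_sum_scale by (simp only: theta_sum_cos7[OF p N' w'])
  finally show ?thesis by (simp add: mult_ac)
qed

lemma k3_inversion: "k3 (nome (-1 / \<tau>)) u = of_real (sqrt (1 / 7)) * csqrt (- \<i> * \<tau>) * dft7 (k3 (nome \<tau>)) u"
  using theta_vec_inversion[of "\<lambda>_. 1" 7 "\<lambda>_. 1" 8 8 u 1 1 1] fourier_res_7[of "int u"] by (simp add: k3_def)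

lemma g23_inversion: "g23 (nome (-1 / \<tau>)) u = of_real (sqrt (2 / 7)) * csqrt (- \<i> * \<tau>) * dft7 (g34 (nome \<tau>)) u"
  using theta_vec_inversion[of odd_ind 14 alt 1 16 u 1 1 4] fourier_odd_res_14[of "int u"] by (simp add: g23_def g34_def)

lemma sqrt_halves:
  "sqrt (2 / 56) * 2 = sqrt (1 / 7)" "sqrt (1 / 56) * 2 = sqrt (1 / 14)" "sqrt (7 / 56) * 2 = sqrt (1 / 2)"
  by (rule real_sqrt_unique[symmetric], auto simp: power_mult_distrib)+

lemma k4_inversion: "k4 (nome (-1 / \<tau>)) u = of_real (sqrt (1 / 7)) * csqrt (- \<i> * \<tau>) * dft7 (k2 (nome \<tau>)) u"
  unfolding k4_def k2_def sqrt_halves[symmetric]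
  using theta_vec_inversion[of alt 14 odd_ind 8 2 u 1 2 4] fourier_alt_res_14[of "int u"] by (simp add: alt_14)

text \<open>The factor 4 from \<open>cos_14\<close> and the 2 from \<open>res_4\<close> cancel
  modulo 7. This is why exactly one of two vectors of period 14 exchanged by inversion carries the
  normalisation a = 4.\<close>

lemma cos7_8: "cos7 (2 * u * (4 * k)) = cos7 (u * k)"
  by (rule cos7_eqI) simp

lemma k2_inversion: "k2 (nome (-1 / \<tau>)) u = of_real (sqrt (1 / 7)) * csqrt (- \<i> * \<tau>) * dft7 (k4 (nome \<tau>)) u"
  unfolding k2_def k4_def
  using theta_vec_inversion[of odd_ind 14 alt 2 8 u 4 1 1] fourier_odd_res_14[of "2 * int u"]
  unfolding res_4 cos7_8 by simp

lemma g34_inversion: "g34 (nome (-1 / \<tau>)) u = of_real (sqrt (1 / 14)) * csqrt (- \<i> * \<tau>) * dft7 (g23 (nome \<tau>)) u"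
  unfolding g34_def g23_def sqrt_halves[symmetric]
  using theta_vec_inversion[of alt 14 odd_ind 16 1 u 4 2 1] fourier_alt_res_14[of "2 * int u"]
  unfolding res_4 cos7_8 by (simp add: alt_14)

lemma th3_inversion: "th3 (nome (-1 / \<tau>)) = csqrt (- \<i> * \<tau>) * th3 (nome \<tau>)"
proof -
  have "{0..<1::int} = {0}" by auto
  then show ?thesis using theta_sum_inversion[OF \<tau>, of "\<lambda>_. 1" 1 1 56 56] by (simp add: th3_def)
qed

lemma theta_sum_inversion_2:
  assumes "N > 0" and NM: "3136 = int N' * int N * 2\<^sup>2"
  shows "theta_sum odd_ind N (nome (-1 / \<tau>)) = of_real (sqrt (real N' / 56)) * csqrt (- \<i> * \<tau>) * theta_sum alt N' (nome \<tau>)"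
    and "theta_sum alt N (nome (-1 / \<tau>)) = of_real (sqrt (real N' / 56) * 2) * csqrt (- \<i> * \<tau>) * theta_sum odd_ind N' (nome \<tau>)"
proof -
  have sum: "(\<Sum>r\<in>{0..<2::int}. f r) = f 0 + f 1" for f :: "int \<Rightarrow> real"
  proof -
    have "{0..<2::int} = {0, 1}" by auto
    then show ?thesis by simp
  qed
  have cos: "cosk 2 (k * 1) = alt k" for k by (simp add: alt_def cos_npi_int)
  have "(\<lambda>k. \<Sum>r\<in>{0..<2}. odd_ind r * cosk 2 (k * r)) = alt"
    "(\<lambda>k. \<Sum>r\<in>{0..<2}. alt r * cosk 2 (k * r)) = (\<lambda>k. 2 * odd_ind k)"
    unfolding sum cos by (auto simp: alt_def)
  note * = this theta_sum_scale
  show "theta_sum odd_ind N (nome (-1 / \<tau>)) = of_real (sqrt (real N' / 56)) * csqrt (- \<i> * \<tau>) * theta_sum alt N' (nome \<tau>)"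
    using theta_sum_inversion[OF \<tau>, of odd_ind 1 2 N N'] assms unfolding * by simp
  show "theta_sum alt N (nome (-1 / \<tau>)) = of_real (sqrt (real N' / 56) * 2) * csqrt (- \<i> * \<tau>) * theta_sum odd_ind N' (nome \<tau>)"
    using theta_sum_inversion[OF \<tau>, of alt 1 2 N N'] assms alt_periodic[of _ 1] unfolding * by simp
qed

lemma th4_inversion: "th4 (nome (-1 / \<tau>)) = csqrt (- \<i> * \<tau>) * th2 (nome \<tau>)"
proof -
  have "sqrt (14 / 56) = 1 / 2" by (rule real_sqrt_unique) (auto simp: power_divide)
  then show ?thesis using theta_sum_inversion_2(2)[of 56 14] by (simp add: th4_def th2_def del: real_sqrt_divide)
qed

lemma th2_inversion: "th2 (nome (-1 / \<tau>)) = csqrt (- \<i> * \<tau>) * th4 (nome \<tau>)"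
  using theta_sum_inversion_2(1)[of 14 56] by (simp add: th4_def th2_def)

lemma th23_inversion: "th23 (nome (-1 / \<tau>)) = of_real (sqrt 2) * csqrt (- \<i> * \<tau>) * th34 (nome \<tau>)"
  using theta_sum_inversion_2(1)[of 7 112] by (simp add: th23_def th34_def)

lemma th34_inversion: "th34 (nome (-1 / \<tau>)) = of_real (sqrt (1 / 2)) * csqrt (- \<i> * \<tau>) * th23 (nome \<tau>)"
  unfolding sqrt_halves[symmetric] using theta_sum_inversion_2(2)[of 112 7] by (simp add: th23_def th34_def)

end

section \<open>Ternary combinations\<close>

text \<open>\<open>tri g k u\<close> is the sum of \<open>\<Phi> u x * g x1 * k x2 * k x3\<close> over \<open>x\<close> in \<open>F\<^sub>7\<^sup>3\<close>, where \<open>\<Phi> u\<close> is half the indicator of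
  \<open>x1\<^sup>2 + x2\<^sup>2 + x3\<^sup>2 = u\<^sup>2\<close>, diminished for \<open>u = 0\<close> by \<open>7/2\<close> at the origin. These \<open>\<Phi> u\<close> span the four-dimensional
  constituent of the Weil representation in which the even functions on \<open>F\<^sub>7\<close> also lie, up to a sign.\<close>
definition tri :: "(nat \<Rightarrow> complex) \<Rightarrow> (nat \<Rightarrow> complex) \<Rightarrow> nat \<Rightarrow> complex" where
  "tri g k u =
    (let h = (\<lambda>a b c. g a * (k 0)\<^sup>2 + 2 * g 0 * k 0 * k a + 4 * k 0 * g b * k b + 2 * g 0 * (k b)\<^sup>2 + 4 * g b * (k c)\<^sup>2 + 8 * g c * k b * k c)
     in if u = 0 then 8 * (g 1 * k 2 * k 3 + g 2 * k 3 * k 1 + g 3 * k 1 * k 2) - 3 * g 0 * (k 0)\<^sup>2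
        else if u = 1 then h 1 2 3 else if u = 2 then h 2 3 1 else h 3 1 2)"

lemma dft7_simps:
  "dft7 v 0 = v 0 + 2 * v 1 + 2 * v 2 + 2 * v 3"
  "dft7 v (Suc 0) = v 0 + of_real (cos7 1) * v 1 + of_real (cos7 2) * v 2 + of_real (cos7 3) * v 3"
  "dft7 v 2 = v 0 + of_real (cos7 2) * v 1 + of_real (cos7 3) * v 2 + of_real (cos7 1) * v 3"
  "dft7 v 3 = v 0 + of_real (cos7 3) * v 1 + of_real (cos7 1) * v 2 + of_real (cos7 2) * v 3"
  by (simp_all add: dft7_def cos7_small)

lemma cos7_relations_complex:
  defines "c \<equiv> complex_of_real (cos7 1)" and "d \<equiv> complex_of_real (cos7 2)" and "e \<equiv> complex_of_real (cos7 3)"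
  shows "c * c = 2 + d" "d * d = 2 + e" "e * e = 2 + c" "c * d = c + e" "d * e = c + d" "c * e = d + e" "c + d + e = -1"
  unfolding c_def d_def e_def of_real_mult[symmetric] cos7_relations by simp_all
    (metis cos7_relations(7) of_real_1 of_real_add of_real_minus)

text \<open>Each case is a polynomial identity modulo the relations between the cosines. The
  constant is (i sqrt 7)^2 = -7, the square of the quadratic Gauss sum: the transform in three
  variables involves the Gauss factor cubed, the transform in one variable involves it once.\<close>

lemma tri_dft7:
  assumes "u < 4"
  shows "tri (dft7 g) (dft7 k) u = -7 * dft7 (tri g k) u"
  by (rule less_4I[OF _ _ _ _ assms], use cos7_relations_complex in \<open>(simp add: tri_def Let_def dft7_simps, algebra)+\<close>)

text \<open>The factors \<open>sqrt 2\<close> make the inversion \<open>\<tau> \<mapsto> -1/\<tau>\<close> unitary.\<close>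
definition "F23 p u = tri (g23 p) (k3 p) u - (g23 p u * (th3 p)\<^sup>2 + 2 * k2 p u * th23 p * th3 p)"
definition "F43 p u = of_real (sqrt 2) * (tri (g34 p) (k3 p) u + (g34 p u * (th3 p)\<^sup>2 + 2 * k4 p u * th34 p * th3 p))"
definition "F34 p u = of_real (sqrt 2) * (tri (g34 p) (k4 p) u + (g34 p u * (th4 p)\<^sup>2 + 2 * k3 p u * th34 p * th4 p))"
definition "F32 p u = tri (g23 p) (k2 p) u - (g23 p u * (th2 p)\<^sup>2 + 2 * k3 p u * th23 p * th2 p)"

lemma tri_scale: "tri (\<lambda>u. c * g u) (\<lambda>u. d * k u) u = c * d\<^sup>2 * tri g k u"
  unfolding tri_def Let_def by (simp add: power2_eq_square algebra_simps)

lemma tri_cong: "(\<And>u. g u = g' u) \<Longrightarrow> (\<And>u. k u = k' u) \<Longrightarrow> tri g k u = tri g' k' u"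
  by (metis ext)

lemma dft7_lin: "dft7 (\<lambda>u. f u - (g u * a + 2 * k u * b * c)) u = dft7 f u - (dft7 g u * a + 2 * dft7 k u * b * c)"
  "dft7 (\<lambda>u. f u + (g u * a + 2 * k u * b * c)) u = dft7 f u + (dft7 g u * a + 2 * dft7 k u * b * c)"
  "dft7 (\<lambda>u. d * f u) u = d * dft7 f u"
  by (simp_all add: dft7_def algebra_simps)

lemma sqrt_complex_facts:
  "complex_of_real (sqrt (1/7)) * of_real (sqrt (1/7)) = 1/7"
  "complex_of_real (sqrt (2/7)) = of_real (sqrt (1/7)) * of_real (sqrt 2)"
  "complex_of_real (sqrt (1/14)) * 2 = of_real (sqrt (1/7)) * of_real (sqrt 2)"
  "complex_of_real (sqrt (1/2)) * 2 = of_real (sqrt 2)"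
  "complex_of_real (sqrt 2) * of_real (sqrt 2) = 2"
proof -
  have "complex_of_real (sqrt a) * of_real (sqrt b) = of_real (sqrt (a * b))" for a b
    by (simp add: real_sqrt_mult)
  from of_real_mult[where 'a = complex, of "sqrt (1/7)" "sqrt (1/7)", symmetric] this[of "1/7" 2] this[of "1/14" 4] this[of "1/2" 4] this[of 2 2]
  show "complex_of_real (sqrt (1/7)) * of_real (sqrt (1/7)) = 1/7"
    "complex_of_real (sqrt (2/7)) = of_real (sqrt (1/7)) * of_real (sqrt 2)"
    "complex_of_real (sqrt (1/14)) * 2 = of_real (sqrt (1/7)) * of_real (sqrt 2)"
    "complex_of_real (sqrt (1/2)) * 2 = of_real (sqrt 2)"
    "complex_of_real (sqrt 2) * of_real (sqrt 2) = 2" by simp_all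
qed

text \<open>Under inversion \<open>tri\<close> picks up -7 * (1/7) = -1 relative to the products
  with undissected theta functions. The relative sign therefore flips, which is why these products
  are subtracted in \<open>F23\<close> and \<open>F32\<close> but added in their partners
  \<open>F43\<close> and \<open>F34\<close>.\<close>

lemma F_inversion:
  assumes \<tau>: "Im \<tau> > 0" and u: "u < 4"
  defines "c \<equiv> - of_real (sqrt (1 / 7)) * csqrt (- \<i> * \<tau>) ^ 3"
  shows "F23 (nome (-1 / \<tau>)) u = c * dft7 (F43 (nome \<tau>)) u"
    and "F43 (nome (-1 / \<tau>)) u = c * dft7 (F23 (nome \<tau>)) u"
    and "F34 (nome (-1 / \<tau>)) u = c * dft7 (F32 (nome \<tau>)) u"
    and "F32 (nome (-1 / \<tau>)) u = c * dft7 (F34 (nome \<tau>)) u"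
proof -
  let ?P = "nome (-1 / \<tau>)" and ?p = "nome \<tau>"
  define \<sigma> where "\<sigma> = csqrt (- \<i> * \<tau>)"
  define a where "a = complex_of_real (sqrt (1/7))"
  define b where "b = complex_of_real (sqrt 2)"
  define a2 where "a2 = complex_of_real (sqrt (2/7))"
  define a14 where "a14 = complex_of_real (sqrt (1/14))"
  define b2 where "b2 = complex_of_real (sqrt (1/2))"
  \<comment> \<open>With the square roots replaced by letters subject to these relations only, the
    four claims become polynomial identities.\<close>
  have rel: "a * a = 1/7" "a2 = a * b" "a14 * 2 = a * b" "b2 * 2 = b" "b * b = 2"
    using sqrt_complex_facts by (simp_all add: a_def b_def a2_def a14_def b2_def)
  note inv = k3_inversion[OF \<tau>] k2_inversion[OF \<tau>] k4_inversion[OF \<tau>] g23_inversion[OF \<tau>] g34_inversion[OF \<tau>]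
    th3_inversion[OF \<tau>] th4_inversion[OF \<tau>] th2_inversion[OF \<tau>] th23_inversion[OF \<tau>] th34_inversion[OF \<tau>]
  note inv' = inv[folded \<sigma>_def a_def b_def a2_def a14_def b2_def]
  have c: "c = - a * \<sigma> ^ 3" by (simp add: c_def a_def \<sigma>_def)
  have t1: "tri (g23 ?P) (k3 ?P) u = - 7 * (a2 * \<sigma>) * (a * \<sigma>)\<^sup>2 * dft7 (tri (g34 ?p) (k3 ?p)) u"
    unfolding tri_cong[OF inv'(4) inv'(1)] tri_scale tri_dft7[OF u] by simp
  have t2: "tri (g34 ?P) (k3 ?P) u = - 7 * (a14 * \<sigma>) * (a * \<sigma>)\<^sup>2 * dft7 (tri (g23 ?p) (k3 ?p)) u"
    unfolding tri_cong[OF inv'(5) inv'(1)] tri_scale tri_dft7[OF u] by simp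
  have t3: "tri (g34 ?P) (k4 ?P) u = - 7 * (a14 * \<sigma>) * (a * \<sigma>)\<^sup>2 * dft7 (tri (g23 ?p) (k2 ?p)) u"
    unfolding tri_cong[OF inv'(5) inv'(3)] tri_scale tri_dft7[OF u] by simp
  have t4: "tri (g23 ?P) (k2 ?P) u = - 7 * (a2 * \<sigma>) * (a * \<sigma>)\<^sup>2 * dft7 (tri (g34 ?p) (k4 ?p)) u"
    unfolding tri_cong[OF inv'(4) inv'(2)] tri_scale tri_dft7[OF u] by simp
  show "F23 ?P u = c * dft7 (F43 ?p) u"
    unfolding F23_def F43_def dft7_lin t1 inv' c b_def[symmetric] using rel by algebra
  show "F43 ?P u = c * dft7 (F23 ?p) u"
    unfolding F23_def F43_def dft7_lin t2 inv' c b_def[symmetric] using rel by algebra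
  show "F34 ?P u = c * dft7 (F32 ?p) u"
    unfolding F34_def F32_def dft7_lin t3 inv' c b_def[symmetric] using rel by algebra
  show "F32 ?P u = c * dft7 (F34 ?p) u"
    unfolding F34_def F32_def dft7_lin t4 inv' c b_def[symmetric] using rel by algebra
qed

section \<open>The invariant norm\<close>

definition sqnorm :: "(nat \<Rightarrow> complex) \<Rightarrow> real" where
  "sqnorm v = (cmod (v 0))\<^sup>2 + 2 * ((cmod (v 1))\<^sup>2 + (cmod (v 2))\<^sup>2 + (cmod (v 3))\<^sup>2)"

text \<open>Parseval for even functions modulo 7: the weight 2 in \<open>sqnorm\<close> accounts for
  the two residues u and -u behind each index u = 1, 2, 3.\<close>

lemma sqnorm_dft7: "sqnorm (dft7 v) = 7 * sqnorm v"
proof -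
  note c = cos7_relations_complex
  have "complex_of_real (sqnorm (dft7 v)) = of_real (7 * sqnorm v)"
    unfolding sqnorm_def of_real_add of_real_mult of_real_numeral complex_norm_square One_nat_def dft7_simps
    using c by simp algebra
  then show ?thesis by (simp only: of_real_eq_iff)
qed

lemma sqnorm_scale:
  assumes "\<And>u. u < 4 \<Longrightarrow> cmod (v u) = a * cmod (w u)"
  shows "sqnorm v = a\<^sup>2 * sqnorm w"
  using assms[of 0] assms[of 1] assms[of 2] assms[of 3] unfolding sqnorm_def
  by (simp add: power_mult_distrib algebra_simps)

section \<open>Translations\<close>

lemma theta_sum_rotate:
  assumes "\<And>n. of_real (s n) * x ^ (N * nat (n\<^sup>2)) = y * of_real (s' n)"
  shows "theta_sum s N (x * p) = y * theta_sum s' N p"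
proof -
  have "theta_sum s N (x * p) = (\<Sum>\<^sub>\<infinity>n. y * (of_real (s' n) * p ^ (N * nat (n\<^sup>2))))"
    unfolding theta_sum_def
  proof (rule infsum_cong)
    fix n
    have "of_real (s n) * (x * p) ^ (N * nat (n\<^sup>2)) = (of_real (s n) * x ^ (N * nat (n\<^sup>2))) * p ^ (N * nat (n\<^sup>2))"
      by (simp add: power_mult_distrib)
    then show "of_real (s n) * (x * p) ^ (N * nat (n\<^sup>2)) = y * (of_real (s' n) * p ^ (N * nat (n\<^sup>2)))"
      unfolding assms by (simp add: mult.assoc)
  qed
  then show ?thesis by (simp add: theta_sum_def infsum_cmult_right')
qed

abbreviation \<omega> :: complex where "\<omega> \<equiv> nome 1"

lemma nome_add_1: "nome (\<tau> + 1) = \<omega> * nome \<tau>" "nome (1 + \<tau>) = \<omega> * nome \<tau>"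
  by (simp_all add: nome_def exp_add[symmetric] add_divide_distrib algebra_simps)

lemma \<omega>_pow_112: "\<omega> ^ 112 = 1"
  unfolding nome_power using exp_two_pi_i by (simp add: mult_ac)

lemma norm_\<omega> [simp]: "cmod \<omega> = 1"
  by (simp add: norm_nome)

lemma \<omega>_pow_cong: "112 dvd int a - int b \<Longrightarrow> \<omega> ^ a = \<omega> ^ b"
proof -
  have red: "\<omega> ^ a = \<omega> ^ (a mod 112)" for a
  proof -
    have "\<omega> ^ a = \<omega> ^ (112 * (a div 112) + a mod 112)" by simp
    also have "\<dots> = \<omega> ^ (a mod 112)" unfolding power_add power_mult \<omega>_pow_112 by simp
    finally show ?thesis .
  qed
  assume "112 dvd int a - int b"
  then have "int a mod 112 = int b mod 112" by (simp add: mod_eq_dvd_iff)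
  then have "a mod 112 = b mod 112" by (metis of_nat_eq_iff of_nat_numeral zmod_int)
  then show ?thesis using red[of a] red[of b] by simp
qed

lemma \<omega>_pow_56: "\<omega> ^ 56 = -1"
  unfolding nome_power by (simp add: mult.commute[of _ pi])

lemma res_nonzeroD: "res u n \<noteq> 0 \<Longrightarrow> \<exists>v j. v\<^sup>2 = u\<^sup>2 \<and> n = v + 7 * j"
proof -
  assume "res u n \<noteq> 0"
  then consider "7 dvd n - u" | "7 dvd n + u" by (auto simp: res_def of_bool_def split: if_splits)
  then show ?thesis
  proof cases
    case 1
    then obtain j where "n - u = 7 * j" by (elim dvdE)
    then have "n = u + 7 * j" by simp
    then show ?thesis by blast
  next
    case 2
    then obtain j where "n + u = 7 * j" by (elim dvdE)
    then have "(- u)\<^sup>2 = u\<^sup>2 \<and> n = - u + 7 * j" by simp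
    then show ?thesis by blast
  qed
qed

lemma odd_square_mod_8: "odd (n::int) \<Longrightarrow> 8 dvd n\<^sup>2 - 1"
proof -
  assume "odd n"
  then obtain a where n: "n = 2 * a + 1" by (elim oddE)
  have "2 dvd a * (a + 1)" by simp
  then obtain b where "a * (a + 1) = 2 * b" by (elim dvdE)
  then have "n\<^sup>2 - 1 = 8 * b" unfolding n by (simp add: power2_eq_square algebra_simps)
  then show ?thesis by simp
qed

lemma dvd_56I: "8 dvd x \<Longrightarrow> 7 dvd x \<Longrightarrow> 56 dvd (x::int)" by presburger
lemma dvd_28I: "4 dvd x \<Longrightarrow> 7 dvd x \<Longrightarrow> 28 dvd (x::int)" by presburger
lemma dvd_14I: "2 dvd x \<Longrightarrow> 7 dvd x \<Longrightarrow> 14 dvd (x::int)" by presburger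

lemma theta_vec_rotate:
  assumes "\<And>n v j. v\<^sup>2 = (int u)\<^sup>2 \<Longrightarrow> a * n = v + 7 * j \<Longrightarrow> of_real (w n) * x ^ (N * nat (n\<^sup>2)) = y * of_real (w' n)"
  shows "theta_vec w a N (x * p) u = y * theta_vec w' a N p u"
  unfolding theta_vec_def
proof (rule theta_sum_rotate)
  fix n
  show "of_real (w n * res (int u) (a * n)) * x ^ (N * nat (n\<^sup>2)) = y * of_real (w' n * res (int u) (a * n))"
  proof (cases "res (int u) (a * n) = 0")
    case False
    from res_nonzeroD[OF this] obtain v j where vj: "v\<^sup>2 = (int u)\<^sup>2" "a * n = v + 7 * j" by blast
    have "of_real (w n * res (int u) (a * n)) * x ^ (N * nat (n\<^sup>2)) = (of_real (w n) * x ^ (N * nat (n\<^sup>2))) * of_real (res (int u) (a * n))"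
      by simp
    also have "\<dots> = y * of_real (w' n * res (int u) (a * n))" unfolding assms[OF vj] by simp
    finally show ?thesis .
  qed simp
qed

text \<open>8 and 7 are the idempotents of the integers modulo 14, so n^2 is congruent to 8 v^2 plus
  7 for odd n. Multiplying by 8 gives the exponent modulo 112.\<close>

lemma \<omega>_8_square:
  assumes "v\<^sup>2 = (int u)\<^sup>2" "n = v + 7 * j"
  shows "\<omega> ^ (8 * nat (n\<^sup>2)) = (\<omega> ^ 64) ^ (u\<^sup>2) * of_real (alt n)"
proof -
  have "14 dvd n\<^sup>2 - (8 * v\<^sup>2 + 7 * b)" if "2 dvd n\<^sup>2 - b" for b
  proof (rule dvd_14I)
    show "2 dvd n\<^sup>2 - (8 * v\<^sup>2 + 7 * b)" using that by presburger
    have "n\<^sup>2 - (8 * v\<^sup>2 + 7 * b) = 7 * (2 * v * j + 7 * j\<^sup>2 - v\<^sup>2 - b)"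
      unfolding assms(2) by (simp add: power2_eq_square algebra_simps)
    then show "7 dvd n\<^sup>2 - (8 * v\<^sup>2 + 7 * b)" by simp
  qed
  from this[of "of_bool (odd n)"] have "14 dvd n\<^sup>2 - (8 * (int u)\<^sup>2 + 7 * of_bool (odd n))"
    by (simp add: assms(1))
  then have "8 * 14 dvd 8 * (n\<^sup>2 - (8 * (int u)\<^sup>2 + 7 * of_bool (odd n)))" by (rule mult_dvd_mono[OF dvd_refl])
  then have "\<omega> ^ (8 * nat (n\<^sup>2)) = \<omega> ^ (64 * u\<^sup>2 + 56 * of_bool (odd n))"
    by (intro \<omega>_pow_cong) (simp add: algebra_simps)
  also have "\<dots> = (\<omega> ^ 64) ^ (u\<^sup>2) * of_real (alt n)"
    unfolding power_add power_mult \<omega>_pow_56 by (simp add: alt_def)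
  finally show ?thesis .
qed

lemma k3_rotate: "k3 (\<omega> * p) u = (\<omega> ^ 64) ^ (u\<^sup>2) * k4 p u"
  unfolding k3_def k4_def by (rule theta_vec_rotate) (use \<omega>_8_square in simp)

lemma k4_rotate: "k4 (\<omega> * p) u = (\<omega> ^ 64) ^ (u\<^sup>2) * k3 p u"
  unfolding k3_def k4_def by (rule theta_vec_rotate) (use \<omega>_8_square in \<open>auto simp: alt_def\<close>)

text \<open>The condition says n = 2 v modulo 7. Hence 16 n^2 becomes 64 u^2 modulo 112, and thanks
  to a = 4 the vector \<open>g34\<close> rotates with the same constant as \<open>k3\<close> and
  \<open>k4\<close>.\<close>

lemma four_mult_residue:
  assumes "v\<^sup>2 = (int u)\<^sup>2" "4 * n = v + 7 * j"
  shows "7 dvd n\<^sup>2 - 4 * (int u)\<^sup>2"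
proof -
  have "n = 2 * v + 7 * (2 * j - n)" using assms(2) by simp
  then obtain i where i: "n = 2 * v + 7 * i" by blast
  have "n\<^sup>2 - 4 * v\<^sup>2 = 7 * (4 * v * i + 7 * i\<^sup>2)" unfolding i by (simp add: power2_eq_square algebra_simps)
  then show ?thesis using assms(1) by simp
qed

lemma g34_rotate: "g34 (\<omega> * p) u = (\<omega> ^ 64) ^ (u\<^sup>2) * g34 p u"
  unfolding g34_def
proof (rule theta_vec_rotate)
  fix n v j assume "v\<^sup>2 = (int u)\<^sup>2" "4 * n = v + 7 * j"
  from four_mult_residue[OF this] have "16 * 7 dvd 16 * (n\<^sup>2 - 4 * (int u)\<^sup>2)" by (rule mult_dvd_mono[OF dvd_refl])
  then have "\<omega> ^ (16 * nat (n\<^sup>2)) = \<omega> ^ (64 * u\<^sup>2)" by (intro \<omega>_pow_cong) (simp add: algebra_simps)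
  then show "of_real (alt n) * \<omega> ^ (16 * nat (n\<^sup>2)) = (\<omega> ^ 64) ^ (u\<^sup>2) * of_real (alt n)"
    by (simp add: power_mult)
qed

lemma th3_rotate: "th3 (\<omega> * p) = th4 p" and th4_rotate: "th4 (\<omega> * p) = th3 p"
proof -
  have w: "\<omega> ^ (56 * nat (n\<^sup>2)) = of_real (alt n)" for n :: int
  proof -
    have "even (nat (n\<^sup>2)) \<longleftrightarrow> even n" by (metis even_nat_iff even_power pos2 zero_le_power2)
    then show ?thesis unfolding power_mult \<omega>_pow_56 by (simp add: alt_def)
  qed
  show "th3 (\<omega> * p) = th4 p" "th4 (\<omega> * p) = th3 p"
    unfolding th3_def th4_def
    using theta_sum_rotate[of "\<lambda>_. 1" \<omega> 56 1 alt p] theta_sum_rotate[of alt \<omega> 56 1 "\<lambda>_. 1" p]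
    unfolding w of_real_mult[symmetric] by (simp_all add: alt_def)
qed

lemma th34_rotate: "th34 (\<omega> * p) = th34 p"
  unfolding th34_def using theta_sum_rotate[where y = 1 and s = alt and s' = alt] by (simp add: power_mult \<omega>_pow_112)

text \<open>In each monomial of \<open>tri g k u\<close> the squares of the three indices add up to
  u^2 modulo 7.\<close>

lemma tri_rotate:
  fixes z :: complex
  assumes z: "z ^ 7 = 1" and u: "u < 4"
  shows "tri (\<lambda>u. c * (z ^ (u\<^sup>2) * g u)) (\<lambda>u. d * (z ^ (u\<^sup>2) * k u)) u = c * d\<^sup>2 * z ^ (u\<^sup>2) * tri g k u"
proof -
  have "tri (\<lambda>u. z ^ (u\<^sup>2) * g u) (\<lambda>u. z ^ (u\<^sup>2) * k u) u = z ^ (u\<^sup>2) * tri g k u"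
    by (rule less_4I[OF _ _ _ _ u], use z in \<open>(simp add: tri_def Let_def, algebra)+\<close>)
  then show ?thesis by (simp add: tri_scale mult.assoc)
qed

lemma \<omega>_roots: "(\<omega> ^ 64) ^ 7 = 1" "(\<omega> ^ 16) ^ 7 = 1"
  unfolding power_mult[symmetric] using \<omega>_pow_cong[of 448 0] \<omega>_pow_112 by simp_all

lemma F43_rotate: "u < 4 \<Longrightarrow> F43 (\<omega> * p) u = (\<omega> ^ 64) ^ (u\<^sup>2) * F34 p u"
  and F34_rotate: "u < 4 \<Longrightarrow> F34 (\<omega> * p) u = (\<omega> ^ 64) ^ (u\<^sup>2) * F43 p u"
proof -
  assume u: "u < 4"
  have r: "g34 (\<omega> * p) u = 1 * ((\<omega> ^ 64) ^ (u\<^sup>2) * g34 p u)" "k3 (\<omega> * p) u = 1 * ((\<omega> ^ 64) ^ (u\<^sup>2) * k4 p u)"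
    "k4 (\<omega> * p) u = 1 * ((\<omega> ^ 64) ^ (u\<^sup>2) * k3 p u)" for u
    by (simp_all add: g34_rotate k3_rotate k4_rotate)
  show "F43 (\<omega> * p) u = (\<omega> ^ 64) ^ (u\<^sup>2) * F34 p u"
    unfolding F43_def F34_def th3_rotate th34_rotate tri_cong[OF r(1,2)] tri_rotate[OF \<omega>_roots(1) u] r by (simp add: algebra_simps)
  show "F34 (\<omega> * p) u = (\<omega> ^ 64) ^ (u\<^sup>2) * F43 p u"
    unfolding F43_def F34_def th4_rotate th34_rotate tri_cong[OF r(1,3)] tri_rotate[OF \<omega>_roots(1) u] r by (simp add: algebra_simps)
qed

lemma k3_rotate2: "k3 (\<omega>\<^sup>2 * p) u = 1 * ((\<omega> ^ 16) ^ (u\<^sup>2) * k3 p u)"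
proof -
  have "\<omega> ^ 64 * \<omega> ^ 64 = \<omega> ^ 16"
    unfolding power_add[symmetric] by (rule \<omega>_pow_cong) simp
  then have "(\<omega> ^ 64) ^ (u\<^sup>2) * (\<omega> ^ 64) ^ (u\<^sup>2) = (\<omega> ^ 16) ^ (u\<^sup>2)"
    by (metis power_mult_distrib)
  moreover have "k3 (\<omega>\<^sup>2 * p) u = (\<omega> ^ 64) ^ (u\<^sup>2) * ((\<omega> ^ 64) ^ (u\<^sup>2) * k3 p u)"
    using k3_rotate[of "\<omega> * p" u] k4_rotate[of p u] by (simp only: power2_eq_square[of \<omega>] mult.assoc)
  ultimately show ?thesis by (simp only: mult.assoc[symmetric] mult_1)
qed

text \<open>Odd squares are constant modulo 8 but not modulo 16, so only the translation by 2 acts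
  diagonally. The exponents are 98 = 2 * 49 and 16 = 2 * 8, where 49 and 8 are the idempotents
  modulo 56.\<close>

lemma g23_rotate2: "g23 (\<omega>\<^sup>2 * p) u = \<omega> ^ 98 * ((\<omega> ^ 16) ^ (u\<^sup>2) * g23 p u)"
  unfolding g23_def mult.assoc[symmetric]
proof (rule theta_vec_rotate)
  fix n v j assume vj: "v\<^sup>2 = (int u)\<^sup>2" "1 * n = v + 7 * j"
  show "of_real (odd_ind n) * (\<omega>\<^sup>2) ^ (1 * nat (n\<^sup>2)) = \<omega> ^ 98 * (\<omega> ^ 16) ^ (u\<^sup>2) * of_real (odd_ind n)"
  proof (cases "odd n")
    case True
    have "56 dvd n\<^sup>2 - (8 * v\<^sup>2 + 49)"
    proof (rule dvd_56I)
      show "8 dvd n\<^sup>2 - (8 * v\<^sup>2 + 49)" using odd_square_mod_8[OF True] by presburger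
      have "n\<^sup>2 - (8 * v\<^sup>2 + 49) = 7 * (2 * v * j + 7 * j\<^sup>2 - v\<^sup>2 - 7)"
        using vj(2) by (simp add: power2_eq_square algebra_simps)
      then show "7 dvd n\<^sup>2 - (8 * v\<^sup>2 + 49)" by simp
    qed
    then have "2 * 56 dvd 2 * (n\<^sup>2 - (8 * (int u)\<^sup>2 + 49))" unfolding vj(1) by (rule mult_dvd_mono[OF dvd_refl])
    then have "\<omega> ^ (2 * nat (n\<^sup>2)) = \<omega> ^ (98 + 16 * u\<^sup>2)" by (intro \<omega>_pow_cong) (simp add: algebra_simps)
    then show ?thesis by (simp add: power_add power_mult)
  qed simp
qed

lemma k2_rotate2: "k2 (\<omega>\<^sup>2 * p) u = \<omega> ^ 84 * ((\<omega> ^ 16) ^ (u\<^sup>2) * k2 p u)"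
  unfolding k2_def mult.assoc[symmetric]
proof (rule theta_vec_rotate)
  fix n v j assume vj: "v\<^sup>2 = (int u)\<^sup>2" "4 * n = v + 7 * j"
  show "of_real (odd_ind n) * (\<omega>\<^sup>2) ^ (2 * nat (n\<^sup>2)) = \<omega> ^ 84 * (\<omega> ^ 16) ^ (u\<^sup>2) * of_real (odd_ind n)"
  proof (cases "odd n")
    case True
    \<comment> \<open>21 is 1 modulo 4 and 0 modulo 7, while 4 u^2 is 0 modulo 4 and the required
      residue modulo 7; multiplication by 4 yields 84 and 16.\<close>
    have "28 dvd n\<^sup>2 - (4 * (int u)\<^sup>2 + 21)"
    proof (rule dvd_28I)
      show "4 dvd n\<^sup>2 - (4 * (int u)\<^sup>2 + 21)" using odd_square_mod_8[OF True] by presburger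
      show "7 dvd n\<^sup>2 - (4 * (int u)\<^sup>2 + 21)" using four_mult_residue[OF vj] by presburger
    qed
    then have "4 * 28 dvd 4 * (n\<^sup>2 - (4 * (int u)\<^sup>2 + 21))" by (rule mult_dvd_mono[OF dvd_refl])
    then have "\<omega> ^ (4 * nat (n\<^sup>2)) = \<omega> ^ (84 + 16 * u\<^sup>2)" by (intro \<omega>_pow_cong) (simp add: algebra_simps)
    then show ?thesis by (simp add: power_add power_mult[symmetric])
  qed simp
qed

lemma th3_rotate2: "th3 (\<omega>\<^sup>2 * p) = th3 p"
  using th3_rotate[of "\<omega> * p"] th4_rotate[of p] by (simp add: power2_eq_square mult.assoc)

lemma th2_rotate2: "th2 (\<omega>\<^sup>2 * p) = \<omega> ^ 28 * th2 p"
  and th23_rotate2: "th23 (\<omega>\<^sup>2 * p) = \<omega> ^ 14 * th23 p"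
proof -
  have *: "\<omega> ^ (2 * (14 * nat (n\<^sup>2))) = \<omega> ^ 28" "\<omega> ^ (2 * (7 * nat (n\<^sup>2))) = \<omega> ^ 14" if n: "odd n" for n :: int
  proof -
    obtain b where "n\<^sup>2 - 1 = 8 * b" using odd_square_mod_8[OF n] by (elim dvdE)
    then have n: "n\<^sup>2 = 8 * b + 1" by simp
    show "\<omega> ^ (2 * (14 * nat (n\<^sup>2))) = \<omega> ^ 28" "\<omega> ^ (2 * (7 * nat (n\<^sup>2))) = \<omega> ^ 14"
      by (rule \<omega>_pow_cong, simp, simp add: n)+
  qed
  show "th2 (\<omega>\<^sup>2 * p) = \<omega> ^ 28 * th2 p" "th23 (\<omega>\<^sup>2 * p) = \<omega> ^ 14 * th23 p"
    unfolding th2_def th23_def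
    by (rule theta_sum_rotate, use * in \<open>auto simp: power_mult[symmetric]\<close>)+
qed

lemma F23_rotate2: "u < 4 \<Longrightarrow> F23 (\<omega>\<^sup>2 * p) u = \<omega> ^ 98 * (\<omega> ^ 16) ^ (u\<^sup>2) * F23 p u"
proof -
  assume u: "u < 4"
  have w: "\<omega> ^ 98 = \<omega> ^ 84 * \<omega> ^ 14" by (simp flip: power_add)
  have "a * 1\<^sup>2 * d * t - (a * (d * g) * h\<^sup>2 + 2 * (b * (d * k)) * (c * m) * h) = a * d * (t - (g * h\<^sup>2 + 2 * k * m * h))"
    if "a = b * c" for a b c d t g h k m :: complex
    unfolding that by (simp add: algebra_simps)
  from this[OF w] show ?thesis
    unfolding F23_def tri_cong[OF g23_rotate2 k3_rotate2] tri_rotate[OF \<omega>_roots(2) u]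
      th3_rotate2 th23_rotate2 g23_rotate2 k2_rotate2 .
qed

lemma F32_rotate2: "u < 4 \<Longrightarrow> F32 (\<omega>\<^sup>2 * p) u = \<omega> ^ 42 * (\<omega> ^ 16) ^ (u\<^sup>2) * F32 p u"
proof -
  assume u: "u < 4"
  \<comment> \<open>The three kinds of terms in \<open>F32\<close> acquire the same phase: 98 + 168,
    98 + 56 and 14 + 28 are all 42 modulo 112.\<close>
  have w: "\<omega> ^ 98 * (\<omega> ^ 84)\<^sup>2 = \<omega> ^ 42" "\<omega> ^ 98 * (\<omega> ^ 28)\<^sup>2 = \<omega> ^ 42" "\<omega> ^ 14 * \<omega> ^ 28 = \<omega> ^ 42"
    unfolding power_mult[symmetric] power_add[symmetric] by (rule \<omega>_pow_cong, simp)+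
  have "a * b\<^sup>2 * d * t - (a * (d * g) * (e * h)\<^sup>2 + 2 * (1 * (d * k)) * (f * m) * (e * h)) = c * d * (t - (g * h\<^sup>2 + 2 * k * m * h))"
    if e: "a * b\<^sup>2 = c" "a * e\<^sup>2 = c" "f * e = c" for a b c d e f t g h k m :: complex
  proof -
    have "a * b\<^sup>2 * d * t - (a * (d * g) * (e * h)\<^sup>2 + 2 * (1 * (d * k)) * (f * m) * (e * h)) =
      (a * b\<^sup>2) * d * t - ((a * e\<^sup>2) * d * g * h\<^sup>2 + 2 * (f * e) * d * k * m * h)"
      by (simp add: power_mult_distrib algebra_simps)
    then show ?thesis unfolding e by (simp add: algebra_simps)
  qed
  from this[OF w] show ?thesis
    unfolding F32_def tri_cong[OF g23_rotate2 k2_rotate2] tri_rotate[OF \<omega>_roots(2) u]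
      th2_rotate2 th23_rotate2 g23_rotate2 k3_rotate2 .
qed

lemma sqnorm_rotate:
  "sqnorm (F43 (\<omega> * p)) = sqnorm (F34 p)" "sqnorm (F34 (\<omega> * p)) = sqnorm (F43 p)"
  "sqnorm (F23 (\<omega>\<^sup>2 * p)) = sqnorm (F23 p)" "sqnorm (F32 (\<omega>\<^sup>2 * p)) = sqnorm (F32 p)"
  using sqnorm_scale[of "F43 (\<omega> * p)" 1 "F34 p"] sqnorm_scale[of "F34 (\<omega> * p)" 1 "F43 p"]
    sqnorm_scale[of "F23 (\<omega>\<^sup>2 * p)" 1 "F23 p"] sqnorm_scale[of "F32 (\<omega>\<^sup>2 * p)" 1 "F32 p"]
  by (simp_all add: F43_rotate F34_rotate F23_rotate2 F32_rotate2 norm_mult norm_power)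

section \<open>Vanishing\<close>

text \<open>The modulus of the invariant function is bounded by \<open>K\<close>, but a zero of order 29 in the local
  parameter at the cusp forces it, by the maximum principle between the heights \<open>y\<close> and \<open>0.9 y\<close>, below \<open>c * K\<close>
  with \<open>c < 1\<close>.\<close>

definition weight_fn :: "(complex \<Rightarrow> nat \<Rightarrow> complex) \<Rightarrow> complex \<Rightarrow> real" where
  "weight_fn F \<tau> = Im \<tau> ^ 3 * (sqnorm (F (nome \<tau>)))\<^sup>2"

definition vanishes29 :: "(complex \<Rightarrow> complex) \<Rightarrow> bool" where
  "vanishes29 f \<longleftrightarrow> (\<exists>r. r holomorphic_on ball 0 1 \<and> (\<forall>p. norm p < 1 \<longrightarrow> f p = p ^ 29 * r p))"

lemma sqnorm_nonneg: "sqnorm v \<ge> 0" by (simp add: sqnorm_def)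

lemma sqnorm_eq_0: "sqnorm v = 0 \<Longrightarrow> u < 4 \<Longrightarrow> v u = 0"
  by (erule less_4I[rotated 4]) (unfold sqnorm_def, (smt (verit) norm_eq_zero power_not_zero zero_le_power2)+)

lemma sqnorm_Cauchy_Schwarz:
  "cmod (cnj (v 0) * w 0 + 2 * (cnj (v 1) * w 1 + cnj (v 2) * w 2 + cnj (v 3) * w 3)) ^ 2 \<le> sqnorm v * sqnorm w"
proof -
  define a b where "a = (\<lambda>i::nat. (if i = 0 then 1 else sqrt 2) * cmod (v i))" and "b = (\<lambda>i::nat. (if i = 0 then 1 else sqrt 2) * cmod (w i))"
  have "cmod (cnj (v 0) * w 0 + 2 * (cnj (v 1) * w 1 + cnj (v 2) * w 2 + cnj (v 3) * w 3)) \<le>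
      cmod (v 0) * cmod (w 0) + 2 * (cmod (v 1) * cmod (w 1) + cmod (v 2) * cmod (w 2) + cmod (v 3) * cmod (w 3))"
    by (intro order_trans[OF norm_triangle_ineq] add_mono) (auto simp: norm_mult intro!: order_trans[OF norm_triangle_ineq] add_mono)
  also have "\<dots> = (\<Sum>i\<in>{0,1,2,3}. a i * b i)"
  proof -
    have "sqrt 2 * x * (sqrt 2 * y) = (sqrt 2 * sqrt 2) * (x * y)" for x y :: real by (simp only: mult_ac)
    then have *: "sqrt 2 * x * (sqrt 2 * y) = 2 * (x * y)" for x y :: real by simp
    show ?thesis by (simp add: a_def b_def *)
  qed
  finally have "cmod (cnj (v 0) * w 0 + 2 * (cnj (v 1) * w 1 + cnj (v 2) * w 2 + cnj (v 3) * w 3)) ^ 2 \<le> (\<Sum>i\<in>{0,1,2,3}. a i * b i) ^ 2"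
    by (intro power_mono) auto
  also have "\<dots> \<le> (\<Sum>i\<in>{0,1,2,3}. (a i)\<^sup>2) * (\<Sum>i\<in>{0,1,2,3}. (b i)\<^sup>2)"
    by (rule Cauchy_Schwarz_ineq_sum)
  also have "(\<Sum>i\<in>{0,1,2,3}. (a i)\<^sup>2) = sqnorm v"
    by (simp add: a_def sqnorm_def power_mult_distrib)
  also have "(\<Sum>i\<in>{0,1,2,3}. (b i)\<^sup>2) = sqnorm w"
    by (simp add: b_def sqnorm_def power_mult_distrib)
  finally show ?thesis .
qed

lemma Im_minus_inverse: "Im (-1 / \<tau>) = Im \<tau> / (cmod \<tau>)\<^sup>2"
  by (simp add: Im_divide cmod_power2)

text \<open>In weight 3/2 the squared norm gains |\<tau>|^3, while Im \<tau> is divided by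
  |\<tau>|^2. Squaring once more in \<open>weight_fn\<close> avoids the half-integral power of Im
  \<tau>.\<close>

lemma weight_fn_inversion:
  assumes \<tau>: "Im \<tau> > 0"
  shows "weight_fn F23 (-1 / \<tau>) = weight_fn F43 \<tau>" "weight_fn F43 (-1 / \<tau>) = weight_fn F23 \<tau>"
    "weight_fn F34 (-1 / \<tau>) = weight_fn F32 \<tau>" "weight_fn F32 (-1 / \<tau>) = weight_fn F34 \<tau>"
proof -
  define \<kappa> where "\<kappa> = cmod (- of_real (sqrt (1 / 7)) * csqrt (- \<i> * \<tau>) ^ 3)"
  have "(cmod (csqrt (- \<i> * \<tau>)))\<^sup>2 = cmod \<tau>"
    by (simp add: norm_power[symmetric] norm_mult)
  moreover have "\<kappa>\<^sup>2 = 1 / 7 * ((cmod (csqrt (- \<i> * \<tau>)))\<^sup>2) ^ 3"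
  proof -
    have "\<kappa> = sqrt (1 / 7) * cmod (csqrt (- \<i> * \<tau>)) ^ 3"
      by (simp only: \<kappa>_def norm_mult norm_power norm_minus_cancel norm_of_real) simp
    then show ?thesis by (simp only: power_mult_distrib power_mult[symmetric]) (simp add: mult.commute)
  qed
  ultimately have \<kappa>: "\<kappa>\<^sup>2 * 7 = cmod \<tau> ^ 3" by (simp only:)
  have gen: "weight_fn F (-1 / \<tau>) = weight_fn G \<tau>"
    if "\<And>u. u < 4 \<Longrightarrow> F (nome (-1 / \<tau>)) u = - of_real (sqrt (1 / 7)) * csqrt (- \<i> * \<tau>) ^ 3 * dft7 (G (nome \<tau>)) u" for F G
  proof -
    have "sqnorm (F (nome (-1 / \<tau>))) = \<kappa>\<^sup>2 * sqnorm (dft7 (G (nome \<tau>)))"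
      by (rule sqnorm_scale) (simp only: that \<kappa>_def norm_mult)
    then have "sqnorm (F (nome (-1 / \<tau>))) = cmod \<tau> ^ 3 * sqnorm (G (nome \<tau>))"
      unfolding sqnorm_dft7 \<kappa>[symmetric] by simp
    moreover have "\<tau> \<noteq> 0" using \<tau> by auto
    ultimately show ?thesis unfolding weight_fn_def Im_minus_inverse
      by (simp add: power_divide power_mult_distrib power_mult[symmetric])
  qed
  show "weight_fn F23 (-1 / \<tau>) = weight_fn F43 \<tau>" "weight_fn F43 (-1 / \<tau>) = weight_fn F23 \<tau>"
    "weight_fn F34 (-1 / \<tau>) = weight_fn F32 \<tau>" "weight_fn F32 (-1 / \<tau>) = weight_fn F34 \<tau>"
    by (rule gen; rule F_inversion[OF \<tau>]; assumption)+
qed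

lemma nome_surj:
  assumes "norm p = exp (- (2 * pi * y / 112))"
  obtains \<tau> where "Im \<tau> = y" "nome \<tau> = p"
proof -
  have "p \<noteq> 0" using assms by auto
  define \<tau> where "\<tau> = 112 * ln p / (2 * of_real pi * \<i>)"
  have "nome \<tau> = p" using \<open>p \<noteq> 0\<close> by (simp add: nome_def \<tau>_def)
  moreover from this have "Im \<tau> = y" using assms norm_nome[of \<tau>] by simp
  ultimately show ?thesis using that by blast
qed

text \<open>The maximum principle wants a scalar function, so the vector is paired with its own
  value v at \<tau>; the pairing divided by p^29 is still holomorphic at the cusp. The comparison
  circle at height 9/10 * Im \<tau> may lie below 1/2, hence K has to be a bound on the whole half
  plane.\<close>

lemma vanishing_descent:
  assumes F: "\<And>u. u < 4 \<Longrightarrow> vanishes29 (\<lambda>p. F p u)"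
    and K: "\<And>\<tau>. Im \<tau> > 0 \<Longrightarrow> weight_fn F \<tau> \<le> K" and \<tau>: "Im \<tau> \<ge> 1 / 2"
  shows "weight_fn F \<tau> \<le> (10 / 9) ^ 3 * exp (- (4 * 29 * pi / 1120)) * K"
proof (cases "sqnorm (F (nome \<tau>)) = 0")
  case True
  have "K \<ge> 0" using K[of \<tau>] \<tau> True by (simp add: weight_fn_def)
  then show ?thesis using True by (simp add: weight_fn_def)
next
  case False
  define y where "y = Im \<tau>"
  define n0 where "n0 = sqnorm (F (nome \<tau>))"
  have n0: "n0 > 0" using False sqnorm_nonneg[of "F (nome \<tau>)"] by (simp add: n0_def)
  have y: "y \<ge> 1 / 2" using \<tau> by (simp add: y_def)
  obtain r where r: "\<And>u. u < 4 \<Longrightarrow> r u holomorphic_on ball 0 1" "\<And>u p. u < 4 \<Longrightarrow> norm p < 1 \<Longrightarrow> F p u = p ^ 29 * r u p"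
    using F unfolding vanishes29_def by metis
  define v where "v = F (nome \<tau>)"
  define ip where "ip = (\<lambda>w::nat \<Rightarrow> complex. cnj (v 0) * w 0 + 2 * (cnj (v 1) * w 1 + cnj (v 2) * w 2 + cnj (v 3) * w 3))"
  define h where "h = (\<lambda>p. ip (\<lambda>u. r u p))"
  have h: "h holomorphic_on ball 0 1"
    unfolding h_def ip_def by (intro holomorphic_intros r) auto
  have hF: "ip (F p) = p ^ 29 * h p" if "norm p < 1" for p
    using r(2)[OF _ that] by (simp add: h_def ip_def algebra_simps)
  have ipv: "ip v = of_real n0"
    unfolding ip_def n0_def v_def sqnorm_def of_real_add of_real_mult complex_norm_square of_real_numeral
    by (simp add: algebra_simps)
  define R0 R1 where "R0 = exp (- (2 * pi * y / 112))" and "R1 = exp (- (2 * pi * (9 / 10 * y) / 112))"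
  have R: "0 < R0" "R0 < R1" "R1 < 1" using y by (auto simp: R0_def R1_def)
  have hol: "h holomorphic_on ball 0 R1" "continuous_on (cball 0 R1) h"
    using h R by (auto intro: holomorphic_on_subset holomorphic_on_imp_continuous_on continuous_on_subset)
  define s where "s = sqrt (K / (9 / 10 * y) ^ 3)"
  define B where "B = sqrt (n0 * s) / R1 ^ 29"
  have bd: "norm (h p) \<le> B" if p: "norm p = R1" for p
  proof -
    obtain \<sigma> where \<sigma>: "Im \<sigma> = 9 / 10 * y" "nome \<sigma> = p"
      using nome_surj p unfolding R1_def by blast
    have "(9 / 10 * y) ^ 3 * (sqnorm (F p))\<^sup>2 \<le> K"
      using K[of \<sigma>] \<sigma> y by (simp add: weight_fn_def)
    then have "(sqnorm (F p))\<^sup>2 \<le> K / (9 / 10 * y) ^ 3"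
      using y by (simp add: field_simps)
    then have n1: "sqnorm (F p) \<le> s" unfolding s_def by (rule real_le_rsqrt)
    have "(cmod (ip (F p)))\<^sup>2 \<le> n0 * sqnorm (F p)"
      unfolding ip_def n0_def using sqnorm_Cauchy_Schwarz[of v "F p"] by (simp add: v_def)
    also have "\<dots> \<le> n0 * s" using n1 n0 by simp
    finally have "cmod (ip (F p)) \<le> sqrt (n0 * s)" by (rule real_le_rsqrt)
    then show ?thesis using hF[of p] p R unfolding B_def by (simp add: norm_mult norm_power field_simps)
  qed
  have "norm (h (nome \<tau>)) \<le> B"
  proof (rule maximum_modulus_frontier[of h "cball 0 R1"])
    show "h holomorphic_on interior (cball 0 R1)" using hol R by simp
    show "continuous_on (closure (cball 0 R1)) h" using hol by simp
    show "nome \<tau> \<in> cball 0 R1" using R by (simp add: norm_nome R0_def y_def[symmetric])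
    fix z :: complex assume "z \<in> frontier (cball 0 R1)"
    then show "norm (h z) \<le> B" using R by (intro bd) (simp add: frontier_cball)
  qed auto
  moreover have "n0 = R0 ^ 29 * norm (h (nome \<tau>))"
  proof -
    have "norm (nome \<tau>) < 1" by (rule norm_nome_less_1) (use \<tau> in simp)
    from hF[OF this] have "of_real n0 = nome \<tau> ^ 29 * h (nome \<tau>)" using ipv by (simp add: v_def)
    then have "norm (of_real n0 :: complex) = R0 ^ 29 * norm (h (nome \<tau>))"
      by (simp add: norm_mult norm_power norm_nome R0_def y_def)
    then show ?thesis using n0 by simp
  qed
  ultimately have "n0 \<le> R0 ^ 29 * B" using R by simp
  also have "\<dots> = (R0 / R1) ^ 29 * sqrt (n0 * s)"
    by (simp add: B_def power_divide)
  finally have "n0\<^sup>2 \<le> ((R0 / R1) ^ 29 * sqrt (n0 * s))\<^sup>2"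
    using n0 by (intro power_mono) auto
  moreover have K0: "K \<ge> 0"
    using K[of \<tau>] \<tau> by (metis less_le_trans order_trans weight_fn_def half_gt_zero_iff less_numeral_extra(1) mult_nonneg_nonneg zero_le_power zero_le_power2 less_imp_le)
  ultimately have "n0 * n0 \<le> n0 * (((R0 / R1) ^ 29)\<^sup>2 * s)"
    using n0 y K0 by (simp add: power_mult_distrib power2_eq_square[of n0] mult_ac s_def)
  then have "n0 \<le> ((R0 / R1) ^ 29)\<^sup>2 * s" using n0 by simp
  then have "n0\<^sup>2 \<le> (((R0 / R1) ^ 29)\<^sup>2 * s)\<^sup>2"
    using n0 by (intro power_mono) auto
  \<comment> \<open>116 = 4 * 29: the first squaring removed the root coming from Cauchy-Schwarz,
    the second one matches the square in \<open>weight_fn\<close>.\<close>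
  also have "\<dots> = (R0 / R1) ^ 116 * (K / (9 / 10 * y) ^ 3)"
    using K0 y by (simp add: power_mult_distrib power_mult[symmetric] s_def)
  finally have "y ^ 3 * n0\<^sup>2 \<le> y ^ 3 * ((R0 / R1) ^ 116 * (K / (9 / 10 * y) ^ 3))"
    using y by (intro mult_left_mono) auto
  also have "\<dots> = (10 / 9) ^ 3 * (R0 / R1) ^ 116 * K"
    using y by (simp add: power_mult_distrib field_simps)
  also have "\<dots> \<le> (10 / 9) ^ 3 * exp (- (4 * 29 * pi / 1120)) * K"
  proof -
    have "R0 / R1 = exp (- (2 * pi * y / 1120))"
      unfolding R0_def R1_def exp_diff[symmetric] by (simp add: field_simps)
    then have "(R0 / R1) ^ 116 = exp (- (2 * pi * y / 1120) * 116)"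
      by (simp add: exp_of_nat2_mult[symmetric] mult.commute)
    also have "\<dots> \<le> exp (- (4 * 29 * pi / 1120))"
      using y by (simp add: field_simps)
    finally show ?thesis using K0 by (intro mult_right_mono mult_left_mono) auto
  qed
  finally show ?thesis by (simp add: weight_fn_def n0_def y_def)
qed

text \<open>The source of the order 29: with ratio 9/10 and height 1/2, order 28 would leave a
  constant slightly above 1.\<close>

lemma descent_constant_less_1: "(10 / 9) ^ 3 * exp (- (4 * 29 * pi / 1120)) < (1::real)"
proof -
  have "3.1415 < pi" using pi_approx by simp
  then have "0.3253 \<le> 4 * 29 * pi / 1120" by simp
  then have "exp (0.3253 :: real) \<le> exp (4 * 29 * pi / 1120)" by simp
  moreover have "1 + 0.3253 + 0.3253\<^sup>2 / 2 + 0 \<le> exp (0.3253 :: real)"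
    using exp_lower_Taylor_quadratic[of "0.3253"] by simp
  moreover have "(10 / 9) ^ 3 < (1 + 0.3253 + 0.3253\<^sup>2 / 2 :: real)" by (simp add: power2_eq_square power3_eq_cube)
  ultimately have "(10 / 9) ^ 3 < exp (4 * 29 * pi / 1120)" by linarith
  then show ?thesis by (simp add: exp_minus field_simps)
qed

text \<open>Makes the supremum in the descent finite: the quotients by p^29 are bounded on a compact
  disc, and the decay of |p|^116 beats the growth of (Im \<tau>)^3.\<close>

lemma vanishes29_bounded:
  assumes F: "\<And>u. u < 4 \<Longrightarrow> vanishes29 (\<lambda>p. F p u)"
  shows "\<exists>C. \<forall>\<tau>. Im \<tau> \<ge> 1 / 2 \<longrightarrow> weight_fn F \<tau> \<le> C"
proof -
  define R where "R = exp (- (2 * pi * (1 / 2) / 112))"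
  have R: "0 < R" "R < 1" by (auto simp: R_def)
  have "\<exists>C. C \<ge> 0 \<and> (\<forall>p\<in>cball 0 R. cmod (F p u) \<le> C * cmod p ^ 29)" if u: "u < 4" for u
  proof -
    obtain r where r: "r holomorphic_on ball 0 1" "\<And>p. norm p < 1 \<Longrightarrow> F p u = p ^ 29 * r p"
      using F[OF u] unfolding vanishes29_def by blast
    have "continuous_on (cball 0 R) r"
      using r(1) R by (auto intro: holomorphic_on_imp_continuous_on continuous_on_subset)
    then have "bounded (r ` cball 0 R)" by (intro compact_imp_bounded compact_continuous_image compact_cball)
    then obtain C where "C > 0" "\<forall>x\<in>r ` cball 0 R. norm x \<le> C"
      unfolding bounded_pos by blast
    then have C: "\<And>p. p \<in> cball 0 R \<Longrightarrow> cmod (r p) \<le> C" "C > 0" by auto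
    have "cmod (F p u) \<le> C * cmod p ^ 29" if "p \<in> cball 0 R" for p
      using r(2)[of p] C(1)[OF that] that R by (simp add: norm_mult norm_power mult.commute mult_right_mono)
    then show ?thesis using C(2) by (intro exI[of _ C]) auto
  qed
  then obtain C where C: "\<And>u. u < 4 \<Longrightarrow> C u \<ge> 0" "\<And>u p. u < 4 \<Longrightarrow> p \<in> cball 0 R \<Longrightarrow> cmod (F p u) \<le> C u * cmod p ^ 29"
    by metis
  define D where "D = (C 0)\<^sup>2 + 2 * ((C 1)\<^sup>2 + (C 2)\<^sup>2 + (C 3)\<^sup>2)"
  have "weight_fn F \<tau> \<le> D\<^sup>2" if \<tau>: "Im \<tau> \<ge> 1 / 2" for \<tau>
  proof -
    define p where "p = nome \<tau>"
    have p: "p \<in> cball 0 R" using \<tau> by (simp add: p_def norm_nome R_def)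
    have sq: "(cmod (F p u))\<^sup>2 \<le> (C u)\<^sup>2 * cmod p ^ 58" if "u < 4" for u
    proof -
      have "(cmod (F p u))\<^sup>2 \<le> (C u * cmod p ^ 29)\<^sup>2"
        using C(2)[OF that p] by (intro power_mono) auto
      also have "\<dots> = (C u)\<^sup>2 * cmod p ^ 58" by (simp add: power_mult_distrib power_mult[symmetric])
      finally show ?thesis .
    qed
    have "sqnorm (F p) \<le> D * cmod p ^ 58"
      using sq[of 0] sq[of 1] sq[of 2] sq[of 3] by (simp add: sqnorm_def D_def distrib_right)
    then have "(sqnorm (F p))\<^sup>2 \<le> (D * cmod p ^ 58)\<^sup>2"
      by (intro power_mono sqnorm_nonneg)
    also have "\<dots> = D\<^sup>2 * cmod p ^ 116" by (simp add: power_mult_distrib power_mult[symmetric])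
    finally have "weight_fn F \<tau> \<le> Im \<tau> ^ 3 * (D\<^sup>2 * cmod p ^ 116)"
      unfolding weight_fn_def p_def using \<tau> by (intro mult_left_mono) auto
    also have "\<dots> = D\<^sup>2 * (Im \<tau> ^ 3 * cmod p ^ 116)" by simp
    also have "Im \<tau> ^ 3 * cmod p ^ 116 \<le> 1"
    proof -
      have "Im \<tau> ^ 3 \<le> exp (Im \<tau>) ^ 3" using \<tau> exp_ge_add_one_self[of "Im \<tau>"] by (intro power_mono) linarith+
      moreover have "cmod p ^ 116 \<le> inverse (exp (Im \<tau>) ^ 3)"
      proof -
        have "cmod p ^ 116 = exp (116 * (- (2 * pi * Im \<tau> / 112)))"
          unfolding p_def norm_nome by (simp add: exp_of_nat2_mult[symmetric] mult.commute)
        also have "\<dots> \<le> exp (- (3 * Im \<tau>))"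
        proof -
          have "3 * Im \<tau> \<le> 116 * 2 * pi / 112 * Im \<tau>"
            using \<tau> pi_gt3 by (intro mult_right_mono) auto
          then show ?thesis by simp
        qed
        also have "\<dots> = inverse (exp (Im \<tau>) ^ 3)"
          by (simp add: exp_minus exp_of_nat2_mult[symmetric] mult.commute)
        finally show ?thesis .
      qed
      ultimately have "Im \<tau> ^ 3 * cmod p ^ 116 \<le> exp (Im \<tau>) ^ 3 * inverse (exp (Im \<tau>) ^ 3)"
        by (intro mult_mono) auto
      then show ?thesis by simp
    qed
    then have "D\<^sup>2 * (Im \<tau> ^ 3 * cmod p ^ 116) \<le> D\<^sup>2 * 1" by (intro mult_left_mono) auto
    finally show ?thesis by simp
  qed
  then show ?thesis by blast
qed

text \<open>Doubling the imaginary part while it is below \<open>1/2\<close> replaces the reduction to the fundamental domain of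
  the modular group.\<close>

context
  fixes \<F>
  assumes S: "\<And>F. F \<in> \<F> \<Longrightarrow> \<exists>G\<in>\<F>. \<forall>\<tau>. Im \<tau> > 0 \<longrightarrow> weight_fn F (-1 / \<tau>) = weight_fn G \<tau>"
    and T: "\<And>F. F \<in> \<F> \<Longrightarrow> \<exists>G\<in>\<F>. \<forall>\<tau>. weight_fn F (\<tau> + 1) = weight_fn G \<tau>"
    and T': "\<And>F. F \<in> \<F> \<Longrightarrow> \<exists>G\<in>\<F>. \<forall>\<tau>. weight_fn F (\<tau> - 1) = weight_fn G \<tau>"
begin

lemma modular_reduction:
  "F \<in> \<F> \<Longrightarrow> Im \<tau> > 0 \<Longrightarrow> Im \<tau> * 2 ^ n \<ge> 1 / 2 \<Longrightarrow> \<exists>G\<in>\<F>. \<exists>\<sigma>. Im \<sigma> \<ge> 1 / 2 \<and> weight_fn F \<tau> = weight_fn G \<sigma>"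
proof (induction n arbitrary: F \<tau>)
  case 0
  then show ?case by auto
next
  case (Suc n)
  show ?case
  proof (cases "Im \<tau> \<ge> 1 / 2")
    case True then show ?thesis using Suc.prems by blast
  next
    case False
    have shift: "\<exists>G\<in>\<F>. \<forall>\<tau>. weight_fn F (\<tau> + of_int m) = weight_fn G \<tau>" if "F \<in> \<F>" for m F
      using that
    proof (induction m arbitrary: F rule: int_induct[where k = 0])
      case base then show ?case by auto
    next
      case (step1 i)
      obtain G where "G \<in> \<F>" "\<And>\<tau>. weight_fn F (\<tau> + 1) = weight_fn G \<tau>" using T[OF step1.prems] by blast
      moreover obtain G' where "G' \<in> \<F>" "\<And>\<tau>. weight_fn G (\<tau> + of_int i) = weight_fn G' \<tau>"
        using step1.IH[OF \<open>G \<in> \<F>\<close>] by blast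
      moreover have "\<tau> + of_int (i + 1) = (\<tau> + of_int i) + 1" for \<tau> :: complex by simp
      ultimately show ?case by metis
    next
      case (step2 i)
      obtain G where "G \<in> \<F>" "\<And>\<tau>. weight_fn F (\<tau> - 1) = weight_fn G \<tau>" using T'[OF step2.prems] by blast
      moreover obtain G' where "G' \<in> \<F>" "\<And>\<tau>. weight_fn G (\<tau> + of_int i) = weight_fn G' \<tau>"
        using step2.IH[OF \<open>G \<in> \<F>\<close>] by blast
      moreover have "\<tau> + of_int (i - 1) = (\<tau> + of_int i) - 1" for \<tau> :: complex by simp
      ultimately show ?case by metis
    qed
    define m where "m = round (Re \<tau>)"
    define \<rho> where "\<rho> = \<tau> - of_int m"
    have \<rho>: "Im \<rho> = Im \<tau>" "\<bar>Re \<rho>\<bar> \<le> 1 / 2"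
      using of_int_round_abs_le[of "Re \<tau>"] by (auto simp: \<rho>_def m_def abs_minus_commute)
    obtain G where G: "G \<in> \<F>" "\<And>\<tau>. weight_fn F (\<tau> + of_int m) = weight_fn G \<tau>"
      using shift[OF Suc.prems(1)] by blast
    have FG: "weight_fn F \<tau> = weight_fn G \<rho>" using G(2)[of \<rho>] by (simp add: \<rho>_def)
    obtain H where H: "H \<in> \<F>" "\<And>\<tau>. Im \<tau> > 0 \<Longrightarrow> weight_fn G (-1 / \<tau>) = weight_fn H \<tau>"
      using S[OF G(1)] by blast
    define \<sigma> where "\<sigma> = -1 / \<rho>"
    \<comment> \<open>Both coordinates of \<rho> are at most 1/2 in modulus, so |\<rho>|^2 \<le>
      1/2, and inversion divides the imaginary part by |\<rho>|^2.\<close>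
    have "(Re \<rho>)\<^sup>2 \<le> (1 / 2)\<^sup>2" using \<rho>(2) by (metis abs_ge_zero power2_abs power_mono)
    moreover have "(Im \<rho>)\<^sup>2 \<le> (1 / 2)\<^sup>2" using False \<rho> Suc.prems by (intro power_mono) auto
    ultimately have c: "(cmod \<rho>)\<^sup>2 \<le> 1 / 2"
      unfolding cmod_power2 by (simp add: power_divide)
    have \<rho>0: "Im \<rho> > 0" "\<rho> \<noteq> 0" using \<rho> Suc.prems by auto
    have "Im \<sigma> \<ge> 2 * Im \<tau>"
    proof -
      have e: "Im \<sigma> = Im \<rho> / (cmod \<rho>)\<^sup>2" unfolding \<sigma>_def by (rule Im_minus_inverse)
      then have "Im \<sigma> \<ge> 0" "Im \<sigma> * (cmod \<rho>)\<^sup>2 = Im \<tau>" using \<rho>0 \<rho>(1) by simp_all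
      then show ?thesis using mult_left_mono[OF c, of "Im \<sigma>"] by simp
    qed
    then have "2 * Im \<tau> * 2 ^ n \<le> Im \<sigma> * 2 ^ n" by (rule mult_right_mono) simp
    moreover have "1 / 2 \<le> 2 * Im \<tau> * 2 ^ n" using Suc.prems(3) by (simp add: mult_ac)
    ultimately have "Im \<sigma> * 2 ^ n \<ge> 1 / 2" by linarith
    moreover have "Im \<sigma> > 0" using \<open>Im \<sigma> \<ge> 2 * Im \<tau>\<close> Suc.prems(2) by linarith
    ultimately have "Im \<sigma> > 0" "Im \<sigma> * 2 ^ n \<ge> 1 / 2" by blast+
    from Suc.IH[OF H(1) this] obtain G' \<sigma>' where "G' \<in> \<F>" "Im \<sigma>' \<ge> 1 / 2" "weight_fn H \<sigma> = weight_fn G' \<sigma>'"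
      by blast
    moreover have "weight_fn G \<rho> = weight_fn H \<sigma>"
      using H(2)[OF \<open>Im \<sigma> > 0\<close>] \<rho>0 by (simp add: \<sigma>_def)
    ultimately show ?thesis using FG by metis
  qed
qed

text \<open>Let K be the supremum over all members and the whole half plane. Every value is already
  taken by some member at height at least 1/2, which makes K finite and gives K \<le> c * K with c <
  1 by the descent.\<close>

theorem modular_vanishing:
  assumes fin: "finite \<F>"
    and V: "\<And>F u. F \<in> \<F> \<Longrightarrow> u < 4 \<Longrightarrow> vanishes29 (\<lambda>p. F p u)"
    and F: "F \<in> \<F>" and \<tau>: "Im \<tau> > 0" and u: "u < 4"
  shows "F (nome \<tau>) u = 0"
proof -
  have red: "\<exists>G\<in>\<F>. \<exists>\<sigma>. Im \<sigma> \<ge> 1 / 2 \<and> weight_fn F \<tau> = weight_fn G \<sigma>" if "F \<in> \<F>" "Im \<tau> > 0" for F \<tau>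
  proof -
    obtain n where "1 / 2 / Im \<tau> < 2 ^ n" using real_arch_pow[of 2 "1 / 2 / Im \<tau>"] by auto
    then have "Im \<tau> * 2 ^ n \<ge> 1 / 2" using that by (simp add: field_simps)
    from modular_reduction[OF that this] show ?thesis by blast
  qed
  have "\<exists>C. \<forall>\<tau>. Im \<tau> \<ge> 1 / 2 \<longrightarrow> weight_fn F \<tau> \<le> C" if "F \<in> \<F>" for F
    using vanishes29_bounded V[OF that] by blast
  then obtain C where C: "\<And>F \<tau>. F \<in> \<F> \<Longrightarrow> Im \<tau> \<ge> 1 / 2 \<Longrightarrow> weight_fn F \<tau> \<le> C F" by metis
  define X where "X = {weight_fn F \<tau> | F \<tau>. F \<in> \<F> \<and> Im \<tau> > 0}"
  have redX: "\<exists>G\<in>\<F>. \<exists>\<sigma>. Im \<sigma> \<ge> 1 / 2 \<and> x = weight_fn G \<sigma>" if "x \<in> X" for x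
    using that red unfolding X_def by blast
  have "bdd_above X"
  proof
    fix x assume "x \<in> X"
    then obtain G \<sigma> where "G \<in> \<F>" "Im \<sigma> \<ge> 1 / 2" "x = weight_fn G \<sigma>"
      using redX by blast
    then have "x \<le> C G" using C by blast
    also have "C G \<le> Max (C ` \<F>)" using fin \<open>G \<in> \<F>\<close> by auto
    finally show "x \<le> Max (C ` \<F>)" .
  qed
  moreover have "X \<noteq> {}" using F \<tau> by (auto simp: X_def)
  define K where "K = Sup X"
  ultimately have K: "weight_fn G \<sigma> \<le> K" if "G \<in> \<F>" "Im \<sigma> > 0" for G \<sigma>
    unfolding K_def using that by (intro cSup_upper) (auto simp: X_def)
  define c :: real where "c = (10 / 9) ^ 3 * exp (- (4 * 29 * pi / 1120))"
  have "x \<le> c * K" if x: "x \<in> X" for x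
  proof -
    obtain G \<sigma> where G: "G \<in> \<F>" "Im \<sigma> \<ge> 1 / 2" "x = weight_fn G \<sigma>"
      using redX[OF x] by blast
    show ?thesis unfolding G(3) c_def
      by (rule vanishing_descent[OF V[OF G(1)] K[OF G(1)] G(2)])
  qed
  then have "K \<le> c * K" unfolding K_def using \<open>X \<noteq> {}\<close> by (intro cSup_least) (auto simp: K_def)
  moreover have "c < 1" unfolding c_def by (rule descent_constant_less_1)
  moreover have "K \<ge> 0"
    using K[OF F \<tau>] \<tau> by (smt (verit) weight_fn_def mult_nonneg_nonneg zero_le_power zero_le_power2)
  ultimately have "K = 0" using mult_right_mono[of c 1 K] by (smt (verit) mult_less_cancel_right2)
  then have "weight_fn F \<tau> \<le> 0" using K[OF F \<tau>] by simp
  then have "Im \<tau> ^ 3 * (sqnorm (F (nome \<tau>)))\<^sup>2 \<le> 0" by (simp add: weight_fn_def)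
  then have "sqnorm (F (nome \<tau>)) = 0"
    using \<tau> by (simp add: mult_le_0_iff not_le[symmetric])
  then show ?thesis using u by (rule sqnorm_eq_0)
qed

end

section \<open>Expansions at the cusp modulo p^29\<close>

definition approx29 :: "(complex \<Rightarrow> complex) \<Rightarrow> (complex \<Rightarrow> complex) \<Rightarrow> bool" where
  "approx29 f P \<longleftrightarrow> f holomorphic_on ball 0 1 \<and> P holomorphic_on ball 0 1 \<and> vanishes29 (\<lambda>p. f p - P p)"

lemma approx29_add: "approx29 f P \<Longrightarrow> approx29 g Q \<Longrightarrow> approx29 (\<lambda>p. f p + g p) (\<lambda>p. P p + Q p)"
  and approx29_diff: "approx29 f P \<Longrightarrow> approx29 g Q \<Longrightarrow> approx29 (\<lambda>p. f p - g p) (\<lambda>p. P p - Q p)"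
  and approx29_mult: "approx29 f P \<Longrightarrow> approx29 g Q \<Longrightarrow> approx29 (\<lambda>p. f p * g p) (\<lambda>p. P p * Q p)"
proof -
  assume a: "approx29 f P" "approx29 g Q"
  obtain r where r: "r holomorphic_on ball 0 1" "\<And>p. norm p < 1 \<Longrightarrow> f p - P p = p ^ 29 * r p"
    using a unfolding approx29_def vanishes29_def by blast
  obtain s where s: "s holomorphic_on ball 0 1" "\<And>p. norm p < 1 \<Longrightarrow> g p - Q p = p ^ 29 * s p"
    using a unfolding approx29_def vanishes29_def by blast
  have h: "f holomorphic_on ball 0 1" "P holomorphic_on ball 0 1" "g holomorphic_on ball 0 1" "Q holomorphic_on ball 0 1"
    using a unfolding approx29_def by auto
  have "vanishes29 (\<lambda>p. (f p + g p) - (P p + Q p))" unfolding vanishes29_def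
    by (intro exI[of _ "\<lambda>p. r p + s p"] conjI holomorphic_intros r s) (use r(2) s(2) in \<open>auto simp: algebra_simps\<close>)
  then show "approx29 (\<lambda>p. f p + g p) (\<lambda>p. P p + Q p)"
    unfolding approx29_def using h by (auto intro!: holomorphic_intros)
  have "vanishes29 (\<lambda>p. (f p - g p) - (P p - Q p))" unfolding vanishes29_def
    by (intro exI[of _ "\<lambda>p. r p - s p"] conjI holomorphic_intros r s) (use r(2) s(2) in \<open>auto simp: algebra_simps\<close>)
  then show "approx29 (\<lambda>p. f p - g p) (\<lambda>p. P p - Q p)"
    unfolding approx29_def using h by (auto intro!: holomorphic_intros)
  have "f p * g p - P p * Q p = p ^ 29 * (r p * g p + P p * s p)" if "norm p < 1" for p
  proof -
    have "f p * g p - P p * Q p = (f p - P p) * g p + P p * (g p - Q p)" by (simp add: algebra_simps)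
    also have "\<dots> = p ^ 29 * (r p * g p + P p * s p)" using r(2)[OF that] s(2)[OF that] by (simp add: algebra_simps)
    finally show ?thesis .
  qed
  then have "vanishes29 (\<lambda>p. f p * g p - P p * Q p)" unfolding vanishes29_def
    by (intro exI[of _ "\<lambda>p. r p * g p + P p * s p"] conjI holomorphic_intros r s h) auto
  then show "approx29 (\<lambda>p. f p * g p) (\<lambda>p. P p * Q p)"
    unfolding approx29_def using h by (auto intro!: holomorphic_intros)
qed

lemma approx29_const: "approx29 (\<lambda>_. c) (\<lambda>_. c)"
  unfolding approx29_def vanishes29_def by (auto intro!: holomorphic_intros exI[of _ "\<lambda>_. 0"])

lemma approx29_power2: "approx29 f P \<Longrightarrow> approx29 (\<lambda>p. (f p)\<^sup>2) (\<lambda>p. (P p)\<^sup>2)"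
  unfolding power2_eq_square by (rule approx29_mult)

lemma approx29_vanishes:
  assumes a: "approx29 f P" and r: "\<And>p. P p = p ^ 29 * r p" "r holomorphic_on ball 0 1"
  shows "vanishes29 f"
proof -
  obtain s where s: "s holomorphic_on ball 0 1" "\<And>p. norm p < 1 \<Longrightarrow> f p - P p = p ^ 29 * s p"
    using a unfolding approx29_def vanishes29_def by blast
  have "f p = p ^ 29 * (s p + r p)" if "norm p < 1" for p
    using s(2)[OF that] r(1)[of p] by (simp add: algebra_simps)
  then show ?thesis unfolding vanishes29_def
    by (intro exI[of _ "\<lambda>p. s p + r p"] conjI holomorphic_intros s r) auto
qed

lemma theta_sum_approx:
  assumes s: "\<And>n. \<bar>s n\<bar> \<le> 1" and A: "finite A" and N: "N > 0"
    and big: "\<And>n. n \<notin> A \<Longrightarrow> s n \<noteq> 0 \<Longrightarrow> N * nat (n\<^sup>2) \<ge> 29"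
    and P: "\<And>p. P p = (\<Sum>n\<in>A. of_real (s n) * p ^ (N * nat (n\<^sup>2)))"
  shows "approx29 (theta_sum s N) P"
proof -
  define c where "c = (\<lambda>n. if n \<in> A then 0 else complex_of_real (s n))"
  \<comment> \<open>The subtraction of natural numbers is truncated only where the coefficient is 0:
    on A by definition of \<open>c\<close>, elsewhere by the assumption \<open>big\<close>.\<close>
  define r where "r = (\<lambda>p::complex. \<Sum>\<^sub>\<infinity>n. c n * p ^ (N * nat (n\<^sup>2) - 29))"
  have le: "nat \<bar>n\<bar> \<le> N * nat (n\<^sup>2)" for n :: int
    using nat_abs_le_nat_square[of n] N by (metis le_trans mult_le_mono1 mult_1 Suc_leI One_nat_def)
  have r: "r holomorphic_on ball 0 1" unfolding r_def
  proof (rule power_series_int_holomorphic[of _ 1 _ 29])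
    show "nat \<bar>n\<bar> \<le> N * nat (n\<^sup>2) - 29 + 29" for n :: int using le[of n] by linarith
  qed (use s in \<open>auto simp: c_def\<close>)
  have "theta_sum s N p - P p = p ^ 29 * r p" if p: "norm p < 1" for p
  proof -
    let ?f = "\<lambda>n. complex_of_real (s n) * p ^ (N * nat (n\<^sup>2))"
    have sm: "?f summable_on UNIV"
      by (rule abs_summable_summable[OF theta_sum_summable[OF s N p]])
    have "theta_sum s N p = infsum ?f A + infsum ?f (UNIV - A)"
      unfolding theta_sum_def using infsum_Un_disjoint[of ?f A "UNIV - A"] A summable_on_subset_banach[OF sm]
      by (auto simp del: infsum_finite)
    also have "infsum ?f A = P p" using A by (simp add: P)
    also have "infsum ?f (UNIV - A) = (\<Sum>\<^sub>\<infinity>n. p ^ 29 * (c n * p ^ (N * nat (n\<^sup>2) - 29)))"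
    proof (rule infsum_cong_neutral)
      fix n assume n: "n \<in> (UNIV - A) \<inter> UNIV"
      show "?f n = p ^ 29 * (c n * p ^ (N * nat (n\<^sup>2) - 29))"
      proof (cases "s n = 0")
        case False
        then have "p ^ (N * nat (n\<^sup>2)) = p ^ 29 * p ^ (N * nat (n\<^sup>2) - 29)"
          using big[of n] n by (simp flip: power_add)
        then show ?thesis using n by (simp add: c_def mult_ac)
      qed (simp add: c_def)
    qed (auto simp: c_def)
    also have "\<dots> = p ^ 29 * r p" unfolding r_def by (rule infsum_cmult_right')
    finally show ?thesis by simp
  qed
  moreover have "P holomorphic_on ball 0 1" unfolding P by (intro holomorphic_intros)
  moreover have "theta_sum s N holomorphic_on ball 0 1" by (rule theta_sum_holomorphic[OF s N])
  ultimately show ?thesis unfolding approx29_def vanishes29_def using r by blast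
qed

lemma square_bound: "n \<notin> {-m..m} \<Longrightarrow> 0 \<le> m \<Longrightarrow> (m + 1)\<^sup>2 \<le> (n::int)\<^sup>2"
proof -
  assume "n \<notin> {-m..m}" "0 \<le> m"
  then have "m + 1 \<le> \<bar>n\<bar>" "0 \<le> m + 1" by auto
  then have "(m + 1)\<^sup>2 \<le> \<bar>n\<bar>\<^sup>2" by (rule power_mono)
  then show ?thesis by simp
qed

lemma theta_sum_approx_interval:
  assumes s: "\<And>n. \<bar>s n\<bar> \<le> 1" and m: "0 \<le> m" "29 \<le> N * nat ((m + 1)\<^sup>2)"
  shows "approx29 (theta_sum s N) (\<lambda>p. \<Sum>n\<in>{-m..m}. of_real (s n) * p ^ (N * nat (n\<^sup>2)))"
proof (rule theta_sum_approx[OF s])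
  fix n :: int assume "n \<notin> {-m..m}"
  then have "nat ((m + 1)\<^sup>2) \<le> nat (n\<^sup>2)" using square_bound[of n m] m by (intro nat_mono) auto
  then have "N * nat ((m + 1)\<^sup>2) \<le> N * nat (n\<^sup>2)" by simp
  then show "29 \<le> N * nat (n\<^sup>2)" using m(2) by linarith
next
  show "0 < N" using m(2) by (cases "N = 0") auto
qed auto

lemma intervals: "{-1..1::int} = {-1, 0, 1}" "{-2..2::int} = {-2, -1, 0, 1, 2}"
  "{-3..3::int} = {-3, -2, -1, 0, 1, 2, 3}" "{-5..5::int} = {-5, -4, -3, -2, -1, 0, 1, 2, 3, 4, 5}"
  unfolding set_eq_iff atLeastAtMost_iff insert_iff empty_iff by presburger+

lemma theta_vec_approx:
  assumes "\<And>n. \<bar>w n\<bar> \<le> 1" "0 \<le> m" "29 \<le> N * nat ((m + 1)\<^sup>2)"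
  shows "approx29 (\<lambda>p. theta_vec w a N p u) (\<lambda>p. \<Sum>n\<in>{-m..m}. of_real (w n * res (int u) (a * n)) * p ^ (N * nat (n\<^sup>2)))"
  unfolding theta_vec_def
  by (rule theta_sum_approx_interval) (use assms abs_res_le in \<open>auto simp: abs_mult mult_le_one\<close>)

lemma approx_g23:
  "approx29 (\<lambda>p. g23 p 0) (\<lambda>p. 0)" "approx29 (\<lambda>p. g23 p 1) (\<lambda>p. p)" "approx29 (\<lambda>p. g23 p 2) (\<lambda>p. p ^ 25)" "approx29 (\<lambda>p. g23 p 3) (\<lambda>p. p ^ 9)"
  using theta_vec_approx[of odd_ind 5 1 1 0] theta_vec_approx[of odd_ind 5 1 1 1] theta_vec_approx[of odd_ind 5 1 1 2] theta_vec_approx[of odd_ind 5 1 1 3]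
  unfolding g23_def intervals by (simp_all add: res_def)

lemma approx_k2:
  "approx29 (\<lambda>p. k2 p 0) (\<lambda>p. 0)" "approx29 (\<lambda>p. k2 p 1) (\<lambda>p. 0)" "approx29 (\<lambda>p. k2 p 2) (\<lambda>p. p ^ 18)" "approx29 (\<lambda>p. k2 p 3) (\<lambda>p. p ^ 2)"
  using theta_vec_approx[of odd_ind 3 2 4 0] theta_vec_approx[of odd_ind 3 2 4 1] theta_vec_approx[of odd_ind 3 2 4 2] theta_vec_approx[of odd_ind 3 2 4 3]
  unfolding k2_def intervals by (simp_all add: res_def)

lemma approx_k3:
  "approx29 (\<lambda>p. k3 p 0) (\<lambda>p. 1)" "approx29 (\<lambda>p. k3 p 1) (\<lambda>p. p ^ 8)" "approx29 (\<lambda>p. k3 p 2) (\<lambda>p. 0)" "approx29 (\<lambda>p. k3 p 3) (\<lambda>p. 0)"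
  using theta_vec_approx[of "\<lambda>_. 1" 1 8 1 0] theta_vec_approx[of "\<lambda>_. 1" 1 8 1 1] theta_vec_approx[of "\<lambda>_. 1" 1 8 1 2] theta_vec_approx[of "\<lambda>_. 1" 1 8 1 3]
  unfolding k3_def intervals by (simp_all add: res_def)

lemma approx_k4:
  "approx29 (\<lambda>p. k4 p 0) (\<lambda>p. 1)" "approx29 (\<lambda>p. k4 p 1) (\<lambda>p. - (p ^ 8))" "approx29 (\<lambda>p. k4 p 2) (\<lambda>p. 0)" "approx29 (\<lambda>p. k4 p 3) (\<lambda>p. 0)"
  using theta_vec_approx[of alt 1 8 1 0] theta_vec_approx[of alt 1 8 1 1] theta_vec_approx[of alt 1 8 1 2] theta_vec_approx[of alt 1 8 1 3]
  unfolding k4_def intervals by (simp_all add: res_def alt_def)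

lemma approx_g34:
  "approx29 (\<lambda>p. g34 p 0) (\<lambda>p. 1)" "approx29 (\<lambda>p. g34 p 1) (\<lambda>p. 0)" "approx29 (\<lambda>p. g34 p 2) (\<lambda>p. 0)" "approx29 (\<lambda>p. g34 p 3) (\<lambda>p. - (p ^ 16))"
  using theta_vec_approx[of alt 1 16 4 0] theta_vec_approx[of alt 1 16 4 1] theta_vec_approx[of alt 1 16 4 2] theta_vec_approx[of alt 1 16 4 3]
  unfolding g34_def intervals by (simp_all add: res_def alt_def)

lemma approx_th: "approx29 th3 (\<lambda>p. 1)" "approx29 th4 (\<lambda>p. 1)" "approx29 th34 (\<lambda>p. 1)"
  "approx29 th2 (\<lambda>p. 2 * p ^ 14)" "approx29 th23 (\<lambda>p. 2 * p ^ 7)"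
  using theta_sum_approx_interval[of "\<lambda>_. 1" 0 56] theta_sum_approx_interval[of alt 0 56] theta_sum_approx_interval[of alt 0 112]
    theta_sum_approx_interval[of odd_ind 1 14] theta_sum_approx_interval[of odd_ind 2 7]
  unfolding th3_def th4_def th34_def th2_def th23_def intervals by (simp_all add: alt_def)

lemmas approx29_intros = approx29_add approx29_diff approx29_mult approx29_const approx29_power2
  approx_g23 approx_g34 approx_k2 approx_k3 approx_k4 approx_th

lemma tri_simps:
  "tri g k 0 = 8 * (g 1 * k 2 * k 3 + g 2 * k 3 * k 1 + g 3 * k 1 * k 2) - 3 * g 0 * (k 0)\<^sup>2"
  "tri g k 1 = g 1 * (k 0)\<^sup>2 + 2 * g 0 * k 0 * k 1 + 4 * k 0 * g 2 * k 2 + 2 * g 0 * (k 2)\<^sup>2 + 4 * g 2 * (k 3)\<^sup>2 + 8 * g 3 * k 2 * k 3"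
  "tri g k 2 = g 2 * (k 0)\<^sup>2 + 2 * g 0 * k 0 * k 2 + 4 * k 0 * g 3 * k 3 + 2 * g 0 * (k 3)\<^sup>2 + 4 * g 3 * (k 1)\<^sup>2 + 8 * g 1 * k 3 * k 1"
  "tri g k 3 = g 3 * (k 0)\<^sup>2 + 2 * g 0 * k 0 * k 3 + 4 * k 0 * g 1 * k 1 + 2 * g 0 * (k 1)\<^sup>2 + 4 * g 1 * (k 2)\<^sup>2 + 8 * g 2 * k 1 * k 2"
  by (simp_all add: tri_def Let_def)

lemmas collect_powers = power_mult_distrib mult.assoc power_mult[symmetric] power_add[symmetric]
  power_Suc[symmetric] power_Suc2[symmetric]

text \<open>With every theta series cut off at degree 28, the combinations become explicit
  polynomials. All of them cancel identically except for the leftovers -4 p^53 and -4 sqrt 2 p^32,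
  whose quotients by p^29 are the nonzero choices of r.\<close>

lemma F_vanishes:
  assumes "u < 4"
  shows "vanishes29 (\<lambda>p. F23 p u)" "vanishes29 (\<lambda>p. F32 p u)" "vanishes29 (\<lambda>p. F43 p u)" "vanishes29 (\<lambda>p. F34 p u)"
  by (rule less_4I[OF _ _ _ _ assms]; unfold F23_def F32_def F43_def F34_def tri_simps;
      rule approx29_vanishes[where r = "\<lambda>_. 0"] approx29_vanishes[where r = "\<lambda>p. - 4 * p ^ 24"]
        approx29_vanishes[where r = "\<lambda>p. - 4 * of_real (sqrt 2) * p ^ 3"],
      (rule approx29_intros)+,
      (simp; fail | algebra | (simp, algebra) | (simp add: collect_powers del: power_Suc; fail)), intro holomorphic_intros)+

lemma vanishes29_rotate: "vanishes29 f \<Longrightarrow> vanishes29 (\<lambda>p. f (\<omega> * p))"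
proof -
  assume "vanishes29 f"
  then obtain r where r: "r holomorphic_on ball 0 1" "\<And>p. norm p < 1 \<Longrightarrow> f p = p ^ 29 * r p"
    unfolding vanishes29_def by blast
  have "(r \<circ> (\<lambda>p. \<omega> * p)) holomorphic_on ball 0 1"
    by (rule holomorphic_on_compose_gen[OF _ r(1)]) (auto intro!: holomorphic_intros simp: norm_mult)
  then have "(\<lambda>p. r (\<omega> * p)) holomorphic_on ball 0 1" by (simp add: o_def)
  then show ?thesis unfolding vanishes29_def
    by (intro exI[of _ "\<lambda>p. \<omega> ^ 29 * r (\<omega> * p)"] conjI holomorphic_intros)
      (auto simp: r(2) norm_mult power_mult_distrib)
qed

text \<open>Only the translation by 2 preserves the norms of \<open>F23\<close> and
  \<open>F32\<close>, so their translates by 1 have to be added; with these six members the family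
  is closed under inversion and translation.\<close>

theorem F23_eq_0:
  assumes "Im \<tau> > 0" "u < 4"
  shows "F23 (nome \<tau>) u = 0"
proof -
  define F5 where "F5 = (\<lambda>p. F23 (\<omega> * p))"
  define F6 where "F6 = (\<lambda>p. F32 (\<omega> * p))"
  define \<F> where "\<F> = {F23, F43, F34, F32, F5, F6}"
  have n1: "nome (\<tau> + 1) = \<omega> * nome \<tau>" for \<tau> by (rule nome_add_1)
  have n2: "\<omega> * (\<omega> * p) = \<omega>\<^sup>2 * p" for p by (simp add: power2_eq_square)
  have T: "weight_fn F23 (\<tau> + 1) = weight_fn F5 \<tau>" "weight_fn F5 (\<tau> + 1) = weight_fn F23 \<tau>"
    "weight_fn F32 (\<tau> + 1) = weight_fn F6 \<tau>" "weight_fn F6 (\<tau> + 1) = weight_fn F32 \<tau>"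
    "weight_fn F43 (\<tau> + 1) = weight_fn F34 \<tau>" "weight_fn F34 (\<tau> + 1) = weight_fn F43 \<tau>" for \<tau>
    unfolding weight_fn_def F5_def F6_def n1 n2 sqnorm_rotate by simp_all
  have T': "weight_fn F23 (\<tau> - 1) = weight_fn F5 \<tau>" "weight_fn F5 (\<tau> - 1) = weight_fn F23 \<tau>"
    "weight_fn F32 (\<tau> - 1) = weight_fn F6 \<tau>" "weight_fn F6 (\<tau> - 1) = weight_fn F32 \<tau>"
    "weight_fn F43 (\<tau> - 1) = weight_fn F34 \<tau>" "weight_fn F34 (\<tau> - 1) = weight_fn F43 \<tau>" for \<tau>
    using T[of "\<tau> - 1"] by simp_all
  note S = weight_fn_inversion
  have Im_inv: "Im (-1 / \<tau>) > 0" if "Im \<tau> > 0" for \<tau>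
  proof -
    have "\<tau> \<noteq> 0" using that by auto
    then show ?thesis unfolding Im_minus_inverse using that by simp
  qed
  \<comment> \<open>\<open>S T S = T\<^sup>-\<^sup>1 S T\<^sup>-\<^sup>1\<close> reduces the inversion of the translates to the known transformations.\<close>
  have S5: "weight_fn F5 (-1 / \<tau>) = weight_fn F6 \<tau>" if \<tau>: "Im \<tau> > 0" for \<tau>
  proof -
    define \<rho> where "\<rho> = \<tau> - 1"
    have \<rho>: "Im \<rho> > 0" "\<rho> \<noteq> 0" "\<tau> \<noteq> 0" using \<tau> by (auto simp: \<rho>_def)
    define \<sigma> where "\<sigma> = -1 / \<rho> - 1"
    have \<sigma>: "Im \<sigma> > 0" using Im_inv[OF \<rho>(1)] by (simp add: \<sigma>_def)
    then have "\<sigma> \<noteq> 0" by auto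
    have "-1 / \<sigma> = -1 / \<tau> + 1"
    proof -
      have "\<sigma> = - \<tau> / \<rho>" using \<rho> by (simp add: \<sigma>_def field_simps) (simp add: \<rho>_def algebra_simps)
      then have "-1 / \<sigma> = \<rho> / \<tau>" using \<rho> by simp
      then show ?thesis using \<rho>(3) by (simp add: \<rho>_def field_simps)
    qed
    then have "weight_fn F5 (-1 / \<tau>) = weight_fn F23 (-1 / \<sigma>)" using T(1)[of "-1 / \<tau>"] by simp
    also have "\<dots> = weight_fn F43 \<sigma>" by (rule S(1)[OF \<sigma>])
    also have "\<dots> = weight_fn F34 (-1 / \<rho>)" unfolding \<sigma>_def by (rule T'(5))
    also have "\<dots> = weight_fn F32 \<rho>" by (rule S(3)[OF \<rho>(1)])
    also have "\<dots> = weight_fn F6 \<tau>" unfolding \<rho>_def by (rule T'(3))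
    finally show ?thesis .
  qed
  have S6: "weight_fn F6 (-1 / \<tau>) = weight_fn F5 \<tau>" if \<tau>: "Im \<tau> > 0" for \<tau>
    using S5[OF Im_inv[OF \<tau>]] by simp
  show ?thesis
  proof (rule modular_vanishing[of \<F>, OF _ _ _ _ _ _ assms])
    show "\<exists>G\<in>\<F>. \<forall>\<tau>. Im \<tau> > 0 \<longrightarrow> weight_fn F (-1 / \<tau>) = weight_fn G \<tau>" if "F \<in> \<F>" for F
      using that S S5 S6 unfolding \<F>_def by blast
    show "\<exists>G\<in>\<F>. \<forall>\<tau>. weight_fn F (\<tau> + 1) = weight_fn G \<tau>" if "F \<in> \<F>" for F
      using that T unfolding \<F>_def by blast
    show "\<exists>G\<in>\<F>. \<forall>\<tau>. weight_fn F (\<tau> - 1) = weight_fn G \<tau>" if "F \<in> \<F>" for F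
      using that T' unfolding \<F>_def by blast
    show "vanishes29 (\<lambda>p. F p u)" if "F \<in> \<F>" "u < 4" for F u
      using that(1) F_vanishes[OF that(2)] F_vanishes(1,2)[OF that(2), THEN vanishes29_rotate]
      unfolding \<F>_def F5_def F6_def by blast
  qed (auto simp: \<F>_def)
qed

section \<open>Lattice sums\<close>

lemma has_sum_prod:
  fixes f g :: "_ \<Rightarrow> complex"
  assumes f: "(f has_sum a) A" and g: "(g has_sum b) B"
  shows "((\<lambda>(x, y). f x * g y) has_sum (a * b)) (A \<times> B)"
proof -
  have F: "(\<lambda>x. norm (f x)) summable_on A" and G: "(\<lambda>x. norm (g x)) summable_on B"
    using f g summable_on_iff_abs_summable_on_complex has_sum_imp_summable by blast+
  have "(\<lambda>z. norm (case z of (x, y) \<Rightarrow> f x * g y)) summable_on A \<times> B"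
  proof (rule Infinite_Sum.abs_summable_on_Sigma_iff[THEN iffD2], intro conjI ballI)
    fix x
    show "(\<lambda>y. norm (case (x, y) of (x, y) \<Rightarrow> f x * g y)) summable_on B"
      using G by (simp add: norm_mult summable_on_cmult_right)
  next
    have "(\<lambda>x. norm (f x) * (\<Sum>\<^sub>\<infinity>y\<in>B. norm (g y))) summable_on A"
      by (rule summable_on_cmult_left[OF F])
    then show "(\<lambda>x. norm (\<Sum>\<^sub>\<infinity>y\<in>B. norm (case (x, y) of (x, y) \<Rightarrow> f x * g y))) summable_on A"
      by (simp add: norm_mult infsum_cmult_right' infsum_nonneg abs_mult)
  qed
  then have s: "(\<lambda>(x, y). f x * g y) summable_on A \<times> B"
    by (rule abs_summable_summable)
  have "(\<Sum>\<^sub>\<infinity>(x, y)\<in>A \<times> B. f x * g y) = (\<Sum>\<^sub>\<infinity>x\<in>A. \<Sum>\<^sub>\<infinity>y\<in>B. f x * g y)"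
    using infsum_Sigma'_banach[OF s] by simp
  also have "\<dots> = (\<Sum>\<^sub>\<infinity>x\<in>A. f x * b)"
    using g by (simp add: infsum_cmult_right' infsumI)
  also have "\<dots> = a * b" using f by (simp add: infsum_cmult_left' infsumI)
  finally show ?thesis using has_sum_infsum[OF s] by simp
qed

lemma theta_sum_has_sum:
  fixes p :: complex
  assumes p: "norm p < 1" and N: "N > 0"
  shows "((\<lambda>n. p ^ (N * nat (n\<^sup>2))) has_sum theta_sum (\<lambda>n. of_bool (n \<in> A)) N p) A"
proof -
  have "((\<lambda>n. of_real (of_bool (n \<in> A)) * p ^ (N * nat (n\<^sup>2))) has_sum theta_sum (\<lambda>n. of_bool (n \<in> A)) N p) UNIV"
    unfolding theta_sum_def
    by (rule has_sum_infsum[OF abs_summable_summable[OF theta_sum_summable[of _ 1, OF _ N p]]]) auto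
  then show ?thesis by (subst (asm) has_sum_cong_neutral[where T = A and g = "\<lambda>n. p ^ (N * nat (n\<^sup>2))"]) auto
qed

text \<open>The exponents and w are even in n, so the class of r may be averaged with the class of
  -r.\<close>

lemma theta_sum_residue:
  fixes p :: complex
  assumes p: "norm p < 1" and N: "N > 0" and w: "\<And>n. w (- n) = w n" "\<And>n. \<bar>w n\<bar> \<le> 1"
  shows "theta_sum (\<lambda>n. w n * of_bool (7 dvd n - r)) N p = theta_sum (\<lambda>n. w n * res r n) N p"
proof -
  let ?s = "\<lambda>n. w n * of_bool (7 dvd n - r)"
  have "theta_sum ?s N p = theta_sum (\<lambda>n. ?s (- n)) N p"
    unfolding theta_sum_def
    using infsum_reindex_bij_betw[OF bij_uminus, of "\<lambda>n. of_real (?s n) * p ^ (N * nat (n\<^sup>2))"] by simp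
  moreover have "theta_sum (\<lambda>n. \<Sum>i\<in>{True, False}. 1 / 2 * (if i then ?s n else ?s (- n))) N p =
     (\<Sum>i\<in>{True, False}. of_real (1 / 2) * theta_sum (\<lambda>n. if i then ?s n else ?s (- n)) N p)"
    by (rule theta_sum_linear[OF p N]) (use w in auto)
  moreover have "(\<Sum>i\<in>{True, False}. 1 / 2 * (if i then ?s n else ?s (- n))) = w n * res r n" for n
  proof -
    have "7 dvd - n - r \<longleftrightarrow> 7 dvd n + r" by presburger
    then show ?thesis by (simp add: res_def w field_simps)
  qed
  ultimately show ?thesis by simp
qed

lemma res_cong: "7 dvd r - u \<or> 7 dvd r + u \<Longrightarrow> res r n = res u n"
proof (erule disjE)
  assume "7 dvd r - u"
  then have "7 dvd n - r \<longleftrightarrow> 7 dvd n - u" "7 dvd n + r \<longleftrightarrow> 7 dvd n + u" by presburger+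
  then show ?thesis by (simp add: res_def)
next
  assume "7 dvd r + u"
  then have "7 dvd n - r \<longleftrightarrow> 7 dvd n + u" "7 dvd n + r \<longleftrightarrow> 7 dvd n - u" by presburger+
  then show ?thesis by (simp add: res_def)
qed

definition class7 :: "int \<Rightarrow> nat" where "class7 r = nat (min (r mod 7) (7 - r mod 7))"

lemma class7_dvd: "7 dvd r - int (class7 r) \<or> 7 dvd r + int (class7 r)"
proof -
  have "7 dvd r - r mod 7" "7 dvd r + (7 - r mod 7)" by presburger+
  moreover have "int (class7 r) = min (r mod 7) (7 - r mod 7)" by (simp add: class7_def)
  ultimately show ?thesis by (metis min_def)
qed

lemma residue_has_sum:
  assumes p: "norm p < 1" and N: "N > 0" and A: "\<And>n. - n \<in> A \<longleftrightarrow> n \<in> A"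
  shows "((\<lambda>n. p ^ (N * nat (n\<^sup>2))) has_sum theta_vec (\<lambda>n. of_bool (n \<in> A)) 1 N p (class7 r)) {n \<in> A. 7 dvd n - r}"
proof -
  have "theta_vec (\<lambda>n. of_bool (n \<in> A)) 1 N p (class7 r) = theta_sum (\<lambda>n. of_bool (n \<in> A) * res r n) N p"
    unfolding theta_vec_def using res_cong[OF class7_dvd[of r]] by simp
  also have "\<dots> = theta_sum (\<lambda>n. of_bool (n \<in> A) * of_bool (7 dvd n - r)) N p"
    by (rule theta_sum_residue[symmetric, OF p N]) (auto simp: A)
  finally show ?thesis using theta_sum_has_sum[OF p N, of "{n \<in> A. 7 dvd n - r}"] by (simp add: of_bool_conj)
qed

text \<open>Modulo 7 the form m^2 + 8 y^2 + 8 z^2 is m^2 + y^2 + z^2, and (1, 2, 4) is isotropic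
  because 1 + 4 + 16 = 21. This lattice is the plane orthogonal to that vector,
  \<open>lattice_B\<close> the line it spans, both with m odd.\<close>

definition lattice_A :: "(int \<times> int \<times> int) set" where
  "lattice_A = {(m, y, z). odd m \<and> 7 dvd m + 2 * y + 4 * z}"

definition lattice_B :: "(int \<times> int \<times> int) set" where
  "lattice_B = {(m, y, z). odd m \<and> 7 dvd y - 2 * m \<and> 7 dvd z - 4 * m}"

definition ternary :: "complex \<Rightarrow> int \<times> int \<times> int \<Rightarrow> complex" where
  "ternary p = (\<lambda>(m, y, z). p ^ nat (m\<^sup>2 + 8 * y\<^sup>2 + 8 * z\<^sup>2))"

lemma ternary_product_has_sum:
  assumes p: "norm p < 1"
  shows "(ternary p has_sum (g23 p (class7 a) * (k3 p (class7 b) * k3 p (class7 c))))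
    ({n. odd n \<and> 7 dvd n - a} \<times> {n. 7 dvd n - b} \<times> {n. 7 dvd n - c})"
proof -
  have "ternary p = (\<lambda>(m, w). p ^ nat (m\<^sup>2) * (case w of (y, z) \<Rightarrow> p ^ (8 * nat (y\<^sup>2)) * p ^ (8 * nat (z\<^sup>2))))"
    by (rule ext) (auto simp: ternary_def power_add nat_add_distrib nat_mult_distrib)
  then show ?thesis
    using has_sum_prod[OF residue_has_sum[OF p, of 1 "{n. odd n}" a]
        has_sum_prod[OF residue_has_sum[OF p, of 8 UNIV b] residue_has_sum[OF p, of 8 UNIV c]]]
    by (simp add: g23_def k3_def)
qed

lemma dvd_lin: "(7::int) dvd a \<Longrightarrow> 7 dvd b \<Longrightarrow> x = a + k * b \<Longrightarrow> 7 dvd x"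
  by simp

lemma sum_upto_7: "(\<Sum>r\<in>{0..<7::int}. f r) = f 0 + f 1 + f 2 + f 3 + f 4 + f 5 + (f 6 :: complex)"
proof -
  have "{0..<7::int} = {0, 1, 2, 3, 4, 5, 6}"
    unfolding set_eq_iff atLeastLessThan_iff insert_iff empty_iff by presburger
  then show ?thesis by (simp add: add_ac)
qed

lemma lattice_B_has_sum:
  assumes p: "norm p < 1"
  shows "(ternary p has_sum (g23 p 0 * (k3 p 0)\<^sup>2 +
    2 * (g23 p 1 * k3 p 2 * k3 p 3 + g23 p 2 * k3 p 3 * k3 p 1 + g23 p 3 * k3 p 1 * k3 p 2))) lattice_B"
proof -
  define X where "X = (\<lambda>r. {n::int. odd n \<and> 7 dvd n - r} \<times> {n. 7 dvd n - 2 * r} \<times> {n. 7 dvd n - 4 * r})"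
  have "(ternary p has_sum (\<Sum>r\<in>{0..<7}. g23 p (class7 r) * (k3 p (class7 (2 * r)) * k3 p (class7 (4 * r))))) (\<Union>r\<in>{0..<7}. X r)"
  proof (rule sum_has_sum)
    fix r r' :: int assume r: "r \<in> {0..<7}" "r' \<in> {0..<7}" "r \<noteq> r'"
    have "\<not> (7 dvd n - r \<and> 7 dvd n - r')" for n
      using r by (metis atLeastLessThan_iff mod_eq_dvd_iff mod_pos_pos_trivial)
    then show "X r \<inter> X r' = {}" unfolding X_def by blast
  qed (auto simp: X_def intro: ternary_product_has_sum[OF p])
  also have "(\<Union>r\<in>{0..<7}. X r) = lattice_B"
  proof (intro set_eqI iffI)
    fix v assume "v \<in> (\<Union>r\<in>{0..<7}. X r)"
    then obtain m y z r where "v = (m, y, z)" "odd m" "7 dvd m - r" "7 dvd y - 2 * r" "7 dvd z - 4 * r"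
      unfolding X_def by auto
    moreover have "7 dvd y - 2 * m" by (rule dvd_lin[OF \<open>7 dvd y - 2 * r\<close> \<open>7 dvd m - r\<close>, of _ "-2"]) simp
    moreover have "7 dvd z - 4 * m" by (rule dvd_lin[OF \<open>7 dvd z - 4 * r\<close> \<open>7 dvd m - r\<close>, of _ "-4"]) simp
    ultimately show "v \<in> lattice_B" by (auto simp: lattice_B_def)
  next
    fix v assume "v \<in> lattice_B"
    then obtain m y z where v: "v = (m, y, z)" "odd m" "7 dvd y - 2 * m" "7 dvd z - 4 * m"
      unfolding lattice_B_def by auto
    define r where "r = m mod 7"
    have "7 dvd m - r" "r \<in> {0..<7}" by (auto simp: r_def dvd_minus_mod)
    moreover have "7 dvd y - 2 * r" by (rule dvd_lin[OF v(3) \<open>7 dvd m - r\<close>, of _ 2]) simp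
    moreover have "7 dvd z - 4 * r" by (rule dvd_lin[OF v(4) \<open>7 dvd m - r\<close>, of _ 4]) simp
    ultimately show "v \<in> (\<Union>r\<in>{0..<7}. X r)" using v unfolding X_def by auto
  qed
  \<comment> \<open>Up to sign, (r, 2 r, 4 r) runs through the cyclic permutations of (1, 2, 3),
    twice each, as r runs through 1, ..., 6.\<close>
  also have "(\<Sum>r\<in>{0..<7}. g23 p (class7 r) * (k3 p (class7 (2 * r)) * k3 p (class7 (4 * r)))) =
    g23 p 0 * (k3 p 0)\<^sup>2 + 2 * (g23 p 1 * k3 p 2 * k3 p 3 + g23 p 2 * k3 p 3 * k3 p 1 + g23 p 3 * k3 p 1 * k3 p 2)"
    unfolding sum_upto_7 by (simp add: class7_def power2_eq_square algebra_simps)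
  finally show ?thesis .
qed

text \<open>By symmetry 8 * S sums over the planes orthogonal to all eight isotropic lines. A vector
  modulo 7 lies in 8, 1, 2 or 0 of these planes according as it is zero, nonzero isotropic, of
  nonsquare norm, or of nonzero square norm. The total sum minus 4 * S thus has the weights -3, 1/2,
  0, 1, which are those of \<open>tri\<close> summed over all residues.\<close>

lemma lattice_A_has_sum:
  assumes p: "norm p < 1"
  shows "\<exists>S. (ternary p has_sum S) lattice_A \<and> dft7 (g23 p) 0 * (dft7 (k3 p) 0)\<^sup>2 - 4 * S = dft7 (tri (g23 p) (k3 p)) 0"
proof -
  define I where "I = {0..<7::int} \<times> {0..<7::int}"
  define X where "X = (\<lambda>(b, c). {n::int. odd n \<and> 7 dvd n - (- 2 * b - 4 * c)} \<times> {n. 7 dvd n - b} \<times> {n. 7 dvd n - c})"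
  define S where "S = (\<Sum>(b, c)\<in>I. g23 p (class7 (- 2 * b - 4 * c)) * (k3 p (class7 b) * k3 p (class7 c)))"
  have "(ternary p has_sum S) (\<Union>w\<in>I. X w)"
    unfolding S_def
  proof (rule sum_has_sum)
    fix w w' assume w: "w \<in> I" "w' \<in> I" "w \<noteq> w'"
    have *: "r = r'" if "7 dvd n - r" "7 dvd n - r'" "r \<in> {0..<7}" "r' \<in> {0..<7}" for n r r' :: int
      using that by (metis atLeastLessThan_iff mod_eq_dvd_iff mod_pos_pos_trivial)
    show "X w \<inter> X w' = {}"
    proof (rule ccontr)
      assume "X w \<inter> X w' \<noteq> {}"
      then obtain m y z where "(m, y, z) \<in> X w" "(m, y, z) \<in> X w'" by auto
      then have "7 dvd y - fst w" "7 dvd z - snd w" "7 dvd y - fst w'" "7 dvd z - snd w'"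
        by (auto simp: X_def split: prod.splits)
      then have "fst w = fst w'" "snd w = snd w'" using w * unfolding I_def by auto
      then show False using w by (simp add: prod_eq_iff)
    qed
  qed (auto simp: X_def I_def intro: ternary_product_has_sum[OF p])
  also have "(\<Union>w\<in>I. X w) = lattice_A"
  proof (intro set_eqI iffI)
    fix v assume "v \<in> (\<Union>w\<in>I. X w)"
    then obtain m y z b c where "v = (m, y, z)" "odd m" "7 dvd m - (- 2 * b - 4 * c)" "7 dvd y - b" "7 dvd z - c"
      unfolding X_def by auto
    moreover have "7 dvd m + 2 * y + 2 * 2 * c"
      by (rule dvd_lin[OF \<open>7 dvd m - (- 2 * b - 4 * c)\<close> \<open>7 dvd y - b\<close>, of _ 2]) simp
    then have "7 dvd m + 2 * y + 4 * z"
      by (rule dvd_lin[OF _ \<open>7 dvd z - c\<close>, of _ _ 4]) simp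
    ultimately show "v \<in> lattice_A" by (auto simp: lattice_A_def)
  next
    fix v assume "v \<in> lattice_A"
    then obtain m y z where v: "v = (m, y, z)" "odd m" "7 dvd m + 2 * y + 4 * z"
      unfolding lattice_A_def by auto
    define b c where "b = y mod 7" and "c = z mod 7"
    have "7 dvd y - b" "7 dvd z - c" "(b, c) \<in> I" by (auto simp: b_def c_def I_def dvd_minus_mod)
    moreover have "7 dvd m + 2 * b + 4 * z" by (rule dvd_lin[OF v(3) \<open>7 dvd y - b\<close>, of _ "-2"]) simp
    then have "7 dvd m - (- 2 * b - 4 * c)" by (rule dvd_lin[OF _ \<open>7 dvd z - c\<close>, of _ _ "-4"]) simp
    ultimately show "v \<in> (\<Union>w\<in>I. X w)" using v unfolding X_def by force
  qed
  finally have "(ternary p has_sum S) lattice_A" .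
  moreover have "S = (\<Sum>b\<in>{0..<7}. \<Sum>c\<in>{0..<7}. g23 p (class7 (- 2 * b - 4 * c)) * (k3 p (class7 b) * k3 p (class7 c)))"
    unfolding S_def I_def by (simp add: sum.cartesian_product)
  then have "dft7 (g23 p) 0 * (dft7 (k3 p) 0)\<^sup>2 - 4 * S = dft7 (tri (g23 p) (k3 p)) 0"
    unfolding sum_upto_7 dft7_simps tri_simps by (simp add: class7_def power2_eq_square algebra_simps)
  ultimately show ?thesis by blast
qed

section \<open>Dissection modulo 3\<close>

lemma half_products: "8 * (n * (n - 1) div 2) = (4::int) * (n\<^sup>2 - n)" "8 * (n * (n + 1) div 2) = (4::int) * (n\<^sup>2 + n)"
  and half_products_nonneg: "n * (n - 1) div 2 \<ge> 0" "n * (n + 1) div 2 \<ge> 0"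
  and square_eq_half_products: "n\<^sup>2 = n * (n - 1) div 2 + n * (n + 1) div 2" for n :: int
proof -
  have "even (n * (n - 1))" "even (n * (n + 1))" by simp_all
  then obtain a b where ab: "n * (n - 1) = 2 * a" "n * (n + 1) = 2 * b" by (elim evenE)
  then have e: "n\<^sup>2 - n = 2 * a" "n\<^sup>2 + n = 2 * b" by (simp_all add: power2_eq_square algebra_simps)
  then show "8 * (n * (n - 1) div 2) = 4 * (n\<^sup>2 - n)" "8 * (n * (n + 1) div 2) = 4 * (n\<^sup>2 + n)" unfolding ab by simp_all
  from e abs_le_square_int[of n] have "a \<ge> 0" "b \<ge> 0" "n\<^sup>2 = a + b" by linarith+
  then show "n * (n - 1) div 2 \<ge> 0" "n * (n + 1) div 2 \<ge> 0" "n\<^sup>2 = n * (n - 1) div 2 + n * (n + 1) div 2"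
    unfolding ab by simp_all
qed

text \<open>The exponent of x in the n-th term of f(q^i, q^j) for q = x^8; the eighth root is what
  completing the square in \<psi> requires.\<close>

abbreviation texp :: "nat \<Rightarrow> nat \<Rightarrow> int \<Rightarrow> nat" where
  "texp i j n \<equiv> 8 * (i * nat (n * (n - 1) div 2) + j * nat (n * (n + 1) div 2))"

lemma theta_f_has_sum:
  assumes x: "norm x < 1" and ij: "i > 0" "j > 0"
  shows "((\<lambda>n. x ^ (texp i j n)) has_sum
    theta_f ((x ^ 8) ^ i) ((x ^ 8) ^ j)) UNIV"
proof -
  have pw: "y powi m = y ^ nat m" if "m \<ge> 0" for y :: complex and m
    using that by (simp add: power_int_def)
  have eq: "((x ^ 8) ^ i) powi (n * (n - 1) div 2) * ((x ^ 8) ^ j) powi (n * (n + 1) div 2) =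
     1 * x ^ (texp i j n)" for n
    unfolding half_products_nonneg[THEN pw] power_mult[symmetric] power_add[symmetric]
    by (simp add: algebra_simps)
  have "(\<lambda>n. 1 * x ^ (texp i j n)) summable_on UNIV"
  proof (rule abs_summable_summable, rule power_series_int_summable[of _ 1 _ 0, OF _ _ x])
    fix n :: int
    have "nat \<bar>n\<bar> \<le> nat (n\<^sup>2)" by (rule nat_abs_le_nat_square)
    also have "n\<^sup>2 = n * (n - 1) div 2 + n * (n + 1) div 2" by (rule square_eq_half_products)
    also have "nat \<dots> = nat (n * (n - 1) div 2) + nat (n * (n + 1) div 2)"
      by (rule nat_add_distrib half_products_nonneg)+
    also have "\<dots> \<le> i * nat (n * (n - 1) div 2) + j * nat (n * (n + 1) div 2)"
      using ij by (intro add_mono) auto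
    finally show "nat \<bar>n\<bar> \<le> texp i j n + 0" by (rule order_trans) simp
  qed simp
  then show ?thesis unfolding theta_f_def eq by (simp add: has_sum_infsum)
qed

lemma theta_exponent:
  "int (texp i j n) = 4 * (int i * (n\<^sup>2 - n) + int j * (n\<^sup>2 + n))"
proof -
  have "int (texp i j n) =
    int i * (8 * (n * (n - 1) div 2)) + int j * (8 * (n * (n + 1) div 2))"
    using half_products_nonneg[of n] by (simp add: algebra_simps)
  then show ?thesis unfolding half_products by (simp add: algebra_simps)
qed

lemma theta_phi_eq:
  assumes x: "norm x < 1" and c: "c > 0"
  shows "theta_sum (\<lambda>_. 1) (8 * c) x = theta_phi ((x ^ 8) ^ c)"
proof -
  have "texp c c n = 8 * c * nat (n\<^sup>2)" for n
  proof -
    have "int (texp c c n) = int (8 * c * nat (n\<^sup>2))"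
      unfolding theta_exponent by (simp add: algebra_simps)
    then show ?thesis by (simp only: of_nat_eq_iff)
  qed
  then have "((\<lambda>n. x ^ (8 * c * nat (n\<^sup>2))) has_sum theta_phi ((x ^ 8) ^ c)) UNIV"
    using theta_f_has_sum[OF x c c] by (simp add: theta_phi_def)
  then show ?thesis
    using theta_sum_has_sum[OF x, of "8 * c" UNIV] c by (auto intro: has_sum_unique)
qed

text \<open>8 (2 n^2 + n) + 1 = (4 n + 1)^2, and each odd integer is 4 n + 1 or -(4 n + 1) for
  exactly one n; hence the factors x^c and 2.\<close>

lemma theta_psi_eq:
  assumes x: "norm x < 1" and c: "c > 0"
  shows "theta_sum odd_ind c x = 2 * x ^ c * theta_psi ((x ^ 8) ^ c)"
proof -
  have e: "c * nat ((4 * n + 1)\<^sup>2) = c + texp c (3 * c) n" for n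
  proof -
    have "int (c * nat ((4 * n + 1)\<^sup>2)) = int (c + texp c (3 * c) n)"
      unfolding of_nat_add[of c] theta_exponent of_nat_mult[of c] nat_0_le[OF zero_le_power2] by (simp add: power2_eq_square algebra_simps)
    then show ?thesis by (simp only: of_nat_eq_iff)
  qed
  have "((\<lambda>n. x ^ c * x ^ (texp c (3 * c) n)) has_sum x ^ c * theta_psi ((x ^ 8) ^ c)) UNIV"
    using has_sum_cmult_right[OF theta_f_has_sum[OF x c, of "3 * c"], of "x ^ c"] c
    by (simp add: theta_psi_def power_mult[symmetric] mult.commute)
  then have s: "((\<lambda>n. x ^ (c * nat ((4 * n + 1)\<^sup>2))) has_sum x ^ c * theta_psi ((x ^ 8) ^ c)) UNIV"
    unfolding e power_add .
  have "inj (\<lambda>n::int. 4 * n + 1)" "inj (\<lambda>n::int. - (4 * n + 1))" by (auto simp: inj_def)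
  then have "((\<lambda>n. x ^ (c * nat (n\<^sup>2))) has_sum x ^ c * theta_psi ((x ^ 8) ^ c)) (range (\<lambda>n. 4 * n + 1))"
    "((\<lambda>n. x ^ (c * nat (n\<^sup>2))) has_sum x ^ c * theta_psi ((x ^ 8) ^ c)) (range (\<lambda>n. - (4 * n + 1)))"
    using s by (simp_all only: has_sum_reindex o_def power2_minus)
  moreover have "range (\<lambda>n::int. 4 * n + 1) \<inter> range (\<lambda>n. - (4 * n + 1)) = {}" by (auto, presburger)
  ultimately have "((\<lambda>n. x ^ (c * nat (n\<^sup>2))) has_sum (x ^ c * theta_psi ((x ^ 8) ^ c) + x ^ c * theta_psi ((x ^ 8) ^ c)))
     (range (\<lambda>n. 4 * n + 1) \<union> range (\<lambda>n. - (4 * n + 1)))"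
    by (rule has_sum_Un_disjoint)
  also have "range (\<lambda>n::int. 4 * n + 1) \<union> range (\<lambda>n. - (4 * n + 1)) = {n. odd n}"
  proof -
    have "n \<in> range (\<lambda>n::int. 4 * n + 1) \<union> range (\<lambda>n. - (4 * n + 1))" if "odd n" for n
    proof -
      have "n = 4 * (n div 4) + 1 \<or> n = - (4 * (- n div 4) + 1)" using that by presburger
      then show ?thesis by blast
    qed
    then show ?thesis by auto
  qed
  finally have "((\<lambda>n. x ^ (c * nat (n\<^sup>2))) has_sum 2 * x ^ c * theta_psi ((x ^ 8) ^ c)) {n. odd n}"
    by (simp add: mult.assoc)
  then show ?thesis
    using theta_sum_has_sum[OF x c, of "{n. odd n}"] by (auto intro: has_sum_unique)
qed

definition plane_3 :: "(int \<times> int) set" where "plane_3 = {(k, l). odd k \<and> 3 dvd k - l}"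

text \<open>On \<open>plane_3\<close> the numerator is (\<alpha> + 8 b) k^2 modulo 3, so the
  division is exact whenever 3 divides \<alpha> + 8 b.\<close>

definition binary :: "nat \<Rightarrow> nat \<Rightarrow> complex \<Rightarrow> int \<times> int \<Rightarrow> complex" where
  "binary \<alpha> b x = (\<lambda>(k, l). x ^ nat ((int \<alpha> * k\<^sup>2 + 8 * int b * l\<^sup>2) div 3))"

text \<open>The glue class 0 modulo 3 gives the product of \<psi> and \<phi>. Class 1 is
  parametrised by (6 n + 1, 3 j + 1) and gives the product of two functions f with offset c; class 2
  is its negative and doubles it.\<close>

lemma binary_has_sum:
  assumes x: "norm x < 1" and pos: "\<alpha> > 0" "b > 0" and c: "\<alpha> + 8 * b = 3 * c"
  shows "(binary \<alpha> b x has_sum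
    (2 * x ^ (3 * \<alpha>) * theta_psi ((x ^ 8) ^ (3 * \<alpha>)) * theta_phi ((x ^ 8) ^ (3 * b)) +
     2 * x ^ c * (theta_f ((x ^ 8) ^ \<alpha>) ((x ^ 8) ^ (2 * \<alpha>)) * theta_f ((x ^ 8) ^ b) ((x ^ 8) ^ (5 * b))))) plane_3"
proof -
  define U where "U = 2 * x ^ (3 * \<alpha>) * theta_psi ((x ^ 8) ^ (3 * \<alpha>)) * theta_phi ((x ^ 8) ^ (3 * b))"
  define P0 where "P0 = (\<lambda>(k::int, l::int). (3 * k, 3 * l)) ` ({k. odd k} \<times> UNIV)"
  define P1 where "P1 = range (\<lambda>(n::int, j::int). (6 * n + 1, 3 * j + 1))"
  define P2 where "P2 = range (\<lambda>(n::int, j::int). (- (6 * n + 1), - (3 * j + 1)))"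
  have "(binary \<alpha> b x has_sum theta_sum odd_ind (3 * \<alpha>) x * theta_sum (\<lambda>_. 1) (8 * (3 * b)) x) P0"
  proof -
    have "((\<lambda>(k, l). x ^ (3 * \<alpha> * nat (k\<^sup>2)) * x ^ (8 * (3 * b) * nat (l\<^sup>2))) has_sum
       theta_sum odd_ind (3 * \<alpha>) x * theta_sum (\<lambda>_. 1) (8 * (3 * b)) x) ({k. odd k} \<times> UNIV)"
      using has_sum_prod[OF theta_sum_has_sum[OF x, of "3 * \<alpha>" "{k. odd k}"] theta_sum_has_sum[OF x, of "8 * (3 * b)" UNIV]] pos
      by simp
    moreover have "x ^ (3 * \<alpha> * nat (k\<^sup>2)) * x ^ (8 * (3 * b) * nat (l\<^sup>2)) = binary \<alpha> b x (3 * k, 3 * l)" for k l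
    proof -
      have "(int \<alpha> * (3 * k)\<^sup>2 + 8 * int b * (3 * l)\<^sup>2) = 3 * int (3 * \<alpha> * nat (k\<^sup>2) + 8 * (3 * b) * nat (l\<^sup>2))"
        by (simp add: power2_eq_square algebra_simps)
      then have "(int \<alpha> * (3 * k)\<^sup>2 + 8 * int b * (3 * l)\<^sup>2) div 3 = int (3 * \<alpha> * nat (k\<^sup>2) + 8 * (3 * b) * nat (l\<^sup>2))"
        by (simp only: nonzero_mult_div_cancel_left[of 3] zero_neq_numeral[symmetric] not_False_eq_True)
      then show ?thesis unfolding binary_def by (simp only: prod.case nat_int power_add)
    qed
    moreover have "inj_on (\<lambda>(k::int, l::int). (3 * k, 3 * l)) A" for A by (auto simp: inj_on_def)
    ultimately show ?thesis unfolding P0_def by (simp add: has_sum_reindex o_def case_prod_unfold)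
  qed
  then have P0: "(binary \<alpha> b x has_sum U) P0"
    using theta_psi_eq[OF x, of "3 * \<alpha>"] theta_phi_eq[OF x, of "3 * b"] pos by (simp add: U_def)
  define V where "V = x ^ c * (theta_f ((x ^ 8) ^ \<alpha>) ((x ^ 8) ^ (2 * \<alpha>)) * theta_f ((x ^ 8) ^ b) ((x ^ 8) ^ (5 * b)))"
  have main: "((\<lambda>(n, j). binary \<alpha> b x (6 * n + 1, 3 * j + 1)) has_sum V) UNIV"
  proof -
    have "((\<lambda>w. x ^ c * (case w of (n, j) \<Rightarrow>
        x ^ (texp \<alpha> (2 * \<alpha>) n) *
        x ^ (texp b (5 * b) j))) has_sum V) (UNIV \<times> UNIV)"
      unfolding V_def using pos
      by (intro has_sum_cmult_right has_sum_prod theta_f_has_sum[OF x]) auto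
    moreover have "x ^ c * (x ^ (texp \<alpha> (2 * \<alpha>) n) *
        x ^ (texp b (5 * b) j)) = binary \<alpha> b x (6 * n + 1, 3 * j + 1)" for n j
    proof -
      let ?e1 = "texp \<alpha> (2 * \<alpha>) n"
      let ?e2 = "texp b (5 * b) j"
      have "int (3 * c) = int \<alpha> + 8 * int b" using c by simp
      then have "int \<alpha> * (6 * n + 1)\<^sup>2 + 8 * int b * (3 * j + 1)\<^sup>2 = 3 * int (c + (?e1 + ?e2))"
        unfolding of_nat_add[of c] of_nat_add[of ?e1] theta_exponent
        by (simp add: power2_eq_square algebra_simps)
      then have "(int \<alpha> * (6 * n + 1)\<^sup>2 + 8 * int b * (3 * j + 1)\<^sup>2) div 3 = int (c + (?e1 + ?e2))"
        by (simp only: nonzero_mult_div_cancel_left[of 3] zero_neq_numeral[symmetric] not_False_eq_True)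
      then show ?thesis unfolding binary_def by (simp only: prod.case nat_int power_add)
    qed
    ultimately show ?thesis by (simp add: case_prod_unfold)
  qed
  have P1: "(binary \<alpha> b x has_sum V) P1"
    using main unfolding P1_def
    by (subst has_sum_reindex) (auto simp: inj_def o_def case_prod_unfold)
  have "binary \<alpha> b x (- k, - l) = binary \<alpha> b x (k, l)" for k l by (simp add: binary_def)
  then have P2: "(binary \<alpha> b x has_sum V) P2"
    using main unfolding P2_def
    by (subst has_sum_reindex) (auto simp: inj_def o_def case_prod_unfold simp del: minus_add_distrib minus_diff_eq)
  have "P1 \<inter> P2 = {}" unfolding P1_def P2_def by (auto, presburger)
  from has_sum_Un_disjoint[OF P1 P2 this] have P12: "(binary \<alpha> b x has_sum (V + V)) (P1 \<union> P2)" .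
  have "P0 \<inter> (P1 \<union> P2) = {}" unfolding P0_def P1_def P2_def by (auto; presburger)
  from has_sum_Un_disjoint[OF P0 P12 this]
  have "(binary \<alpha> b x has_sum (U + (V + V))) (P0 \<union> (P1 \<union> P2))" .
  moreover have "P0 \<union> (P1 \<union> P2) = plane_3"
  proof (intro set_eqI iffI)
    fix w assume "w \<in> P0 \<union> (P1 \<union> P2)"
    then show "w \<in> plane_3" unfolding P0_def P1_def P2_def plane_3_def by (auto; presburger)
  next
    fix w assume "w \<in> plane_3"
    then obtain k l where w: "w = (k, l)" "odd k" "3 dvd k - l" unfolding plane_3_def by auto
    then obtain d where d: "k - l = 3 * d" by (elim dvdE)
    consider "k mod 3 = 0" | "k mod 3 = 1" | "k mod 3 = 2" by linarith
    then show "w \<in> P0 \<union> (P1 \<union> P2)"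
    proof cases
      case 1
      then obtain k' where k': "k = 3 * k'" by (auto elim!: dvdE simp: dvd_eq_mod_eq_0[symmetric])
      then have "w = (3 * k', 3 * (k' - d))" "odd k'" using w d by auto
      then have "w \<in> P0" unfolding P0_def by (intro image_eqI[of _ _ "(k', k' - d)"]) auto
      then show ?thesis by blast
    next
      case 2
      have "k = 6 * (k div 6) + 1" using 2 w(2) by presburger
      moreover from this have "l = 3 * (2 * (k div 6) - d) + 1" using d by simp
      ultimately have "w = (6 * (k div 6) + 1, 3 * (2 * (k div 6) - d) + 1)" using w(1) by metis
      then have "w \<in> P1" unfolding P1_def by (intro image_eqI[of _ _ "(k div 6, 2 * (k div 6) - d)"]) auto
      then show ?thesis by blast
    next
      case 3
      define n where "n = (- k) div 6"
      have k: "k = - (6 * n + 1)" using 3 w(2) unfolding n_def by presburger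
      then have "l = - (3 * (2 * n + d) + 1)" using d by simp
      then have "w = (- (6 * n + 1), - (3 * (2 * n + d) + 1))" using w(1) k by metis
      then have "w \<in> P2" unfolding P2_def by (intro image_eqI[of _ _ "(n, 2 * n + d)"]) auto
      then show ?thesis by blast
    qed
  qed
  ultimately show ?thesis unfolding U_def V_def by (simp add: algebra_simps)
qed

section \<open>Orthogonal splitting of the ternary lattices\<close>

lemma div_6_exact: "6 * v = w \<Longrightarrow> w div 6 = (v::int)" by simp

lemma odd_add_even: "(m::int) = 7 * a - 2 * t \<Longrightarrow> odd m \<longleftrightarrow> odd a" by simp

text \<open>Integrality of the second coordinate in the inverse maps below: divisibility by 3 comes
  from the glue condition, divisibility by 2 from the two parities.\<close>

lemma split_dvd_6:
  fixes k l a :: int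
  assumes "odd k" "odd a" "3 dvd k - l"
  obtains y where "k - 4 * l + 3 * a = 6 * y"
proof -
  obtain d where d: "k - l = 3 * d" using assms(3) by (elim dvdE)
  obtain i j where ij: "k = 2 * i + 1" "a = 2 * j + 1" using assms by (elim oddE)
  have e: "k - 4 * l + 3 * a = 3 * (4 * d - k + a)" using d by simp
  also have "4 * d - k + a = 2 * (2 * d - i + j)" using ij by simp
  finally show ?thesis using that[of "2 * d - i + j"] by simp
qed

text \<open>The vector (2, 1/2, 1) has norm 14, and its inner product with (m, y, z) is 2 (m + 2 y +
  4 z) = 14 a. Splitting it off leaves m^2 + 8 y^2 + 8 z^2 = 14 a^2 + (k^2 + 56 l^2) / 3.\<close>

lemma lattice_A_split:
  "(ternary x has_sum S) lattice_A \<longleftrightarrow>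
   ((\<lambda>(a, w). x ^ (14 * nat (a\<^sup>2)) * binary 1 7 x w) has_sum S) ({a. odd a} \<times> plane_3)"
proof -
  define bwd where "bwd = (\<lambda>(a, k, l). (7 * a - 2 * ((k - 4 * l + 3 * a) div 6) - 4 * (l + a), (k - 4 * l + 3 * a) div 6, l + a) :: int \<times> int \<times> int)"
  define fwd where "fwd = (\<lambda>(m, y, z). ((m + 2 * y + 4 * z) div 7, 6 * y + 4 * z - 7 * ((m + 2 * y + 4 * z) div 7), z - (m + 2 * y + 4 * z) div 7) :: int \<times> int \<times> int)"
  show ?thesis
  proof (rule has_sum_reindex_bij_witness[where i = bwd and j = fwd])
    fix v assume "v \<in> lattice_A"
    then obtain m y z where v: "v = (m, y, z)" "odd m" "7 dvd m + 2 * y + 4 * z" by (auto simp: lattice_A_def)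
    then obtain a where a: "m + 2 * y + 4 * z = 7 * a" by (elim dvdE)
    then have m: "m = 7 * a - 2 * (y + 2 * z)" by simp
    have oa: "odd a" using v(2) odd_add_even[OF m] by simp
    define k l where "k = 6 * y + 4 * z - 7 * a" and "l = z - a"
    have y: "(k - 4 * l + 3 * a) div 6 = y" by (rule div_6_exact) (simp add: k_def l_def)
    have j: "fwd v = (a, k, l)" unfolding fwd_def v(1) prod.case a by (simp add: k_def l_def)
    show "bwd (fwd v) = v"
      unfolding j unfolding bwd_def prod.case y v(1) using m by (simp add: l_def)
    have "k - l = 3 * (2 * y + z - 2 * a)" by (simp add: k_def l_def)
    moreover have "odd k" using oa by (simp add: k_def)
    ultimately show "fwd v \<in> {a. odd a} \<times> plane_3" unfolding j plane_3_def using oa by simp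
    show "(case fwd v of (a, w) \<Rightarrow> x ^ (14 * nat (a\<^sup>2)) * binary 1 7 x w) = ternary x v"
    proof -
      have "k\<^sup>2 + 56 * l\<^sup>2 = 3 * (m\<^sup>2 + 8 * y\<^sup>2 + 8 * z\<^sup>2 - 14 * a\<^sup>2)"
        unfolding k_def l_def m by (simp add: power2_eq_square algebra_simps)
      moreover define g where "g = m\<^sup>2 + 8 * y\<^sup>2 + 8 * z\<^sup>2 - 14 * a\<^sup>2"
      ultimately have g: "k\<^sup>2 + 56 * l\<^sup>2 = 3 * g" by simp
      then have "g \<ge> 0" using zero_le_power2[of k] zero_le_power2[of l] by linarith
      have "m\<^sup>2 + 8 * y\<^sup>2 + 8 * z\<^sup>2 = 14 * a\<^sup>2 + g" by (simp add: g_def)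
      then have n: "nat (m\<^sup>2 + 8 * y\<^sup>2 + 8 * z\<^sup>2) = 14 * nat (a\<^sup>2) + nat g"
        using \<open>g \<ge> 0\<close> by (simp add: nat_add_distrib nat_mult_distrib)
      have d: "(int 1 * k\<^sup>2 + 8 * int 7 * l\<^sup>2) div 3 = g" using g by simp
      then show ?thesis unfolding j unfolding prod.case binary_def d ternary_def v(1) n by (simp only: power_add prod.case)
    qed
  next
    fix w :: "int \<times> int \<times> int" assume "w \<in> {a. odd a} \<times> plane_3"
    then obtain a k l :: int where w: "w = (a, k, l)" "odd a" "odd k" "3 dvd k - l" by (auto simp: plane_3_def)
    obtain y where y: "k - 4 * l + 3 * a = 6 * y" using split_dvd_6[OF w(3,2,4)] .
    then have y': "(k - 4 * l + 3 * a) div 6 = y" by simp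
    have i: "bwd w = (7 * a - 2 * y - 4 * (l + a), y, l + a)" unfolding bwd_def w(1) prod.case y' ..
    have s: "7 * a - 2 * y - 4 * (l + a) + 2 * y + 4 * (l + a) = 7 * a" by simp
    show "fwd (bwd w) = w"
      unfolding i unfolding fwd_def prod.case s w(1) using y by simp
    have "odd (7 * a - 2 * y - 4 * (l + a))" using w(2) by simp
    then show "bwd w \<in> lattice_A" unfolding i lattice_A_def prod.case mem_Collect_eq s by simp
  qed simp
qed

text \<open>Inside \<open>lattice_A\<close> this is the sublattice on which the coordinate k of the
  previous splitting is divisible by 7. Writing 7 k for it turns the norm into 7 (2 a^2 + (7 k^2 + 8
  l^2) / 3), whence the variable x = p^7.\<close>

lemma lattice_B_split:
  assumes x: "x = p ^ 7"
  shows "(ternary p has_sum S) lattice_B \<longleftrightarrow>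
   ((\<lambda>(a, w). x ^ (2 * nat (a\<^sup>2)) * binary 7 1 x w) has_sum S) ({a. odd a} \<times> plane_3)"
proof -
  define bwd where "bwd = (\<lambda>(a, k, l). (7 * a - 2 * ((7 * k - 4 * l + 3 * a) div 6) - 4 * (l + a), (7 * k - 4 * l + 3 * a) div 6, l + a) :: int \<times> int \<times> int)"
  define fwd where "fwd = (\<lambda>(m, y, z). ((m + 2 * y + 4 * z) div 7, (6 * y + 4 * z) div 7 - (m + 2 * y + 4 * z) div 7, z - (m + 2 * y + 4 * z) div 7) :: int \<times> int \<times> int)"
  show ?thesis
  proof (rule has_sum_reindex_bij_witness[where i = bwd and j = fwd])
    fix v assume "v \<in> lattice_B"
    then obtain m y z where v: "v = (m, y, z)" "odd m" "7 dvd y - 2 * m" "7 dvd z - 4 * m" by (auto simp: lattice_B_def)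
    obtain s t where st: "y - 2 * m = 7 * s" "z - 4 * m = 7 * t" using v by (elim dvdE)
    define a where "a = 3 * m + 2 * s + 4 * t"
    have a: "m + 2 * y + 4 * z = 7 * a" using st by (simp add: a_def)
    have m: "m = 7 * a - 2 * (y + 2 * z)" using a by simp
    have oa: "odd a" using v(2) odd_add_even[OF m] by simp
    define e where "e = 4 * m + 6 * s + 4 * t"
    have e: "6 * y + 4 * z = 7 * e" using st by (simp add: e_def)
    define k l where "k = e - a" and "l = z - a"
    have y: "(7 * k - 4 * l + 3 * a) div 6 = y" by (rule div_6_exact) (use e in \<open>simp add: k_def l_def\<close>)
    have j: "fwd v = (a, k, l)" unfolding fwd_def v(1) prod.case a e by (simp add: k_def l_def)
    show "bwd (fwd v) = v"
      unfolding j unfolding bwd_def prod.case y v(1) using m by (simp add: l_def)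
    have "k - l = 3 * (2 * s - t)" using st by (simp add: k_def l_def e_def)
    moreover have "odd k" using oa by (simp add: k_def e_def)
    ultimately show "fwd v \<in> {a. odd a} \<times> plane_3" unfolding j plane_3_def using oa by simp
    show "(case fwd v of (a, w) \<Rightarrow> x ^ (2 * nat (a\<^sup>2)) * binary 7 1 x w) = ternary p v"
    proof -
      have kl: "k = m + 4 * s" "l = m - 2 * s + 3 * t" "y = 2 * m + 7 * s" "z = 4 * m + 7 * t"
        using st by (simp_all add: k_def l_def e_def a_def)
      have "7 * k\<^sup>2 + 8 * l\<^sup>2 = 3 * (5 * m\<^sup>2 + 8 * m * s + 16 * m * t + 48 * s\<^sup>2 + 24 * t\<^sup>2 - 32 * s * t) \<and>
        m\<^sup>2 + 8 * y\<^sup>2 + 8 * z\<^sup>2 = 7 * (2 * a\<^sup>2 + (5 * m\<^sup>2 + 8 * m * s + 16 * m * t + 48 * s\<^sup>2 + 24 * t\<^sup>2 - 32 * s * t))"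
        unfolding kl a_def by (simp add: power2_eq_square algebra_simps)
      then obtain g where g: "7 * k\<^sup>2 + 8 * l\<^sup>2 = 3 * g" "m\<^sup>2 + 8 * y\<^sup>2 + 8 * z\<^sup>2 = 7 * (2 * a\<^sup>2 + g)" by blast
      have "g \<ge> 0" using g(1) zero_le_power2[of k] zero_le_power2[of l] by linarith
      then have "nat (m\<^sup>2 + 8 * y\<^sup>2 + 8 * z\<^sup>2) = 7 * (2 * nat (a\<^sup>2) + nat g)"
        unfolding g(2) by (simp add: nat_mult_distrib nat_add_distrib)
      moreover have "(int 7 * k\<^sup>2 + 8 * int 1 * l\<^sup>2) div 3 = g" using g(1) by simp
      ultimately show ?thesis unfolding j unfolding prod.case binary_def ternary_def v(1) x
        by (simp add: power_mult[symmetric] power_add[symmetric])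
    qed
  next
    fix w :: "int \<times> int \<times> int" assume "w \<in> {a. odd a} \<times> plane_3"
    then obtain a k l :: int where w: "w = (a, k, l)" "odd a" "odd k" "3 dvd k - l" by (auto simp: plane_3_def)
    obtain y0 where y0: "k - 4 * l + 3 * a = 6 * y0" using split_dvd_6[OF w(3,2,4)] .
    define y where "y = y0 + k"
    have y: "7 * k - 4 * l + 3 * a = 6 * y" using y0 by (simp add: y_def)
    then have y': "(7 * k - 4 * l + 3 * a) div 6 = y" by simp
    have i: "bwd w = (7 * a - 2 * y - 4 * (l + a), y, l + a)" unfolding bwd_def w(1) prod.case y' ..
    have s: "7 * a - 2 * y - 4 * (l + a) + 2 * y + 4 * (l + a) = 7 * a" by simp
    have t: "6 * y + 4 * (l + a) = 7 * (k + a)" using y by simp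
    show "fwd (bwd w) = w"
      unfolding i unfolding fwd_def prod.case s t w(1) by simp
    have "odd (7 * a - 2 * y - 4 * (l + a))" using w(2) by simp
    moreover have "y - 2 * (7 * a - 2 * y - 4 * (l + a)) = 7 * (5 * y - 5 * k + 4 * l - 3 * a)" using y by algebra
    then have "7 dvd y - 2 * (7 * a - 2 * y - 4 * (l + a))" by (simp only: dvd_triv_left)
    moreover have "l + a - 4 * (7 * a - 2 * y - 4 * (l + a)) = 7 * (7 * l - 5 * a + 8 * y - 8 * k)" using y by algebra
    then have "7 dvd l + a - 4 * (7 * a - 2 * y - 4 * (l + a))" by (simp only: dvd_triv_left)
    ultimately show "bwd w \<in> lattice_B" unfolding i unfolding lattice_B_def prod.case mem_Collect_eq by blast
  qed simp
qed

section \<open>The identities\<close>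

lemma F23_eq_0_disc:
  assumes "p \<noteq> 0" "norm p < 1" "u < 4"
  shows "F23 p u = 0"
proof -
  define y where "y = - 112 * ln (norm p) / (2 * pi)"
  have "norm p = exp (- (2 * pi * y / 112))" using assms by (simp add: y_def)
  then obtain \<tau> where "Im \<tau> = y" "nome \<tau> = p" by (rule nome_surj)
  moreover have "y > 0" using assms by (simp add: y_def field_simps)
  ultimately show ?thesis using F23_eq_0[of \<tau> u] assms by simp
qed

lemma theta_sum_power7: "theta_sum s (7 * N) p = theta_sum s N (p ^ 7)"
  unfolding theta_sum_def power_mult[symmetric] by (simp add: mult.assoc)

lemma theta_sum_multiples_7:
  assumes "\<And>n. w (7 * n) = w n"
  shows "theta_sum (\<lambda>n. w n * of_bool (7 dvd n)) N p = theta_sum w (7 * N) (p ^ 7)"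
proof -
  have "theta_sum (\<lambda>n. w n * of_bool (7 dvd n)) N p = (\<Sum>\<^sub>\<infinity>n\<in>range (\<lambda>m. 7 * m). of_real (w n) * p ^ (N * nat (n\<^sup>2)))"
    unfolding theta_sum_def by (rule infsum_cong_neutral) (auto simp: image_def dvd_def)
  also have "\<dots> = (\<Sum>\<^sub>\<infinity>m. of_real (w (7 * m)) * p ^ (N * nat ((7 * m)\<^sup>2)))"
    by (subst infsum_reindex) (auto simp: inj_def o_def)
  also have "\<dots> = theta_sum w (7 * N) (p ^ 7)"
    unfolding theta_sum_def assms power_mult[symmetric]
    by (simp add: power_mult_distrib nat_mult_distrib mult_ac)
  finally show ?thesis .
qed

lemma res_0: "res 0 n = of_bool (7 dvd n)" "res 0 (4 * n) = of_bool (7 dvd n)"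
  unfolding res_4 by (simp_all add: res_def)

text \<open>At index 0 all cosines are 1, so the residue classes recombine to the whole
  series.\<close>

lemma dft7_theta_vec_0:
  assumes "norm p < 1" "N > 0" "\<And>n. \<bar>w n\<bar> \<le> 1"
  shows "dft7 (theta_vec w a N p) 0 = theta_sum w N p"
  using theta_sum_cos7[where u = 0 and a = a and w = w, OF assms] by simp

lemma complex_root_exists:
  assumes "q \<noteq> 0" "norm q < 1" "n > 0"
  obtains p :: complex where "p ^ n = q" "p \<noteq> 0" "norm p < 1"
proof -
  define p where "p = exp (ln q / of_nat n)"
  have "p ^ n = q" using assms by (simp add: p_def exp_of_nat_mult[symmetric])
  moreover from this have "norm p ^ n < 1" using assms by (simp add: norm_power[symmetric])
  then have "norm p < 1" using assms by (metis not_less one_le_power)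
  ultimately show ?thesis using that by (simp add: p_def)
qed

text \<open>Component 0 of the transform removes the conditions modulo 7, and all series become
  theta functions of q = p^8.\<close>

lemma identity_1:
  assumes q: "q \<noteq> 0" "norm q < 1"
  shows "theta_psi q * ((theta_phi q)^2 - (theta_phi (q^7))^2) =
           4 * q * theta_psi (q^2) * theta_psi (q^7) * theta_phi (q^7)
         + 8 * q^2 * theta_psi (q^14) * theta_psi (q^3) * theta_phi (q^21)
         + 8 * q^4 * theta_psi (q^14) * theta_f q (q^2) * theta_f (q^7) (q^35)"
proof -
  obtain p where p: "p ^ 8 = q" "p \<noteq> 0" "norm p < 1" using complex_root_exists[OF q, of 8] by auto
  obtain S where S: "(ternary p has_sum S) lattice_A"
    "dft7 (g23 p) 0 * (dft7 (k3 p) 0)\<^sup>2 - 4 * S = dft7 (tri (g23 p) (k3 p)) 0"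
    using lattice_A_has_sum[OF p(3)] by blast
  have S_eq: "S = 2 * p ^ 14 * theta_psi (q ^ 14) *
     (2 * p ^ 3 * theta_psi (q ^ 3) * theta_phi (q ^ 21) + 2 * p ^ 19 * (theta_f q (q ^ 2) * theta_f (q ^ 7) (q ^ 35)))"
  proof (rule has_sum_unique[OF S(1)])
    have psi: "theta_sum odd_ind 14 p = 2 * p ^ 14 * theta_psi (q ^ 14)"
      using theta_psi_eq[OF p(3), of 14] unfolding p(1) by simp
    have "((\<lambda>(a, w). p ^ (14 * nat (a\<^sup>2)) * binary 1 7 p w) has_sum
       theta_sum odd_ind 14 p * (2 * p ^ (3 * 1) * theta_psi ((p ^ 8) ^ (3 * 1)) * theta_phi ((p ^ 8) ^ (3 * 7)) +
       2 * p ^ 19 * (theta_f ((p ^ 8) ^ 1) ((p ^ 8) ^ (2 * 1)) * theta_f ((p ^ 8) ^ 7) ((p ^ 8) ^ (5 * 7))))) ({a. odd a} \<times> plane_3)"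
      using has_sum_prod[OF theta_sum_has_sum[OF p(3), of 14 "{a. odd a}"] binary_has_sum[OF p(3), of 1 7 19]] by simp
    then show "(ternary p has_sum 2 * p ^ 14 * theta_psi (q ^ 14) *
     (2 * p ^ 3 * theta_psi (q ^ 3) * theta_phi (q ^ 21) + 2 * p ^ 19 * (theta_f q (q ^ 2) * theta_f (q ^ 7) (q ^ 35)))) lattice_A"
      unfolding lattice_A_split psi p(1) by simp
  qed
  have v: "dft7 (g23 p) 0 = 2 * p * theta_psi q" "dft7 (k3 p) 0 = theta_phi q" "dft7 (k2 p) 0 = 2 * p ^ 2 * theta_psi (q ^ 2)"
    "th3 p = theta_phi (q ^ 7)" "th23 p = 2 * p ^ 7 * theta_psi (q ^ 7)"
    using theta_psi_eq[OF p(3), of 1] theta_phi_eq[OF p(3), of 1] theta_psi_eq[OF p(3), of 2] theta_phi_eq[OF p(3), of 7] theta_psi_eq[OF p(3), of 7]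
    by (simp_all add: g23_def k3_def k2_def th3_def th23_def dft7_theta_vec_0 p)
  have "dft7 (F23 p) 0 = 0"
    using F23_eq_0_disc[OF p(2,3)] by (simp add: dft7_def)
  then have "dft7 (tri (g23 p) (k3 p)) 0 - (dft7 (g23 p) 0 * (th3 p)\<^sup>2 + 2 * dft7 (k2 p) 0 * th23 p * th3 p) = 0"
    using dft7_lin(1)[of "tri (g23 p) (k3 p)" "g23 p" "(th3 p)\<^sup>2" "k2 p" "th23 p" "th3 p" 0]
    unfolding F23_def[abs_def] by simp
  \<comment> \<open>The common factor is 2 p: the terms from S contribute 16 p^17 = 2 p * 8 q^2 and
    16 p^33 = 2 p * 8 q^4, the mixed term 8 p^9 = 2 p * 4 q.\<close>
  then have "2 * p * (theta_psi q * ((theta_phi q)^2 - (theta_phi (q^7))^2) -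
           (4 * p ^ 8 * theta_psi (q^2) * theta_psi (q^7) * theta_phi (q^7)
         + 8 * (p ^ 8)^2 * theta_psi (q^14) * theta_psi (q^3) * theta_phi (q^21)
         + 8 * (p ^ 8)^4 * theta_psi (q^14) * theta_f q (q^2) * theta_f (q^7) (q^35))) = 0"
    unfolding S(2)[symmetric] v S_eq by algebra
  then show ?thesis using p by simp
qed

text \<open>The component u = 0 keeps the multiples of 7, whose squares contribute a factor 49.
  Passing to x = p^7 with x^8 = q leaves one factor 7, which produces the arguments q^7 and
  q^14.\<close>

lemma identity_2:
  assumes q: "q \<noteq> 0" "norm q < 1"
  shows "7 * (theta_phi (q^7))^2 * theta_psi (q^7) =
           8 * q^2 * theta_psi (q^2) * theta_psi (q^21) * theta_phi (q^3)
         + 8 * theta_psi (q^2) * theta_f q (q^5) * theta_f (q^7) (q^14)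
         - 4 * q * theta_psi (q^14) * theta_psi q * theta_phi q
         - theta_psi (q^7) * (theta_phi q)^2"
proof -
  obtain p where p: "p ^ 56 = q" "p \<noteq> 0" "norm p < 1" using complex_root_exists[OF q, of 56] by auto
  define x where "x = p ^ 7"
  have x: "x ^ 8 = q" "x \<noteq> 0" "norm x < 1"
    using p by (auto simp: x_def power_mult[symmetric] norm_power power_Suc_less_one simp flip: power_mult intro: power_less_one_iff[THEN iffD2])
  have v: "g23 p 0 = 2 * x ^ 7 * theta_psi (q ^ 7)" "k3 p 0 = theta_phi (q ^ 7)" "k2 p 0 = 2 * x ^ 14 * theta_psi (q ^ 14)"
    "th3 p = theta_phi q" "th23 p = 2 * x * theta_psi q"
  proof -
    have "g23 p 0 = theta_sum odd_ind (7 * 1) x"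
      using theta_sum_multiples_7[of odd_ind 1 p] by (simp add: g23_def theta_vec_def res_0 x_def)
    then show "g23 p 0 = 2 * x ^ 7 * theta_psi (q ^ 7)" using theta_psi_eq[OF x(3), of 7] by (simp add: x(1))
    have "k3 p 0 = theta_sum (\<lambda>_. 1) (7 * 8) x"
      using theta_sum_multiples_7[of "\<lambda>_. 1" 8 p] by (simp add: k3_def theta_vec_def res_0 x_def)
    then show "k3 p 0 = theta_phi (q ^ 7)" using theta_phi_eq[OF x(3), of 7] by (simp add: x(1))
    have "k2 p 0 = theta_sum odd_ind (7 * 2) x"
      using theta_sum_multiples_7[of odd_ind 2 p]
      unfolding k2_def theta_vec_def of_nat_0 res_0(2) x_def by simp
    then show "k2 p 0 = 2 * x ^ 14 * theta_psi (q ^ 14)" using theta_psi_eq[OF x(3), of 14] by (simp add: x(1))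
    show "th3 p = theta_phi q" using theta_sum_power7[of "\<lambda>_. 1" 8 p] theta_phi_eq[OF x(3), of 1] by (simp add: th3_def x(1) x_def[symmetric])
    show "th23 p = 2 * x * theta_psi q" using theta_sum_power7[of odd_ind 1 p] theta_psi_eq[OF x(3), of 1] by (simp add: th23_def x(1) x_def[symmetric])
  qed
  have V: "g23 p 0 * (k3 p 0)\<^sup>2 + 2 * (g23 p 1 * k3 p 2 * k3 p 3 + g23 p 2 * k3 p 3 * k3 p 1 + g23 p 3 * k3 p 1 * k3 p 2) =
     2 * x ^ 2 * theta_psi (q ^ 2) *
     (2 * x ^ 21 * theta_psi (q ^ 21) * theta_phi (q ^ 3) + 2 * x ^ 5 * (theta_f (q ^ 7) (q ^ 14) * theta_f q (q ^ 5)))"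
  proof (rule has_sum_unique[OF lattice_B_has_sum[OF p(3)]])
    have psi: "theta_sum odd_ind 2 x = 2 * x ^ 2 * theta_psi (q ^ 2)"
      using theta_psi_eq[OF x(3), of 2] unfolding x(1) by simp
    have "((\<lambda>(a, w). x ^ (2 * nat (a\<^sup>2)) * binary 7 1 x w) has_sum
       theta_sum odd_ind 2 x * (2 * x ^ (3 * 7) * theta_psi ((x ^ 8) ^ (3 * 7)) * theta_phi ((x ^ 8) ^ (3 * 1)) +
       2 * x ^ 5 * (theta_f ((x ^ 8) ^ 7) ((x ^ 8) ^ (2 * 7)) * theta_f ((x ^ 8) ^ 1) ((x ^ 8) ^ (5 * 1))))) ({a. odd a} \<times> plane_3)"
      using has_sum_prod[OF theta_sum_has_sum[OF x(3), of 2 "{a. odd a}"] binary_has_sum[OF x(3), of 7 1 5]] by simp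
    then show "(ternary p has_sum 2 * x ^ 2 * theta_psi (q ^ 2) *
     (2 * x ^ 21 * theta_psi (q ^ 21) * theta_phi (q ^ 3) + 2 * x ^ 5 * (theta_f (q ^ 7) (q ^ 14) * theta_f q (q ^ 5)))) lattice_B"
      unfolding lattice_B_split[OF x_def] psi x(1) by simp
  qed
  have "tri (g23 p) (k3 p) 0 - (g23 p 0 * (th3 p)\<^sup>2 + 2 * k2 p 0 * th23 p * th3 p) = 0"
    using F23_eq_0_disc[OF p(2,3), of 0] by (simp add: F23_def)
  \<comment> \<open>The eight isotropic lines have equal sums V and share the origin, so half the
    sum over the cone is 4 * V minus 7/2 at the origin; \<open>tri\<close> subtracts another 7/2
    there. This is the 7 in the identity.\<close>
  moreover have "tri (g23 p) (k3 p) 0 = 4 * (g23 p 0 * (k3 p 0)\<^sup>2 + 2 * (g23 p 1 * k3 p 2 * k3 p 3 + g23 p 2 * k3 p 3 * k3 p 1 + g23 p 3 * k3 p 1 * k3 p 2))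
     - 7 * g23 p 0 * (k3 p 0)\<^sup>2"
    unfolding tri_simps by (simp add: algebra_simps)
  ultimately have F: "4 * (2 * x ^ 2 * theta_psi (q ^ 2) *
      (2 * x ^ 21 * theta_psi (q ^ 21) * theta_phi (q ^ 3) + 2 * x ^ 5 * (theta_f (q ^ 7) (q ^ 14) * theta_f q (q ^ 5))))
     - 7 * (2 * x ^ 7 * theta_psi (q ^ 7)) * (theta_phi (q ^ 7))\<^sup>2
     - (2 * x ^ 7 * theta_psi (q ^ 7) * (theta_phi q)\<^sup>2 + 2 * (2 * x ^ 14 * theta_psi (q ^ 14)) * (2 * x * theta_psi q) * theta_phi q) = 0"
    unfolding V unfolding v by simp
  have "2 * x ^ 7 * (7 * a\<^sup>2 * b - (8 * (x ^ 8)\<^sup>2 * c * d * e + 8 * c * f * g - 4 * x ^ 8 * h * i * j - b * j\<^sup>2)) =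
      - (4 * (2 * x ^ 2 * c * (2 * x ^ 21 * d * e + 2 * x ^ 5 * (g * f))) - 7 * (2 * x ^ 7 * b) * a\<^sup>2 -
        (2 * x ^ 7 * b * j\<^sup>2 + 2 * (2 * x ^ 14 * h) * (2 * x * i) * j))" for a b c d e f g h i j
    by algebra
  note * = this[of "theta_phi (q ^ 7)" "theta_psi (q ^ 7)" "theta_psi (q\<^sup>2)" "theta_psi (q ^ 21)" "theta_phi (q ^ 3)"
      "theta_f q (q ^ 5)" "theta_f (q ^ 7) (q ^ 14)" "theta_psi (q ^ 14)" "theta_psi q" "theta_phi q"]
  have "2 * x ^ 7 * (7 * (theta_phi (q^7))^2 * theta_psi (q^7) -
          (8 * (x ^ 8)^2 * theta_psi (q^2) * theta_psi (q^21) * theta_phi (q^3)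
         + 8 * theta_psi (q^2) * theta_f q (q^5) * theta_f (q^7) (q^14)
         - 4 * x ^ 8 * theta_psi (q^14) * theta_psi q * theta_phi q
         - theta_psi (q^7) * (theta_phi q)^2)) = 0"
    unfolding * F by simp
  then show ?thesis using x by simp
qed

lemma theta_f_0: "theta_f 0 0 = 1"
proof -
  have "theta_f 0 0 = theta_sum (\<lambda>_. 1) (8 * 1) 0"
    using theta_phi_eq[of 0 1] by (simp add: theta_phi_def)
  also have "\<dots> = (\<Sum>\<^sub>\<infinity>n\<in>{0::int}. 1)"
    unfolding theta_sum_def by (rule infsum_cong_neutral) auto
  finally show ?thesis by simp
qed

theorem theorem1p1:
  fixes q :: complex
  assumes "norm q < 1"
  shows "theta_psi q * ((theta_phi q)^2 - (theta_phi (q^7))^2) =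
           4 * q * theta_psi (q^2) * theta_psi (q^7) * theta_phi (q^7)
         + 8 * q^2 * theta_psi (q^14) * theta_psi (q^3) * theta_phi (q^21)
         + 8 * q^4 * theta_psi (q^14) * theta_f q (q^2) * theta_f (q^7) (q^35)
       \<and> 7 * (theta_phi (q^7))^2 * theta_psi (q^7) =
           8 * q^2 * theta_psi (q^2) * theta_psi (q^21) * theta_phi (q^3)
         + 8 * theta_psi (q^2) * theta_f q (q^5) * theta_f (q^7) (q^14)
         - 4 * q * theta_psi (q^14) * theta_psi q * theta_phi q
         - theta_psi (q^7) * (theta_phi q)^2"
proof (cases "q = 0")
  case True
  \<comment> \<open>0 is not a value of \<open>nome\<close>; here all theta values are 1, and the
    second identity reads 7 = 8 - 1.\<close>
  then show ?thesis by (simp add: theta_phi_def theta_psi_def theta_f_0)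
next
  case False
  then show ?thesis using identity_1[OF False assms] identity_2[OF False assms] by blast
qed

end
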